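(* In the general nested model with sampling described in the context (with parameters $g>0$, $f\in(0,1]$, $T>0$, diversification process $Z$ and $g\,\mathbb E(L)\ge1$), condition on $N:=N^f_T\ge1$ and let the sampled genera be labeled $0,\dots,N-1$ in the planar order. For $1\le i\le N-1$ let $A_i$ be the age at time $T$ of sampled genus $i$, $S_i\ge1$ its size (number of species at time $T$), and $H_i$ the coalescence time between sampled genera $i-1$ and $i$. Let $(H,A,S)$ be a random triple with the following law: (a) $A$ has density $\mathbb P(A\in da)=g\,e^{-\eta a}\,\mathbb P(L>a)\,da$ on $(0,\infty)$; (b) conditionally on $A$, $H$ and $S$ are independent; (c) $\displaystyle \mathbb P(H<h,\,A\in da)=\frac{f\,W(h-a)}{W_f(h)}\,g\,\mathbb P(L>a)\,da$ for $0<a\le h$, and in particular (letting $h\downarrow a$) $\displaystyle \mathbb P(H=A\in da)=\frac{f}{W_f(a)}\,g\,\mathbb P(L>a)\,da$; (d) $\mathbb P(S=k\mid A=a)=\mathbb P(Z_a=k\mid Z_a\neq0)$ for $k\ge1$, $a>0$, so that $\mathbb P(S=k,\,A\in da)=g\,\mathbb P(Z_a=k)\,e^{-\eta a}\,da$. Then the sequence $((H_i,A_i,S_i))_{1\le i\le N-1}$ is distributed as an i.i.d. sequence of copies of $(H,A,S)$ killed at the first index whose first component exceeds $T$: if $((H'_j,A'_j,S'_j))_{j\ge1}$ are i.i.d. copies of $(H,A,S)$ and $K:=\min\{j\ge1:H'_j>T\}$, then $\big(N-1,((H_i,A_i,S_i))_{1\le i\le N-1}\big)$ has the same law as $\big(K-1,((H'_j,A'_j,S'_j))_{1\le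 j\le K-1}\big)$.
   Context: General nested model: $(Z_t)_{t\ge0}$ is a time-homogeneous continuous-time Markov process on $\{0,1,2,\dots\}$ with $0$ absorbing and $Z_0=1$. Its lifetime is $L:=\inf\{t>0:Z_t=0\}$ (with $L=+\infty$ if $Z$ never hits $0$); assume $L$ has a (possibly defective) density $v$ on $(0,\infty)$. At time $0$ there is one genus (primordial genus). Each genus $i$, born at time $t_i$, carries its own species-count process $(Z^{(i)}_t)_{t\ge0}$ (its number of species at time $t_i+t$), the processes being i.i.d. copies of $Z$; a genus is extinct once its species count hits $0$. Each extant (non-extinct) genus gives birth, independently of everything and of its own species count, at rate $g>0$ to a daughter genus (whose species count starts afresh as a copy of $Z$); the mother's species count is unaffected. The process is stopped at time $T$; each genus extant at $T$ is independently sampled with probability $f\in(0,1]$, and $N^f_T$ denotes the number of sampled genera. Assume $g\,\mathbb E(L)\ge1$. Characteristic exponent: $\psi(x):=x-g+g\,\mathbb E(e^{-xL})$ for $x>0$. Malthusian parameter $\eta$: the unique positive root of $\psi$ if $g\,\mathbb E(L)>1$, and $\eta:=0$ if $g\,\mathbb E(L)=1$. Scale function: $W:[0,\infty)\to[1,\infty)$ is the unique increasing solution with $W(0)=1$ of $W'(t)=g\big(W(t)-\int_0^tW(u)\,v(t-u)\,du\big)$; equivalently $\int_0^\infty W(y)e^{-xy}\,dy=1/\psi(x)$ for $x>\eta$. Set $W_f(t):=1-f+fW(t)$. Planar order: the genealogical tree of all genera (including extinct ones) is ordered recursively depth-first: a genus comes first, followed by the ordered lists of the subtrees of its daughters taken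 in order of decreasing birth time (most recently born daughter first). Restricting to sampled genera gives labels $0,\dots,N^f_T-1$. Age of a genus at $T$: $T$ minus its birth time. Coalescence time of two genera: $T$ minus the last time at which their ancestral lineages (each genus's lineage followed back to its birth, then continued along its mother genus, and so on) coincide, i.e. a depth measured backward from $T$. *)

theory Defs
  imports "HOL-Probability.Probability"
begin

type_synonym path = "real \<Rightarrow> nat"
(* data attached to genus u: species-count path, interarrival times of its
   daughter births (Poisson process of rate g), sampling coin *)
type_synonym omega = "nat list \<Rightarrow> path \<times> (nat \<Rightarrow> real) \<times> bool"

definition lifetime :: "path \<Rightarrow> ereal" where
  "lifetime z = (if \<exists>t>0. z t = 0 then ereal (Inf {t. t > 0 \<and> z t = 0}) else \<infinity>)"

fun chain_prob :: "(real \<Rightarrow> nat \<Rightarrow> nat \<Rightarrow> real) \<Rightarrow> real \<Rightarrow> nat \<Rightarrow> real list \<Rightarrow> nat list \<Rightarrow> real" where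
  "chain_prob p t0 j0 (t # ts) (j # js) = p (t - t0) j0 j * chain_prob p t j ts js"
| "chain_prob p t0 j0 _ _ = 1"

definition nat_markov_process :: "path measure \<Rightarrow> bool" where
  "nat_markov_process MZ \<longleftrightarrow> prob_space MZ \<and>
     (\<lambda>(t, z). z t) \<in> measurable (borel \<Otimes>\<^sub>M MZ) (count_space UNIV) \<and>
     (\<exists>p. (\<forall>i j. p 0 i j = (if i = j then 1 else 0)) \<and> (\<forall>t\<ge>0. p t 0 0 = 1) \<and>
        (\<forall>ts js. sorted_wrt (<) ts \<and> (\<forall>t\<in>set ts. 0 \<le> t) \<and> length js = length ts \<longrightarrow>
           measure MZ {z \<in> space MZ. list_all2 (\<lambda>t j. z t = j) ts js} = chain_prob p 0 1 ts js)) \<and>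
     (AE z in MZ. \<forall>t\<ge>0. \<exists>e>0. \<forall>s. t \<le> s \<and> s < t + e \<longrightarrow> z s = z t)"

definition lifetime_density :: "path measure \<Rightarrow> (real \<Rightarrow> real) \<Rightarrow> bool" where
  "lifetime_density MZ v \<longleftrightarrow> (\<forall>t>0. v t \<ge> 0) \<and> set_integrable lborel {0<..} v \<and>
     (\<forall>t>0. measure MZ {z \<in> space MZ. lifetime z \<le> ereal t} = (LINT s:{0<..t}|lborel. v s))"

definition expected_lifetime :: "path measure \<Rightarrow> ennreal" where
  "expected_lifetime MZ = (\<integral>\<^sup>+ z. e2ennreal (lifetime z) \<partial>MZ)"

definition exp_neg_L :: "real \<Rightarrow> path \<Rightarrow> real" where
  "exp_neg_L x z = (if lifetime z = \<infinity> then 0 else exp (- x * real_of_ereal (lifetime z)))"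

definition char_exp :: "real \<Rightarrow> path measure \<Rightarrow> real \<Rightarrow> real" where
  "char_exp g MZ x = x - g + g * (\<integral>z. exp_neg_L x z \<partial>MZ)"

definition malthus :: "real \<Rightarrow> path measure \<Rightarrow> real" where
  "malthus g MZ = (if ennreal g * expected_lifetime MZ > 1
                   then (THE x. x > 0 \<and> char_exp g MZ x = 0) else 0)"

definition scale_function :: "real \<Rightarrow> (real \<Rightarrow> real) \<Rightarrow> (real \<Rightarrow> real) \<Rightarrow> bool" where
  "scale_function g v W \<longleftrightarrow> W 0 = 1 \<and> mono_on {0..} W \<and> continuous_on {0..} W \<and>
     (\<forall>t>0. (W has_real_derivative g * (W t - (LINT u:{0..t}|lborel. W u * v (t - u)))) (at t))"

definition Wf :: "real \<Rightarrow> (real \<Rightarrow> real) \<Rightarrow> real \<Rightarrow> real" where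
  "Wf f W t = 1 - f + f * W t"

definition PL :: "path measure \<Rightarrow> real \<Rightarrow> real" where
  "PL MZ a = measure MZ {z \<in> space MZ. lifetime z > ereal a}"

definition PZ :: "path measure \<Rightarrow> real \<Rightarrow> nat \<Rightarrow> real" where
  "PZ MZ a k = measure MZ {z \<in> space MZ. z a = k}"

definition HAS_law :: "real \<Rightarrow> real \<Rightarrow> path measure \<Rightarrow> (real \<Rightarrow> real) \<Rightarrow> (real \<times> real \<times> nat) measure \<Rightarrow> bool" where
  "HAS_law g f MZ W \<mu> \<longleftrightarrow>
     prob_space \<mu> \<and> sets \<mu> = sets (borel \<Otimes>\<^sub>M borel \<Otimes>\<^sub>M count_space UNIV) \<and>
     \<comment> \<open>(a)\<close>
     distr \<mu> lborel (\<lambda>x. fst (snd x)) =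
       density lborel (\<lambda>a. ennreal (indicator {0<..} a * g * exp (- malthus g MZ * a) * PL MZ a)) \<and>
     \<comment> \<open>(b) H and S conditionally independent given A\<close>
     (\<forall>B C. B \<in> sets borel \<longrightarrow>
        (AE x in \<mu>.
          real_cond_exp \<mu> (vimage_algebra (space \<mu>) (\<lambda>y. fst (snd y)) borel)
             (\<lambda>y. indicator B (fst y) * indicator C (snd (snd y))) x =
          real_cond_exp \<mu> (vimage_algebra (space \<mu>) (\<lambda>y. fst (snd y)) borel) (\<lambda>y. indicator B (fst y)) x *
          real_cond_exp \<mu> (vimage_algebra (space \<mu>) (\<lambda>y. fst (snd y)) borel) (\<lambda>y. indicator C (snd (snd y))) x)) \<and>
     \<comment> \<open>(c)\<close>
     (\<forall>h D. D \<in> sets borel \<longrightarrow>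
        measure \<mu> {x \<in> space \<mu>. fst x < h \<and> fst (snd x) \<in> D} =
          (LINT a:D \<inter> {0<..<h}|lborel. f * W (h - a) / Wf f W h * g * PL MZ a)) \<and>
     (\<forall>D. D \<in> sets borel \<longrightarrow>
        measure \<mu> {x \<in> space \<mu>. fst x = fst (snd x) \<and> fst (snd x) \<in> D} =
          (LINT a:D \<inter> {0<..}|lborel. f / Wf f W a * g * PL MZ a)) \<and>
     \<comment> \<open>(d)\<close>
     (\<forall>k D. k \<ge> 1 \<longrightarrow> D \<in> sets borel \<longrightarrow>
        measure \<mu> {x \<in> space \<mu>. snd (snd x) = k \<and> fst (snd x) \<in> D} =
          (LINT a:D \<inter> {0<..}|lborel. g * PZ MZ a k * exp (- malthus g MZ * a)))"

definition genus_model :: "real \<Rightarrow> real \<Rightarrow> path measure \<Rightarrow> omega measure" where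
  "genus_model g f MZ = (\<Pi>\<^sub>M u\<in>UNIV.
      MZ \<Otimes>\<^sub>M (\<Pi>\<^sub>M k\<in>UNIV. density lborel (exponential_density g)) \<Otimes>\<^sub>M measure_pmf (bernoulli_pmf f))"

definition gpath :: "omega \<Rightarrow> nat list \<Rightarrow> path" where "gpath \<omega> u = fst (\<omega> u)"
definition ginter :: "omega \<Rightarrow> nat list \<Rightarrow> nat \<Rightarrow> real" where "ginter \<omega> u = fst (snd (\<omega> u))"
definition gcoin :: "omega \<Rightarrow> nat list \<Rightarrow> bool" where "gcoin \<omega> u = snd (snd (\<omega> u))"

text \<open>age of mother u at the birth of its k-th daughter (k = 0,1,... in increasing birth time)\<close>
definition daughter_age :: "omega \<Rightarrow> nat list \<Rightarrow> nat \<Rightarrow> real" where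
  "daughter_age \<omega> u k = (\<Sum>j\<le>k. ginter \<omega> u j)"

text \<open>Walking down an Ulam-Harris label: (does the genus exist, its birth time).
  A daughter is born only while the mother is extant (age < lifetime).\<close>
fun gen_info :: "omega \<Rightarrow> nat list \<Rightarrow> real \<Rightarrow> nat list \<Rightarrow> bool \<times> real" where
  "gen_info \<omega> p t [] = (True, t)"
| "gen_info \<omega> p t (k # ks) = (let s = daughter_age \<omega> p k in
     if ereal s < lifetime (gpath \<omega> p) then gen_info \<omega> (p @ [k]) (t + s) ks else (False, t + s))"

definition born :: "omega \<Rightarrow> nat list \<Rightarrow> bool" where "born \<omega> u = fst (gen_info \<omega> [] 0 u)"
definition btime :: "omega \<Rightarrow> nat list \<Rightarrow> real" where "btime \<omega> u = snd (gen_info \<omega> [] 0 u)"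

definition extant_at :: "real \<Rightarrow> omega \<Rightarrow> nat list \<Rightarrow> bool" where
  "extant_at T \<omega> u \<longleftrightarrow> born \<omega> u \<and> btime \<omega> u \<le> T \<and> ereal (T - btime \<omega> u) < lifetime (gpath \<omega> u)"

definition sampled_set :: "real \<Rightarrow> omega \<Rightarrow> nat list set" where
  "sampled_set T \<omega> = {u. extant_at T \<omega> u \<and> gcoin \<omega> u}"

definition Nsamp :: "real \<Rightarrow> omega \<Rightarrow> nat" where
  "Nsamp T \<omega> = card (sampled_set T \<omega>)"

text \<open>Planar (depth-first) order: a genus precedes its descendants; daughter subtrees
  are taken in decreasing birth time, i.e. decreasing daughter index.\<close>
definition planar_less :: "nat list \<Rightarrow> nat list \<Rightarrow> bool" where
  "planar_less u v \<longleftrightarrow> (\<exists>w. w \<noteq> [] \<and> v = u @ w) \<or>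
     (\<exists>w a b x y. b < a \<and> u = w @ a # x \<and> v = w @ b # y)"

definition sgen :: "real \<Rightarrow> omega \<Rightarrow> nat \<Rightarrow> nat list" where
  "sgen T \<omega> i = (THE u. u \<in> sampled_set T \<omega> \<and> card {v \<in> sampled_set T \<omega>. planar_less v u} = i)"

definition anc :: "omega \<Rightarrow> nat list \<Rightarrow> real \<Rightarrow> nat list" where
  "anc \<omega> u s = take (GREATEST j. j \<le> length u \<and> btime \<omega> (take j u) \<le> s) u"

definition coal_time :: "real \<Rightarrow> omega \<Rightarrow> nat list \<Rightarrow> nat list \<Rightarrow> real" where
  "coal_time T \<omega> u v = T - Sup {s. 0 \<le> s \<and> s \<le> T \<and> anc \<omega> u s = anc \<omega> v s}"

definition sampled_triple :: "real \<Rightarrow> omega \<Rightarrow> nat \<Rightarrow> real \<times> real \<times> nat" where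
  "sampled_triple T \<omega> i =
     (coal_time T \<omega> (sgen T \<omega> (i - 1)) (sgen T \<omega> i),
      T - btime \<omega> (sgen T \<omega> i),
      gpath \<omega> (sgen T \<omega> i) (T - btime \<omega> (sgen T \<omega> i)))"

end

theory Submission
  imports Defs
begin

text \<open>
  Fix a finite list of tests on triples. For a tree of depth \<open>t\<close> let \<open>x(t, As)\<close> be the probability that the list of its
  sampled genera, read in planar order, passes the tests \<open>As\<close>, and let \<open>y(t, c, As)\<close> be the same probability when only
  the subtrees of the daughters born before the root reaches age \<open>c\<close> are kept. The subtree of the first-born
  daughter is the last block of the traversal, so conditioning on her birth time expresses \<open>y\<close> as an integral of
  convolutions of \<open>y\<close> and \<open>x\<close> at smaller depths, while conditioning on the lifetime and the sampling of the root expresses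
  \<open>x\<close> through \<open>y\<close>. By a Gronwall argument this system has a single bounded solution.

  Writing \<open>M\<^sub>t\<close> for the law of \<open>(H, A, S)\<close> restricted to \<open>H \<le> t\<close> and \<open>G\<^sub>t\<close> for the law of the killed sequence, that is
  \<open>G\<^sub>t = W\<^sub>f(t)\<inverse> \<Sum>\<^sub>n M\<^sub>t\<^sup>\<otimes>\<^sup>n = (W\<^sub>f(t) (1 - M\<^sub>t))\<inverse>\<close> in the tensor algebra, independence of the Poisson births in disjoint time
  windows suggests \<open>y(t, c) = G\<^sub>r\<inverse> G\<^sub>t\<close> with \<open>r = t - c\<close>. This guess solves the system because \<open>G' = g (G \<theta> G - (1 - q) G)\<close>, where \<open>q\<close> is
  the probability that no genus is sampled and \<open>\<theta> = W\<^sub>f M' / g\<close> turns out to be the law of the first sampled genus. Hence,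
  given that some genus is sampled, the remaining list has law \<open>G\<^sub>T\<close>. The Malthusian parameter drops out.
\<close>

section \<open>The planar order\<close>

lemma planar_less_Nil_left [simp]: "planar_less [] v \<longleftrightarrow> v \<noteq> []"
  by (auto simp: planar_less_def)

lemma planar_less_Nil_right [simp]: "\<not> planar_less u []"
  by (auto simp: planar_less_def)

lemma planar_less_Cons [simp]:
  "planar_less (k # u) (l # v) \<longleftrightarrow> l < k \<or> k = l \<and> planar_less u v"
proof
  assume "planar_less (k # u) (l # v)"
  then show "l < k \<or> k = l \<and> planar_less u v"
    unfolding planar_less_def
  proof (elim disjE exE conjE)
    fix w a b x y assume *: "b < a" "k # u = w @ a # x" "l # v = w @ b # y"
    show "l < k \<or> k = l \<and> ((\<exists>w. w \<noteq> [] \<and> v = u @ w) \<or>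
        (\<exists>w a b x y. b < a \<and> u = w @ a # x \<and> v = w @ b # y))"
      using * by (cases w) auto
  qed auto
next
  assume "l < k \<or> k = l \<and> planar_less u v"
  then show "planar_less (k # u) (l # v)"
  proof (elim disjE conjE)
    assume "l < k"
    then have "l < k \<and> k # u = [] @ k # u \<and> l # v = [] @ l # v" by simp
    then show ?thesis unfolding planar_less_def by blast
  next
    assume kl: "k = l" and "planar_less u v"
    then consider w where "w \<noteq> []" "v = u @ w"
      | w a b x y where "b < a" "u = w @ a # x" "v = w @ b # y"
      unfolding planar_less_def by blast
    then show ?thesis
    proof cases
      case (2 w a b x y)
      then have "b < a \<and> k # u = (k # w) @ a # x \<and> l # v = (k # w) @ b # y"
        using kl by simp
      then show ?thesis unfolding planar_less_def by blast
    qed (use kl in \<open>simp add: planar_less_def\<close>)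
  qed
qed

lemma planar_less_irrefl: "\<not> planar_less u u"
  by (induction u) auto

lemma planar_less_trans: "planar_less u v \<Longrightarrow> planar_less v w \<Longrightarrow> planar_less u w"
proof (induction u arbitrary: v w)
  case Nil
  then show ?case by (cases v; cases w) auto
next
  case (Cons k u)
  then show ?case by (cases v; cases w) auto
qed

lemma planar_less_total: "planar_less u v \<or> u = v \<or> planar_less v u"
proof (induction u arbitrary: v)
  case Nil
  then show ?case by auto
next
  case (Cons k u)
  then show ?case by (cases v) auto
qed

interpretation planar: linorder "\<lambda>u v. planar_less u v \<or> u = v" planar_less
  by unfold_locales
    (use planar_less_irrefl planar_less_trans planar_less_total in blast)+

section \<open>Recursive structure of the genealogical tree\<close>

definition sub :: "omega \<Rightarrow> nat \<Rightarrow> omega" where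
  "sub \<omega> k = (\<lambda>u. \<omega> (k # u))"

lemma sub_data [simp]:
  "gpath (sub \<omega> k) u = gpath \<omega> (k # u)" "ginter (sub \<omega> k) u = ginter \<omega> (k # u)"
  "gcoin (sub \<omega> k) u = gcoin \<omega> (k # u)" "daughter_age (sub \<omega> k) u = daughter_age \<omega> (k # u)"
  by (auto simp: sub_def gpath_def ginter_def gcoin_def daughter_age_def fun_eq_iff)

abbreviation age :: "omega \<Rightarrow> nat \<Rightarrow> real" where
  "age \<omega> k \<equiv> daughter_age \<omega> [] k"

text \<open>Unlike \<^const>\<open>btime\<close>, this ignores whether the mothers live long enough.\<close>
fun bt :: "omega \<Rightarrow> nat list \<Rightarrow> real" where
  "bt \<omega> [] = 0"
| "bt \<omega> (k # u) = age \<omega> k + bt (sub \<omega> k) u"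

fun bornr :: "omega \<Rightarrow> nat list \<Rightarrow> bool" where
  "bornr \<omega> [] = True"
| "bornr \<omega> (k # u) = (ereal (age \<omega> k) < lifetime (gpath \<omega> []) \<and> bornr (sub \<omega> k) u)"

fun alive :: "real \<Rightarrow> omega \<Rightarrow> nat list \<Rightarrow> bool" where
  "alive t \<omega> [] = (0 \<le> t \<and> ereal t < lifetime (gpath \<omega> []) \<and> gcoin \<omega> [])"
| "alive t \<omega> (k # u) = (ereal (age \<omega> k) < lifetime (gpath \<omega> []) \<and> alive (t - age \<omega> k) (sub \<omega> k) u)"

definition subs :: "omega \<Rightarrow> nat list \<Rightarrow> omega" where
  "subs \<omega> p = (\<lambda>u. \<omega> (p @ u))"

lemma subs_data [simp]:
  "gpath (subs \<omega> p) u = gpath \<omega> (p @ u)" "ginter (subs \<omega> p) u = ginter \<omega> (p @ u)"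
  "gcoin (subs \<omega> p) u = gcoin \<omega> (p @ u)" "daughter_age (subs \<omega> p) u = daughter_age \<omega> (p @ u)"
  by (auto simp: subs_def gpath_def ginter_def gcoin_def daughter_age_def fun_eq_iff)

lemma sub_subs: "sub (subs \<omega> p) k = subs \<omega> (p @ [k])"
  by (auto simp: sub_def subs_def)

lemma subs_Nil [simp]: "subs \<omega> [] = \<omega>"
  by (auto simp: subs_def)

lemma gen_info_eq:
  "fst (gen_info \<omega> p t u) = bornr (subs \<omega> p) u \<and>
   (bornr (subs \<omega> p) u \<longrightarrow> snd (gen_info \<omega> p t u) = t + bt (subs \<omega> p) u)"
  by (induction u arbitrary: p t) (auto simp: Let_def sub_subs)

lemma born_eq: "born \<omega> u = bornr \<omega> u"
  and btime_eq: "bornr \<omega> u \<Longrightarrow> btime \<omega> u = bt \<omega> u"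
  using gen_info_eq[of \<omega> "[]" 0 u] by (auto simp: born_def btime_def)

lemma alive_iff:
  "alive t \<omega> u \<longleftrightarrow> bornr \<omega> u \<and> bt \<omega> u \<le> t \<and> ereal (t - bt \<omega> u) < lifetime (gpath \<omega> u) \<and> gcoin \<omega> u"
  by (induction u arbitrary: t \<omega>) (auto simp: diff_diff_eq algebra_simps)

lemma sampled_set_eq: "sampled_set t \<omega> = {u. alive t \<omega> u}"
  by (auto simp: sampled_set_def extant_at_def alive_iff born_eq btime_eq)

lemma bornr_take: "bornr \<omega> u \<Longrightarrow> bornr \<omega> (take j u)"
proof (induction u arbitrary: \<omega> j)
  case (Cons k u)
  then show ?case by (cases j) auto
qed auto

definition good :: "omega \<Rightarrow> bool" where
  "good \<omega> \<longleftrightarrow> (\<forall>u j. ginter \<omega> u j > 0)"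

lemma good_sub: "good \<omega> \<Longrightarrow> good (sub \<omega> k)"
  by (auto simp: good_def)

lemma age_pos: "good \<omega> \<Longrightarrow> age \<omega> k > 0"
  unfolding daughter_age_def by (intro sum_pos) (auto simp: good_def)

lemma age_less: "good \<omega> \<Longrightarrow> j < k \<Longrightarrow> age \<omega> j < age \<omega> k"
  unfolding daughter_age_def by (rule sum_strict_mono2[where b = k]) (auto simp: good_def less_imp_le)

lemma bt_nonneg: "good \<omega> \<Longrightarrow> bt \<omega> u \<ge> 0"
proof (induction u arbitrary: \<omega>)
  case (Cons k u)
  then show ?case using age_pos[of \<omega> k] good_sub[of \<omega> k] by (auto intro!: add_nonneg_nonneg less_imp_le)
qed auto

lemma bt_append: "bt \<omega> (u @ w) = bt \<omega> u + bt (subs \<omega> u) w"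
proof (induction u arbitrary: \<omega>)
  case (Cons k u)
  have "subs (sub \<omega> k) u = subs \<omega> (k # u)" by (auto simp: sub_def subs_def)
  then show ?case using Cons by simp
qed auto

lemma good_subs: "good \<omega> \<Longrightarrow> good (subs \<omega> p)"
  by (auto simp: good_def)

lemma bt_pos: "good \<omega> \<Longrightarrow> u \<noteq> [] \<Longrightarrow> bt \<omega> u > 0"
  using age_pos bt_nonneg good_sub by (cases u) (auto intro!: add_pos_nonneg)

lemma bt_take_mono: "good \<omega> \<Longrightarrow> i \<le> j \<Longrightarrow> bt \<omega> (take i u) \<le> bt \<omega> (take j u)"
proof -
  assume g: "good \<omega>" and ij: "i \<le> j"
  have "take j u = take i u @ take (j - i) (drop i u)"
    using ij by (metis le_add_diff_inverse take_add)
  then show ?thesis using bt_append bt_nonneg[OF good_subs[OF g]] by simp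
qed

lemma alive_nonneg: "good \<omega> \<Longrightarrow> alive t \<omega> u \<Longrightarrow> t \<ge> 0"
  using bt_nonneg[of \<omega> u] by (auto simp: alive_iff)

section \<open>Lists of triples read off a planar traversal\<close>

fun lcp :: "nat list \<Rightarrow> nat list \<Rightarrow> nat" where
  "lcp (k # u) (l # v) = (if k = l then Suc (lcp u v) else 0)"
| "lcp _ _ = 0"

definition trip :: "real \<Rightarrow> omega \<Rightarrow> nat list \<Rightarrow> nat list \<Rightarrow> real \<times> real \<times> nat" where
  "trip t \<omega> u v = (t - bt \<omega> (take (Suc (lcp u v)) v), t - bt \<omega> v, gpath \<omega> v (t - bt \<omega> v))"

fun walk :: "real \<Rightarrow> omega \<Rightarrow> nat list \<Rightarrow> nat list list \<Rightarrow> (real \<times> real \<times> nat) list" where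
  "walk t \<omega> u [] = []"
| "walk t \<omega> u (v # vs) = trip t \<omega> u v # walk t \<omega> v vs"

text \<open>The first genus of a subtree has no predecessor in it; its first component is set to the
  depth \<open>t\<close> of the root, which is its coalescence depth with whatever precedes the subtree.\<close>
fun info :: "real \<Rightarrow> omega \<Rightarrow> nat list list \<Rightarrow> (real \<times> real \<times> nat) list" where
  "info t \<omega> [] = []"
| "info t \<omega> (v # vs) = (t, t - bt \<omega> v, gpath \<omega> v (t - bt \<omega> v)) # walk t \<omega> v vs"

lemma length_walk [simp]: "length (walk t \<omega> u vs) = length vs"
  by (induction vs arbitrary: u) auto

lemma walk_append: "walk t \<omega> u (xs @ ys) = walk t \<omega> u xs @ walk t \<omega> (last (u # xs)) ys"
  by (induction xs arbitrary: u) auto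

lemma trip_Cons: "trip t \<omega> (k # u) (k # v) = trip (t - age \<omega> k) (sub \<omega> k) u v"
  by (auto simp: trip_def algebra_simps)

lemma walk_Cons: "walk t \<omega> (k # u) (map ((#) k) vs) = walk (t - age \<omega> k) (sub \<omega> k) u vs"
  by (induction vs arbitrary: u) (auto simp: trip_Cons)

lemma walk_info:
  assumes "u = [] \<or> hd u \<noteq> k"
  shows "walk t \<omega> u (map ((#) k) vs) = info (t - age \<omega> k) (sub \<omega> k) vs"
proof (cases vs)
  case (Cons v vs')
  have "lcp u (k # v) = 0" using assms by (cases u) auto
  then show ?thesis using Cons by (simp add: walk_Cons trip_def algebra_simps)
qed simp

text \<open>Deletes the first-born daughter of the root together with her subtree and starts time at her birth.\<close>
definition tlw :: "omega \<Rightarrow> omega" where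
  "tlw \<omega> u = (case u of [] \<Rightarrow> (gpath \<omega> [], \<lambda>j. ginter \<omega> [] (Suc j), gcoin \<omega> []) | k # w \<Rightarrow> \<omega> (Suc k # w))"

fun bump :: "nat list \<Rightarrow> nat list" where
  "bump [] = []"
| "bump (k # u) = Suc k # u"

lemma sub_tlw [simp]: "sub (tlw \<omega>) k = sub \<omega> (Suc k)"
  by (auto simp: sub_def tlw_def)

lemma age_tlw: "age \<omega> (Suc k) = ginter \<omega> [] 0 + age (tlw \<omega>) k"
  unfolding daughter_age_def by (subst sum.atMost_Suc_shift) (simp add: tlw_def ginter_def)

lemma age_0: "age \<omega> 0 = ginter \<omega> [] 0"
  by (simp add: daughter_age_def)

lemma good_tlw: "good \<omega> \<Longrightarrow> good (tlw \<omega>)"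
  by (auto simp: good_def tlw_def ginter_def split: list.splits)

lemma bt_bump: "u \<noteq> [] \<Longrightarrow> bt \<omega> (bump u) = ginter \<omega> [] 0 + bt (tlw \<omega>) u"
  by (cases u) (auto simp: age_tlw)

lemma gpath_bump: "u \<noteq> [] \<Longrightarrow> gpath \<omega> (bump u) = gpath (tlw \<omega>) u"
  by (cases u) (auto simp: gpath_def tlw_def)

lemma lcp_bump: "lcp (bump u) (bump v) = lcp u v"
  by (cases u; cases v) auto

lemma take_Suc_bump: "take (Suc i) (bump v) = bump (take (Suc i) v)"
  by (cases v) auto

lemma trip_bump: "v \<noteq> [] \<Longrightarrow> trip t \<omega> (bump u) (bump v) = trip (t - ginter \<omega> [] 0) (tlw \<omega>) u v"
  by (auto simp: trip_def lcp_bump take_Suc_bump bt_bump gpath_bump algebra_simps)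

lemma walk_bump:
  "[] \<notin> set vs \<Longrightarrow> walk t \<omega> (bump u) (map bump vs) = walk (t - ginter \<omega> [] 0) (tlw \<omega>) u vs"
  by (induction vs arbitrary: u) (auto simp: trip_bump)

definition Yset :: "real \<Rightarrow> real \<Rightarrow> omega \<Rightarrow> nat list set" where
  "Yset t c \<omega> = {k # u | k u. age \<omega> k < c \<and> age \<omega> k \<le> t \<and> alive (t - age \<omega> k) (sub \<omega> k) u}"

lemma Nil_notin_Yset [simp]: "[] \<notin> Yset t c \<omega>"
  by (auto simp: Yset_def)

lemma Cons_in_Yset [simp]:
  "k # u \<in> Yset t c \<omega> \<longleftrightarrow> age \<omega> k < c \<and> age \<omega> k \<le> t \<and> alive (t - age \<omega> k) (sub \<omega> k) u"
  by (auto simp: Yset_def)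

definition root_bound :: "real \<Rightarrow> omega \<Rightarrow> real" where
  "root_bound t \<omega> = (if ereal t < lifetime (gpath \<omega> []) then t + 1 else real_of_ereal (lifetime (gpath \<omega> [])))"

lemma lifetime_nonneg: "lifetime z \<ge> 0"
  by (auto simp: lifetime_def intro!: cInf_greatest)

lemma alive_set_eq:
  assumes "good \<omega>" "t \<ge> 0"
  shows "{u. alive t \<omega> u} = (if ereal t < lifetime (gpath \<omega> []) \<and> gcoin \<omega> [] then {[]} else {}) \<union>
    Yset t (root_bound t \<omega>) \<omega>"
proof (intro set_eqI)
  fix u
  show "u \<in> {u. alive t \<omega> u} \<longleftrightarrow> u \<in> (if ereal t < lifetime (gpath \<omega> []) \<and> gcoin \<omega> [] then {[]} else {}) \<union>
    Yset t (root_bound t \<omega>) \<omega>"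
  proof (cases u)
    case (Cons k w)
    have "age \<omega> k \<le> t" if "alive (t - age \<omega> k) (sub \<omega> k) w"
      using alive_nonneg[OF good_sub[OF assms(1)] that] by simp
    moreover have "ereal (age \<omega> k) < lifetime (gpath \<omega> []) \<longleftrightarrow> age \<omega> k < root_bound t \<omega>" if "age \<omega> k \<le> t"
    proof (cases "ereal t < lifetime (gpath \<omega> [])")
      case True
      then have "ereal (age \<omega> k) < lifetime (gpath \<omega> [])"
        using that by (metis ereal_less_eq(3) le_less_trans)
      then show ?thesis using that True by (auto simp: root_bound_def)
    next
      case False
      then obtain l where "lifetime (gpath \<omega> []) = ereal l"
        using lifetime_nonneg[of "gpath \<omega> []"] by (cases "lifetime (gpath \<omega> [])") auto
      then show ?thesis using False by (auto simp: root_bound_def)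
    qed
    ultimately show ?thesis using Cons by auto
  qed (use assms in auto)
qed

lemma Yset_rec:
  assumes "good \<omega>"
  defines "s \<equiv> ginter \<omega> [] 0"
  shows "Yset t c \<omega> = (if s < c \<and> s \<le> t
    then bump ` Yset (t - s) (c - s) (tlw \<omega>) \<union> (#) 0 ` {u. alive (t - s) (sub \<omega> 0) u} else {})"
proof (cases "s < c \<and> s \<le> t")
  case False
  have "age \<omega> k \<ge> s" for k
    using age_less[OF assms(1), of 0 k] by (cases k) (auto simp: age_0 s_def)
  then have "\<not> (age \<omega> k < c \<and> age \<omega> k \<le> t)" for k using False by (meson le_less_trans order_trans)
  then show ?thesis using False by (auto simp: Yset_def)
next
  case True
  show ?thesis
  proof (intro set_eqI)
    fix u
    have "k # w \<in> Yset t c \<omega> \<longleftrightarrow> k # w \<in> bump ` Yset (t - s) (c - s) (tlw \<omega>) \<union> (#) 0 ` {u. alive (t - s) (sub \<omega> 0) u}" for k w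
    proof (cases k)
      case 0
      have "0 # w \<notin> bump ` Yset (t - s) (c - s) (tlw \<omega>)"
        by (auto simp: Yset_def)
      then show ?thesis using 0 True by (auto simp: age_0 s_def)
    next
      case (Suc j)
      have "k # w \<in> bump ` Yset (t - s) (c - s) (tlw \<omega>) \<longleftrightarrow> j # w \<in> Yset (t - s) (c - s) (tlw \<omega>)"
        by (auto simp: Yset_def Suc image_iff intro!: exI)
      then show ?thesis using Suc True
        by (auto simp: age_tlw s_def algebra_simps)
    qed
    moreover have "[] \<notin> bump ` Yset (t - s) (c - s) (tlw \<omega>)"
      by (auto simp: Yset_def)
    ultimately show "u \<in> Yset t c \<omega> \<longleftrightarrow> u \<in> (if s < c \<and> s \<le> t
      then bump ` Yset (t - s) (c - s) (tlw \<omega>) \<union> (#) 0 ` {u. alive (t - s) (sub \<omega> 0) u} else {})"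
      using True by (cases u) auto
  qed
qed

text \<open>A test \<open>(b, D, K)\<close> stands for the box \<open>H \<le> b\<close>, \<open>A \<in> D\<close>, \<open>S \<in> K\<close>. Half-lines suffice for \<open>H\<close>, and
  they make the test of the first genus of a subtree insensitive to replacing its \<open>H\<close> by the depth of the root.\<close>
type_synonym test = "real \<times> real set \<times> nat set"

fun tmem :: "real \<times> real \<times> nat \<Rightarrow> test \<Rightarrow> bool" where
  "tmem (h, a, s) (b, D, K) \<longleftrightarrow> h \<le> b \<and> a \<in> D \<and> s \<in> K"

definition Xmatch :: "real \<Rightarrow> omega \<Rightarrow> test list \<Rightarrow> bool" where
  "Xmatch t \<omega> As \<longleftrightarrow> (\<exists>us. sorted_wrt planar_less us \<and> set us = {u. alive t \<omega> u} \<and> list_all2 tmem (info t \<omega> us) As)"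

definition Ymatch :: "real \<Rightarrow> real \<Rightarrow> omega \<Rightarrow> test list \<Rightarrow> bool" where
  "Ymatch t c \<omega> As \<longleftrightarrow> (\<exists>us. sorted_wrt planar_less us \<and> set us = Yset t c \<omega> \<and> list_all2 tmem (walk t \<omega> [] us) As)"

lemma sorted_planar_card: "sorted_wrt planar_less us \<Longrightarrow> length us = card (set us)"
  using planar.strict_sorted_iff distinct_card by metis

lemma Ymatch_card: "Ymatch t c \<omega> As \<Longrightarrow> finite (Yset t c \<omega>) \<and> card (Yset t c \<omega>) = length As"
  unfolding Ymatch_def by (metis List.finite_set length_walk list_all2_lengthD sorted_planar_card)

lemma Ymatch_sorted:
  assumes "sorted_wrt planar_less us" "set us = Yset t c \<omega>"
  shows "Ymatch t c \<omega> As \<longleftrightarrow> list_all2 tmem (walk t \<omega> [] us) As"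
  using assms planar.strict_sorted_equal unfolding Ymatch_def by metis

lemma Xmatch_sorted:
  assumes "sorted_wrt planar_less us" "set us = {u. alive t \<omega> u}"
  shows "Xmatch t \<omega> As \<longleftrightarrow> list_all2 tmem (info t \<omega> us) As"
  using assms planar.strict_sorted_equal unfolding Xmatch_def by metis

lemma planar_sorted_ex:
  assumes "finite U" obtains us where "sorted_wrt planar_less us" "set us = U"
  using planar.finite_set_strict_sorted[OF assms] by metis

lemma list_all2_append_iff:
  "list_all2 P (xs @ ys) zs \<longleftrightarrow> (\<exists>k\<le>length zs. list_all2 P xs (take k zs) \<and> list_all2 P ys (drop k zs))"
proof
  assume "list_all2 P (xs @ ys) zs"
  then obtain us vs where "zs = us @ vs" "list_all2 P xs us" "list_all2 P ys vs"
    by (auto simp: list_all2_append1)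
  then show "\<exists>k\<le>length zs. list_all2 P xs (take k zs) \<and> list_all2 P ys (drop k zs)"
    by (intro exI[of _ "length us"]) simp
next
  assume "\<exists>k\<le>length zs. list_all2 P xs (take k zs) \<and> list_all2 P ys (drop k zs)"
  then show "list_all2 P (xs @ ys) zs"
    using list_all2_appendI by fastforce
qed

lemma Ymatch_rec:
  assumes good: "good \<omega>"
  defines "s \<equiv> ginter \<omega> [] 0"
  shows "Ymatch t c \<omega> As \<longleftrightarrow> (if s < c \<and> s \<le> t
    then \<exists>k\<le>length As. Ymatch (t - s) (c - s) (tlw \<omega>) (take k As) \<and> Xmatch (t - s) (sub \<omega> 0) (drop k As)
    else As = [])"
proof (cases "s < c \<and> s \<le> t")
  case False
  then have "Yset t c \<omega> = {}" using Yset_rec[OF good, of t c] by (auto simp: s_def)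
  then have "Ymatch t c \<omega> As \<longleftrightarrow> As = []" using Ymatch_sorted[of "[]"] by auto
  then show ?thesis using False by auto
next
  case True
  let ?Y = "Yset (t - s) (c - s) (tlw \<omega>)" and ?X = "{u. alive (t - s) (sub \<omega> 0) u}"
  have Y: "Yset t c \<omega> = bump ` ?Y \<union> (#) 0 ` ?X"
    using Yset_rec[OF good, of t c] True by (simp add: s_def)
  have injb: "inj_on bump ?Y"
    by (auto simp: inj_on_def Yset_def)
  show ?thesis
  proof (cases "finite ?Y \<and> finite ?X")
    case False
    then have "infinite (Yset t c \<omega>)"
      unfolding Y using injb finite_imageD[of bump ?Y] finite_imageD[of "(#) 0" ?X] by auto
    then have "\<not> Ymatch t c \<omega> As" using Ymatch_card by blast
    moreover have "\<not> (Ymatch (t - s) (c - s) (tlw \<omega>) As1 \<and> Xmatch (t - s) (sub \<omega> 0) As2)" for As1 As2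
    proof
      assume *: "Ymatch (t - s) (c - s) (tlw \<omega>) As1 \<and> Xmatch (t - s) (sub \<omega> 0) As2"
      then have "finite ?Y" using Ymatch_card by blast
      moreover have "finite ?X" using * unfolding Xmatch_def by (metis List.finite_set)
      ultimately show False using False by blast
    qed
    ultimately show ?thesis using True by auto
  next
    case fin: True
    then obtain us vs where us: "sorted_wrt planar_less us" "set us = ?Y"
      and vs: "sorted_wrt planar_less vs" "set vs = ?X"
      using planar_sorted_ex by metis
    have ne: "[] \<notin> set us" using us by simp
    have sb: "planar_less (bump a) (bump b)" if "planar_less a b" "a \<noteq> []" "b \<noteq> []" for a b
      using that by (cases a; cases b) auto
    have sorted: "sorted_wrt planar_less (map bump us @ map ((#) 0) vs)"
    proof -
      have "sorted_wrt planar_less (map bump us)"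
        unfolding sorted_wrt_map using us(1)
        by (rule sorted_wrt_mono_rel[rotated]) (use ne in \<open>metis sb\<close>)
      moreover have "sorted_wrt planar_less (map ((#) 0) vs)"
        unfolding sorted_wrt_map using vs(1) by (rule sorted_wrt_mono_rel[rotated]) auto
      moreover have "planar_less (bump a) (0 # b)" if "a \<in> set us" for a b
      proof -
        have "a \<noteq> []" using that ne by blast
        then show ?thesis by (cases a) simp_all
      qed
      ultimately show ?thesis by (auto simp: sorted_wrt_append)
    qed
    have "set (map bump us @ map ((#) 0) vs) = Yset t c \<omega>"
      using Y us vs by auto
    note m = Ymatch_sorted[OF sorted this]
    have 1: "walk t \<omega> [] (map bump us) = walk (t - s) (tlw \<omega>) [] us"
      using walk_bump[OF ne, of t \<omega> "[]"] by (simp add: s_def)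
    have "last ([] # map bump us) = [] \<or> hd (last ([] # map bump us)) \<noteq> 0"
    proof (cases us rule: rev_cases)
      case (snoc ys y)
      then show ?thesis using ne by (cases y) auto
    qed auto
    then have "walk t \<omega> [] (map bump us @ map ((#) 0) vs) = walk (t - s) (tlw \<omega>) [] us @ info (t - s) (sub \<omega> 0) vs"
      by (simp add: walk_append 1 walk_info age_0 s_def del: last.simps)
    with m have "Ymatch t c \<omega> As \<longleftrightarrow> (\<exists>k\<le>length As. list_all2 tmem (walk (t - s) (tlw \<omega>) [] us) (take k As) \<and>
       list_all2 tmem (info (t - s) (sub \<omega> 0) vs) (drop k As))"
      by (simp only: list_all2_append_iff)
    then show ?thesis using True Ymatch_sorted[OF us] Xmatch_sorted[OF vs] by simp
  qed
qed

lemma Xmatch_rec: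
  assumes good: "good \<omega>" and t: "t \<ge> 0"
  defines "L \<equiv> lifetime (gpath \<omega> [])"
  shows "Xmatch t \<omega> [] \<longleftrightarrow> \<not> (ereal t < L \<and> gcoin \<omega> []) \<and> Ymatch t (root_bound t \<omega>) \<omega> []"
    and "Xmatch t \<omega> ((b, D, K) # As) \<longleftrightarrow> t \<le> b \<and>
      (if ereal t < L \<and> gcoin \<omega> [] then t \<in> D \<and> gpath \<omega> [] t \<in> K \<and> Ymatch t (root_bound t \<omega>) \<omega> As
       else Ymatch t (root_bound t \<omega>) \<omega> ((b, D, K) # As))"
proof -
  let ?Y = "Yset t (root_bound t \<omega>) \<omega>" 
  let ?r = "ereal t < L \<and> gcoin \<omega> []"
  have X: "{u. alive t \<omega> u} = (if ?r then {[]} else {}) \<union> ?Y"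
    unfolding L_def by (rule alive_set_eq[OF good t])
  have "(Xmatch t \<omega> [] \<longleftrightarrow> \<not> ?r \<and> Ymatch t (root_bound t \<omega>) \<omega> []) \<and>
     (Xmatch t \<omega> ((b, D, K) # As) \<longleftrightarrow> t \<le> b \<and>
      (if ?r then t \<in> D \<and> gpath \<omega> [] t \<in> K \<and> Ymatch t (root_bound t \<omega>) \<omega> As
       else Ymatch t (root_bound t \<omega>) \<omega> ((b, D, K) # As)))"
  proof (cases "finite ?Y")
    case False
    then have "infinite {u. alive t \<omega> u}" by (simp add: X)
    then have "\<not> Xmatch t \<omega> As" for As unfolding Xmatch_def by (metis List.finite_set)
    then show ?thesis using Ymatch_card False by auto
  next
    case True
    then obtain us where us: "sorted_wrt planar_less us" "set us = ?Y"
      using planar_sorted_ex by metis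
    have ne: "[] \<notin> set us" using us by simp
    show ?thesis
    proof (cases ?r)
      case True
      have "sorted_wrt planar_less ([] # us)"
        using us(1) ne by (metis planar_less_Nil_left sorted_wrt.simps(2))
      then have "Xmatch t \<omega> As \<longleftrightarrow> list_all2 tmem (info t \<omega> ([] # us)) As" for As
        by (rule Xmatch_sorted) (use X True us in auto)
      then show ?thesis using True Ymatch_sorted[OF us] by auto
    next
      case False
      then have "Xmatch t \<omega> As \<longleftrightarrow> list_all2 tmem (info t \<omega> us) As" for As
        using Xmatch_sorted[OF us(1)] us X by auto
      moreover have "list_all2 tmem (info t \<omega> us) ((b, D, K) # As) \<longleftrightarrow>
          t \<le> b \<and> list_all2 tmem (walk t \<omega> [] us) ((b, D, K) # As)"
      proof (cases us)
        case (Cons v vs)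
        have "t - bt \<omega> w \<le> b" if "t \<le> b" for w using bt_nonneg[OF good, of w] that by simp
        then show ?thesis using Cons by (auto simp: trip_def)
      qed simp
      moreover have "list_all2 tmem (info t \<omega> us) [] \<longleftrightarrow> list_all2 tmem (walk t \<omega> [] us) []"
        by (cases us) auto
      ultimately show ?thesis using False Ymatch_sorted[OF us] by auto
    qed
  qed
  then show "Xmatch t \<omega> [] \<longleftrightarrow> \<not> (ereal t < L \<and> gcoin \<omega> []) \<and> Ymatch t (root_bound t \<omega>) \<omega> []"
    and "Xmatch t \<omega> ((b, D, K) # As) \<longleftrightarrow> t \<le> b \<and>
      (if ereal t < L \<and> gcoin \<omega> [] then t \<in> D \<and> gpath \<omega> [] t \<in> K \<and> Ymatch t (root_bound t \<omega>) \<omega> As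
       else Ymatch t (root_bound t \<omega>) \<omega> ((b, D, K) # As))"
    by auto
qed

section \<open>Coalescence times of consecutive sampled genera\<close>

lemma planar_less_lcp:
  assumes "planar_less u v"
  shows "take (lcp u v) u = take (lcp u v) v" "lcp u v < length v" "lcp u v \<le> length u"
    "lcp u v < length u \<Longrightarrow> v ! lcp u v < u ! lcp u v"
proof -
  have "take (lcp u v) u = take (lcp u v) v \<and> lcp u v < length v \<and> lcp u v \<le> length u \<and>
    (lcp u v < length u \<longrightarrow> v ! lcp u v < u ! lcp u v)"
    using assms
  proof (induction u arbitrary: v)
    case (Cons k u)
    then show ?case by (cases v) auto
  qed auto
  then show "take (lcp u v) u = take (lcp u v) v" "lcp u v < length v" "lcp u v \<le> length u"
    "lcp u v < length u \<Longrightarrow> v ! lcp u v < u ! lcp u v" by auto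
qed

lemma coal_time_eq:
  assumes good: "good \<omega>" and u: "alive T \<omega> u" and v: "alive T \<omega> v" and uv: "planar_less u v"
  shows "coal_time T \<omega> u v = T - bt \<omega> (take (Suc (lcp u v)) v)"
proof -
  define p where "p = lcp u v"
  define b where "b = bt \<omega> (take (Suc p) v)"
  note l = planar_less_lcp[OF uv, folded p_def]
  have bu: "btime \<omega> (take j u) = bt \<omega> (take j u)" and bv: "btime \<omega> (take j v) = bt \<omega> (take j v)" for j
    using u v by (auto simp: alive_iff intro!: btime_eq bornr_take)
  have bpos: "b > 0"
    unfolding b_def using l(2) by (intro bt_pos[OF good]) auto
  have "b \<le> bt \<omega> v"
    unfolding b_def using bt_take_mono[OF good, of "Suc p" "length v" v] l(2) by simp
  then have bT: "b \<le> T" using v by (auto simp: alive_iff)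
  have bub: "b \<le> bt \<omega> (take (Suc p) u)" if "p < length u"
  proof -
    have "take (Suc p) v = take p u @ [v ! p]" "take (Suc p) u = take p u @ [u ! p]"
      using l that by (auto simp: take_Suc_conv_app_nth)
    then show ?thesis
      unfolding b_def using age_less[OF good_subs[OF good] l(4)[OF that], of "take p u"]
      by (simp add: bt_append)
  qed
  let ?P = "\<lambda>w s j. j \<le> length w \<and> btime \<omega> (take j w) \<le> s"
  have "anc \<omega> u s = anc \<omega> v s \<longleftrightarrow> s < b" if s: "0 \<le> s" "s \<le> T" for s
  proof
    assume sb: "s < b"
    have "?P u s j \<longleftrightarrow> ?P v s j" for j
    proof (cases "j \<le> p")
      case True
      then have "take j u = take j v" using l(1) by (metis min.absorb1 take_take)
      then show ?thesis using True l by auto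
    next
      case False
      then have "\<not> ?P v s j"
        using bt_take_mono[OF good, of "Suc p" j v] sb unfolding bv b_def by auto
      moreover have "\<not> ?P u s j"
        using False bt_take_mono[OF good, of "Suc p" j u] sb bub unfolding bu by auto
      ultimately show ?thesis by blast
    qed
    then have eq: "(GREATEST j. ?P u s j) = (GREATEST j. ?P v s j)" by presburger
    define J where "J = (GREATEST j. ?P v s j)"
    have "?P v s J"
      unfolding J_def by (rule GreatestI_nat[of _ 0 "length v"]) (use s in \<open>auto simp: btime_def\<close>)
    then have "bt \<omega> (take J v) < b" using sb bv by simp
    then have "J \<le> p"
      using bt_take_mono[OF good, of "Suc p" J v] unfolding b_def by (cases "J \<le> p") auto
    then have "take J u = take J v" using l(1) by (metis min.absorb1 take_take)
    then show "anc \<omega> u s = anc \<omega> v s"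
      unfolding anc_def eq J_def .
  next
    assume eq: "anc \<omega> u s = anc \<omega> v s"
    show "s < b"
    proof (rule ccontr)
      assume "\<not> s < b"
      then have "?P v s (Suc p)" using l(2) bv by (auto simp: b_def)
      then have "Suc p \<le> (GREATEST j. ?P v s j)"
        by (rule Greatest_le_nat[of _ _ "length v"]) auto
      then have len: "p < length (anc \<omega> v s)" "anc \<omega> v s ! p = v ! p"
        using l(2) by (auto simp: anc_def)
      then have "p < length u" "anc \<omega> u s ! p = u ! p"
        unfolding eq[symmetric] by (auto simp: anc_def)
      then show False using l(4) eq len by simp
    qed
  qed
  then have "{s. 0 \<le> s \<and> s \<le> T \<and> anc \<omega> u s = anc \<omega> v s} = {0..<b}"
    using bT by auto
  then show ?thesis
    unfolding coal_time_def using bpos by (simp add: b_def p_def)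
qed

lemma walk_nth: "i < length vs \<Longrightarrow> walk t \<omega> u vs ! i = trip t \<omega> ((u # vs) ! i) (vs ! i)"
proof (induction vs arbitrary: u i)
  case (Cons v vs)
  then show ?case by (cases i) auto
qed auto

lemma card_planar_below:
  assumes "sorted_wrt planar_less us" "i < length us"
  shows "card {v \<in> set us. planar_less v (us ! i)} = i"
proof -
  have "{v \<in> set us. planar_less v (us ! i)} = set (take i us)"
  proof (intro set_eqI iffI)
    fix v assume "v \<in> {v \<in> set us. planar_less v (us ! i)}"
    then obtain j where j: "j < length us" "v = us ! j" "planar_less (us ! j) (us ! i)"
      by (auto simp: in_set_conv_nth)
    have "\<not> i \<le> j"
    proof
      assume "i \<le> j"
      then have "us ! i = us ! j \<or> planar_less (us ! i) (us ! j)"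
        using sorted_wrt_nth_less[OF assms(1), of i j] j(1) by (cases "i = j") auto
      then show False
        using j(3) planar_less_irrefl planar_less_trans[OF j(3)] by auto
    qed
    then have "j < i" by simp
    then show "v \<in> set (take i us)" using j assms by (auto simp: in_set_conv_nth)
  next
    fix v assume "v \<in> set (take i us)"
    then obtain j where "j < i" "v = us ! j" by (auto simp: in_set_conv_nth)
    then show "v \<in> {v \<in> set us. planar_less v (us ! i)}"
      using assms sorted_wrt_nth_less by auto
  qed
  moreover have "distinct us" using assms planar.strict_sorted_iff by blast
  ultimately show ?thesis using assms by (simp add: distinct_card)
qed

lemma sgen_eq:
  assumes us: "sorted_wrt planar_less us" "set us = sampled_set T \<omega>" and i: "i < length us"
  shows "sgen T \<omega> i = us ! i"
  unfolding sgen_def us(2)[symmetric]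
proof (rule the_equality)
  show "us ! i \<in> set us \<and> card {v \<in> set us. planar_less v (us ! i)} = i"
    using card_planar_below[OF us(1) i] i by auto
  fix u assume "u \<in> set us \<and> card {v \<in> set us. planar_less v u} = i"
  then show "u = us ! i" using card_planar_below[OF us(1)] by (auto simp: in_set_conv_nth)
qed

lemma sampled_triple_eq:
  assumes good: "good \<omega>" and us: "sorted_wrt planar_less us" "set us = sampled_set T \<omega>"
    and i: "1 \<le> i" "i < length us"
  shows "sampled_triple T \<omega> i = trip T \<omega> (us ! (i - 1)) (us ! i)"
proof -
  have al: "alive T \<omega> (us ! j)" if "j < length us" for j
    using us(2) that nth_mem unfolding sampled_set_eq by blast
  have "planar_less (us ! (i - 1)) (us ! i)"
    using us(1) i by (intro sorted_wrt_nth_less[of planar_less]) auto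
  then have "coal_time T \<omega> (us ! (i - 1)) (us ! i) = T - bt \<omega> (take (Suc (lcp (us ! (i - 1)) (us ! i))) (us ! i))"
    by (intro coal_time_eq[OF good] al) (use i in auto)
  moreover have "btime \<omega> (us ! i) = bt \<omega> (us ! i)"
    using al[OF i(2)] by (auto simp: alive_iff intro: btime_eq)
  ultimately show ?thesis
    using sgen_eq[OF us] i by (simp add: sampled_triple_def trip_def)
qed

lemma Xmatch_sampled:
  assumes good: "good \<omega>"
  shows "Xmatch T \<omega> ((T, UNIV, UNIV) # map A [1..<Suc n]) \<longleftrightarrow>
    Nsamp T \<omega> = Suc n \<and> (\<forall>i\<in>{1..n}. tmem (sampled_triple T \<omega> i) (A i))"
proof (cases "finite (sampled_set T \<omega>)")
  case False
  then have "\<not> Xmatch T \<omega> As" for As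
    unfolding Xmatch_def sampled_set_eq by (metis List.finite_set)
  then show ?thesis using False by (simp add: Nsamp_def)
next
  case True
  then obtain us where us: "sorted_wrt planar_less us" "set us = sampled_set T \<omega>"
    using planar_sorted_ex by metis
  have N: "Nsamp T \<omega> = length us"
    unfolding Nsamp_def using sorted_planar_card[OF us(1)] us(2) by simp
  have "Xmatch T \<omega> ((T, UNIV, UNIV) # map A [1..<Suc n]) \<longleftrightarrow>
    list_all2 tmem (info T \<omega> us) ((T, UNIV, UNIV) # map A [1..<Suc n])"
    using us by (intro Xmatch_sorted) (auto simp: sampled_set_eq)
  also have "\<dots> \<longleftrightarrow> length us = Suc n \<and> (\<forall>i\<in>{1..n}. tmem (trip T \<omega> (us ! (i - 1)) (us ! i)) (A i))"
  proof (cases us)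
    case (Cons v vs)
    have "list_all2 tmem (walk T \<omega> v vs) (map A [1..<Suc n]) \<longleftrightarrow>
      length vs = n \<and> (\<forall>i<n. tmem (trip T \<omega> ((v # vs) ! i) (vs ! i)) (A (Suc i)))"
      unfolding list_all2_conv_all_nth by (auto simp: walk_nth simp del: upt_Suc)
    also have "(\<forall>i<n. tmem (trip T \<omega> ((v # vs) ! i) (vs ! i)) (A (Suc i))) \<longleftrightarrow>
      (\<forall>i\<in>{1..n}. tmem (trip T \<omega> (us ! (i - 1)) (us ! i)) (A i))"
      unfolding Cons
    proof safe
      fix i assume *: "\<forall>i<n. tmem (trip T \<omega> ((v # vs) ! i) (vs ! i)) (A (Suc i))" "i \<in> {1..n}"
      then show "tmem (trip T \<omega> ((v # vs) ! (i - 1)) ((v # vs) ! i)) (A i)"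
        by (cases i) auto
    next
      fix i assume *: "\<forall>i\<in>{1..n}. tmem (trip T \<omega> ((v # vs) ! (i - 1)) ((v # vs) ! i)) (A i)" "i < n"
      then show "tmem (trip T \<omega> ((v # vs) ! i) (vs ! i)) (A (Suc i))"
        using bspec[OF *(1), of "Suc i"] by auto
    qed
    finally show ?thesis using Cons by (simp del: upt_Suc)
  qed simp
  also have "\<dots> \<longleftrightarrow> Nsamp T \<omega> = Suc n \<and> (\<forall>i\<in>{1..n}. tmem (sampled_triple T \<omega> i) (A i))"
    using sampled_triple_eq[OF good us] N by auto
  finally show ?thesis .
qed

section \<open>Decompositions of product measures\<close>

lemma nn_integral_PiM_insert:
  fixes M0 :: "'a measure" and i :: 'i
  assumes M0: "prob_space M0" and G: "G \<in> borel_measurable (\<Pi>\<^sub>M i\<in>UNIV. M0)"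
  shows "(\<integral>\<^sup>+\<omega>. G \<omega> \<partial>(\<Pi>\<^sub>M i\<in>(UNIV :: 'i set). M0)) =
    (\<integral>\<^sup>+x. \<integral>\<^sup>+X. G (X(i := x)) \<partial>(\<Pi>\<^sub>M i\<in>UNIV - {i}. M0) \<partial>M0)"
proof -
  let ?P = "\<Pi>\<^sub>M i\<in>(UNIV :: 'i set). M0" and ?R = "\<Pi>\<^sub>M i\<in>UNIV - {i}. M0"
  interpret R: prob_space ?R by (intro prob_space_PiM M0)
  have I: "insert i (UNIV - {i}) = UNIV" by auto
  have "distr (M0 \<Otimes>\<^sub>M ?R) ?P (\<lambda>(x, X). X(i := x)) = ?P"
    using distr_pair_PiM_eq_PiM[of "UNIV - {i}" "\<lambda>_. M0" i] M0 unfolding I by simp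
  moreover have m: "(\<lambda>(x, X). X(i := x)) \<in> measurable (M0 \<Otimes>\<^sub>M ?R) ?P"
    using measurable_fun_upd[of UNIV "UNIV - {i}" i snd "M0 \<Otimes>\<^sub>M ?R" "\<lambda>_. M0" fst] I
    by (simp add: split_beta')
  ultimately have "(\<integral>\<^sup>+\<omega>. G \<omega> \<partial>?P) = (\<integral>\<^sup>+(x, X). G (X(i := x)) \<partial>(M0 \<Otimes>\<^sub>M ?R))"
    using nn_integral_distr[OF m, of G] G by (simp add: split_beta')
  also have "\<dots> = (\<integral>\<^sup>+x. \<integral>\<^sup>+X. G (X(i := x)) \<partial>?R \<partial>M0)"
    using measurable_compose[OF m G] by (subst R.nn_integral_fst[symmetric]) (auto simp: split_beta')
  finally show ?thesis .
qed

lemma nn_integral_PiM_replace: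
  fixes M0 :: "'a measure" and i :: 'i
  assumes M0: "prob_space M0"
    and h: "h \<in> measurable (Q \<Otimes>\<^sub>M M0) M0" "distr (Q \<Otimes>\<^sub>M M0) M0 h = M0"
    and G: "G \<in> borel_measurable (\<Pi>\<^sub>M i\<in>UNIV. M0)"
  shows "(\<integral>\<^sup>+\<omega>. G \<omega> \<partial>(\<Pi>\<^sub>M i\<in>(UNIV :: 'i set). M0)) =
    (\<integral>\<^sup>+q. \<integral>\<^sup>+\<omega>. G (fun_upd \<omega> i (h (q, \<omega> i))) \<partial>(\<Pi>\<^sub>M i\<in>UNIV. M0) \<partial>Q)"
proof -
  let ?P = "\<Pi>\<^sub>M i\<in>(UNIV :: 'i set). M0" and ?R = "\<Pi>\<^sub>M i\<in>UNIV - {i}. M0"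
  interpret R: prob_space ?R by (intro prob_space_PiM M0)
  interpret M0: prob_space M0 by fact
  have m: "(\<lambda>(x, X). X(i := x)) \<in> measurable (M0 \<Otimes>\<^sub>M ?R) ?P"
    using measurable_fun_upd[of UNIV "UNIV - {i}" i snd "M0 \<Otimes>\<^sub>M ?R" "\<lambda>_. M0" fst]
    by (auto simp: split_beta')
  define F where "F x = (\<integral>\<^sup>+X. G (X(i := x)) \<partial>?R)" for x
  have F: "F \<in> borel_measurable M0"
    unfolding F_def using measurable_compose[OF m G]
    by (intro R.borel_measurable_nn_integral) (simp add: split_beta')
  have u: "(\<lambda>\<omega>. fun_upd \<omega> i (h (q, \<omega> i))) \<in> measurable ?P ?P" if "q \<in> space Q" for q
  proof -
    have "(\<lambda>\<omega>. h (q, \<omega> i)) \<in> measurable ?P M0"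
      using h(1) that by (intro measurable_compose[OF _ h(1)] measurable_Pair) auto
    then show ?thesis
      by (intro measurable_fun_upd[where J = UNIV]) auto
  qed
  have "(\<integral>\<^sup>+\<omega>. G \<omega> \<partial>?P) = (\<integral>\<^sup>+x. F x \<partial>M0)"
    unfolding F_def by (rule nn_integral_PiM_insert[OF M0 G])
  also have "\<dots> = (\<integral>\<^sup>+x. F x \<partial>distr (Q \<Otimes>\<^sub>M M0) M0 h)" using h by simp
  also have "\<dots> = (\<integral>\<^sup>+x. F (h x) \<partial>(Q \<Otimes>\<^sub>M M0))"
    using F h by (intro nn_integral_distr) auto
  also have "\<dots> = (\<integral>\<^sup>+q. \<integral>\<^sup>+x. F (h (q, x)) \<partial>M0 \<partial>Q)"
    using measurable_compose[OF h(1) F] by (rule M0.nn_integral_fst[symmetric])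
  also have "\<dots> = (\<integral>\<^sup>+q. \<integral>\<^sup>+\<omega>. G (fun_upd \<omega> i (h (q, \<omega> i))) \<partial>?P \<partial>Q)"
  proof (intro nn_integral_cong)
    fix q assume "q \<in> space Q"
    then have "(\<lambda>\<omega>. G (fun_upd \<omega> i (h (q, \<omega> i)))) \<in> borel_measurable ?P"
      by (intro measurable_compose[OF u G])
    then show "(\<integral>\<^sup>+x. F (h (q, x)) \<partial>M0) = (\<integral>\<^sup>+\<omega>. G (fun_upd \<omega> i (h (q, \<omega> i))) \<partial>?P)"
      by (subst nn_integral_PiM_insert[OF M0, of _ i]) (simp_all add: F_def)
  qed
  finally show ?thesis .
qed

definition interleave :: "('i \<Rightarrow> 'i + 'i) \<Rightarrow> ('i \<Rightarrow> 'a) \<Rightarrow> ('i \<Rightarrow> 'a) \<Rightarrow> 'i \<Rightarrow> 'a" where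
  "interleave \<phi> \<omega>1 \<omega>0 u = (case \<phi> u of Inl a \<Rightarrow> \<omega>1 a | Inr b \<Rightarrow> \<omega>0 b)"

lemma measurable_interleave:
  "(\<lambda>(\<omega>1, \<omega>0). interleave \<phi> \<omega>1 \<omega>0) \<in>
    measurable ((\<Pi>\<^sub>M i\<in>UNIV. M0) \<Otimes>\<^sub>M (\<Pi>\<^sub>M i\<in>UNIV. M0)) (\<Pi>\<^sub>M i\<in>UNIV. M0)"
proof (rule measurable_PiM_single')
  fix i
  show "(\<lambda>x. (case x of (\<omega>1, \<omega>0) \<Rightarrow> interleave \<phi> \<omega>1 \<omega>0) i) \<in>
    measurable ((\<Pi>\<^sub>M i\<in>UNIV. M0) \<Otimes>\<^sub>M (\<Pi>\<^sub>M i\<in>UNIV. M0)) M0"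
    by (cases "\<phi> i") (simp_all add: interleave_def split_beta')
qed (auto simp: PiE_iff space_pair_measure space_PiM interleave_def split: sum.splits)

lemma nn_integral_PiM_interleave:
  fixes M0 :: "'a measure" and \<phi> :: "'i \<Rightarrow> 'i + 'i"
  assumes M0: "prob_space M0" and \<phi>: "inj \<phi>"
    and G: "G \<in> borel_measurable (\<Pi>\<^sub>M i\<in>UNIV. M0)"
  shows "(\<integral>\<^sup>+\<omega>. G \<omega> \<partial>(\<Pi>\<^sub>M i\<in>(UNIV :: 'i set). M0)) =
    (\<integral>\<^sup>+\<omega>1. \<integral>\<^sup>+\<omega>0. G (interleave \<phi> \<omega>1 \<omega>0) \<partial>(\<Pi>\<^sub>M i\<in>UNIV. M0) \<partial>(\<Pi>\<^sub>M i\<in>UNIV. M0))"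
proof -
  interpret M0: prob_space M0 by fact
  interpret product_prob_space "\<lambda>_. M0" "UNIV :: 'i set" by unfold_locales
  let ?P = "\<Pi>\<^sub>M i\<in>(UNIV :: 'i set). M0"
  let ?m = "\<lambda>(\<omega>1, \<omega>0). interleave \<phi> \<omega>1 \<omega>0"
  note m = measurable_interleave[of \<phi> M0]
  have eq: "distr (?P \<Otimes>\<^sub>M ?P) ?P ?m = ?P"
  proof (rule PiM_eq)
    fix J F assume J: "finite J" "J \<subseteq> (UNIV :: 'i set)" "\<And>j. j \<in> J \<Longrightarrow> F j \<in> sets M0"
    define L where "L = {a. Inl a \<in> \<phi> ` J}"
    define R where "R = {b. Inr b \<in> \<phi> ` J}"
    define F' where "F' y = F (inv \<phi> y)" for y
    have fin: "finite L" "finite R"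
      using J(1) finite_vimageI[of "\<phi> ` J" Inl] finite_vimageI[of "\<phi> ` J" Inr]
      by (auto simp: L_def R_def vimage_def)
    have F': "F' (\<phi> j) = F j" for j unfolding F'_def using \<phi> by simp
    have dj: "\<phi> ` J = Inl ` L \<union> Inr ` R"
    proof (intro set_eqI)
      fix y show "y \<in> \<phi> ` J \<longleftrightarrow> y \<in> Inl ` L \<union> Inr ` R"
        by (cases y) (auto simp: L_def R_def)
    qed
    have sL: "F' (Inl a) \<in> sets M0" if "a \<in> L" for a using that J(3) F' by (auto simp: L_def)
    have sR: "F' (Inr a) \<in> sets M0" if "a \<in> R" for a using that J(3) F' by (auto simp: R_def)
    have "?m -` prod_emb UNIV (\<lambda>_. M0) J (Pi\<^sub>E J F) \<inter> space (?P \<Otimes>\<^sub>M ?P) =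
      {\<omega>1\<in>space ?P. \<forall>a\<in>L. \<omega>1 a \<in> F' (Inl a)} \<times> {\<omega>0\<in>space ?P. \<forall>b\<in>R. \<omega>0 b \<in> F' (Inr b)}"
    proof -
      have "(\<forall>j\<in>J. interleave \<phi> \<omega>1 \<omega>0 j \<in> F j) \<longleftrightarrow> (\<forall>y\<in>\<phi> ` J. (case y of Inl a \<Rightarrow> \<omega>1 a | Inr b \<Rightarrow> \<omega>0 b) \<in> F' y)" for \<omega>1 \<omega>0
        by (auto simp: F' interleave_def)
      then have "(\<forall>j\<in>J. interleave \<phi> \<omega>1 \<omega>0 j \<in> F j) \<longleftrightarrow> (\<forall>a\<in>L. \<omega>1 a \<in> F' (Inl a)) \<and> (\<forall>b\<in>R. \<omega>0 b \<in> F' (Inr b))" for \<omega>1 \<omega>0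
        unfolding dj by (simp add: ball_Un)
      moreover have "interleave \<phi> \<omega>1 \<omega>0 \<in> space ?P" if "\<omega>1 \<in> space ?P" "\<omega>0 \<in> space ?P" for \<omega>1 \<omega>0
        using that by (auto simp: space_PiM interleave_def PiE_iff split: sum.splits)
      ultimately show ?thesis
        by (auto simp: prod_emb_def space_pair_measure PiE_iff space_PiM)
    qed
    moreover have "prod_emb UNIV (\<lambda>_. M0) J (Pi\<^sub>E J F) \<in> sets ?P"
      using J by (intro sets_PiM_I) auto
    ultimately have "emeasure (distr (?P \<Otimes>\<^sub>M ?P) ?P ?m) (prod_emb UNIV (\<lambda>_. M0) J (Pi\<^sub>E J F)) =
      emeasure (?P \<Otimes>\<^sub>M ?P) ({\<omega>1\<in>space ?P. \<forall>a\<in>L. \<omega>1 a \<in> F' (Inl a)} \<times> {\<omega>0\<in>space ?P. \<forall>b\<in>R. \<omega>0 b \<in> F' (Inr b)})"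
      by (simp add: emeasure_distr m)
    also have "\<dots> = emeasure ?P {\<omega>1\<in>space ?P. \<forall>a\<in>L. \<omega>1 a \<in> F' (Inl a)} * emeasure ?P {\<omega>0\<in>space ?P. \<forall>b\<in>R. \<omega>0 b \<in> F' (Inr b)}"
      using fin sL sR
      by (intro P.emeasure_pair_measure_Times sets.sets_Collect_finite_All predE
          pred_sets2[OF _ measurable_component_singleton]) auto
    also have "\<dots> = (\<Prod>a\<in>L. emeasure M0 (F' (Inl a))) * (\<Prod>b\<in>R. emeasure M0 (F' (Inr b)))"
      using fin sL sR by (subst (1 2) emeasure_PiM_Collect) auto
    also have "\<dots> = (\<Prod>y\<in>\<phi> ` J. emeasure M0 (F' y))"
      unfolding dj using fin by (subst prod.union_disjoint) (auto simp: prod.reindex)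
    also have "\<dots> = (\<Prod>j\<in>J. emeasure M0 (F j))"
      using \<phi> by (subst prod.reindex) (auto simp: F' inj_on_def dest: injD)
    finally show "emeasure (distr (?P \<Otimes>\<^sub>M ?P) ?P ?m) (prod_emb UNIV (\<lambda>_. M0) J (Pi\<^sub>E J F)) =
      (\<Prod>j\<in>J. emeasure M0 (F j))" .
  qed simp
  have "(\<integral>\<^sup>+\<omega>. G \<omega> \<partial>?P) = (\<integral>\<^sup>+\<omega>. G \<omega> \<partial>distr (?P \<Otimes>\<^sub>M ?P) ?P ?m)" using eq by simp
  also have "\<dots> = (\<integral>\<^sup>+x. G (?m x) \<partial>(?P \<Otimes>\<^sub>M ?P))"
    using m G by (intro nn_integral_distr) auto
  also have "\<dots> = (\<integral>\<^sup>+\<omega>1. \<integral>\<^sup>+\<omega>0. G (interleave \<phi> \<omega>1 \<omega>0) \<partial>?P \<partial>?P)"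
    using measurable_compose[OF m G] by (subst P.nn_integral_fst[symmetric]) auto
  finally show ?thesis .
qed

section \<open>Measurability of the matching events\<close>

locale genus_data =
  fixes g f :: real and MZ :: "path measure"
  assumes g: "g > 0" and f: "0 < f" "f \<le> 1" and prob_MZ: "prob_space MZ"
    and eval: "(\<lambda>(t, z). z t) \<in> measurable (borel \<Otimes>\<^sub>M MZ) (count_space UNIV)"
    and life [measurable]: "lifetime \<in> borel_measurable MZ"
begin

abbreviation "Exq \<equiv> density lborel (\<lambda>s. ennreal (exponential_density g s))"
abbreviation "Arr \<equiv> (\<Pi>\<^sub>M k\<in>(UNIV :: nat set). Exq)"
abbreviation "Coin \<equiv> measure_pmf (bernoulli_pmf f)"
abbreviation "M0 \<equiv> MZ \<Otimes>\<^sub>M Arr \<Otimes>\<^sub>M Coin"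
abbreviation "Om \<equiv> genus_model g f MZ"

lemma Om_eq: "Om = (\<Pi>\<^sub>M u\<in>UNIV. M0)"
  by (simp add: genus_model_def)

sublocale MZ: prob_space MZ by (rule prob_MZ)

sublocale Exq: prob_space Exq
  using prob_space_exponential_density[OF g] .

sublocale Arr: prob_space Arr
  by (intro prob_space_PiM Exq.prob_space_axioms)

sublocale ArrCoin: pair_prob_space Arr Coin
  by unfold_locales

sublocale M0: pair_prob_space MZ "Arr \<Otimes>\<^sub>M Coin"
  by unfold_locales

sublocale Om: prob_space Om
  unfolding Om_eq by (intro prob_space_PiM M0.prob_space_axioms)

lemma measurable_omega [measurable]: "(\<lambda>\<omega>. \<omega> u) \<in> measurable Om M0"
  unfolding Om_eq by (rule measurable_component_singleton) simp

lemma measurable_gpath [measurable]: "(\<lambda>\<omega>. gpath \<omega> u) \<in> measurable Om MZ"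
  unfolding gpath_def by measurable

lemma measurable_ginter_fun [measurable]: "(\<lambda>\<omega>. ginter \<omega> u) \<in> measurable Om Arr"
  unfolding ginter_def by measurable

lemma measurable_ginter [measurable]: "(\<lambda>\<omega>. ginter \<omega> u j) \<in> borel_measurable Om"
proof -
  have "(\<lambda>e. e j) \<in> measurable Arr Exq" by measurable
  then have "(\<lambda>e. e j) \<in> borel_measurable Arr" by simp
  from measurable_compose[OF measurable_ginter_fun this] show ?thesis .
qed

lemma measurable_gcoin [measurable]: "Measurable.pred Om (\<lambda>\<omega>. gcoin \<omega> u)"
proof -
  have "(\<lambda>\<omega>. gcoin \<omega> u) \<in> measurable Om Coin"
    unfolding gcoin_def by measurable
  then show ?thesis by simp
qed

lemma measurable_daughter_age [measurable]: "(\<lambda>\<omega>. daughter_age \<omega> u k) \<in> borel_measurable Om"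
  unfolding daughter_age_def by measurable

lemma measurable_sub [measurable]: "(\<lambda>\<omega>. sub \<omega> k) \<in> measurable Om Om"
proof -
  have "(\<lambda>\<omega>. sub \<omega> k) \<in> measurable Om (\<Pi>\<^sub>M u\<in>UNIV. M0)"
  proof (rule measurable_PiM_single')
    show "(\<lambda>\<omega>. sub \<omega> k i) \<in> measurable Om M0" for i
      unfolding sub_def by measurable
  qed (auto simp: sub_def Om_eq space_PiM PiE_iff)
  then show ?thesis by (simp add: Om_eq)
qed

lemma measurable_bt [measurable]: "(\<lambda>\<omega>. bt \<omega> u) \<in> borel_measurable Om"
proof (induction u)
  case (Cons k u)
  note Cons [measurable]
  show ?case by simp
qed simp

lemma measurable_alive [measurable]: "Measurable.pred (borel \<Otimes>\<^sub>M Om) (\<lambda>(t, \<omega>). alive t \<omega> u)"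
proof (induction u)
  case (Cons k u)
  have 1: "(\<lambda>x. (fst x - age (snd x) k, sub (snd x) k)) \<in> measurable (borel \<Otimes>\<^sub>M Om) (borel \<Otimes>\<^sub>M Om)"
    by measurable
  have "Measurable.pred (borel \<Otimes>\<^sub>M Om) (\<lambda>x. alive (fst x - age (snd x) k) (sub (snd x) k) u)"
    using measurable_compose[OF 1 Cons] by (simp add: split_beta')
  note this [measurable]
  show ?case by (simp add: split_beta')
qed (simp add: split_beta')

lemma measurable_eval:
  assumes [measurable]: "t \<in> borel_measurable N" "z \<in> measurable N MZ"
  shows "(\<lambda>x. z x (t x)) \<in> measurable N (count_space UNIV)"
  using measurable_compose[OF _ eval, of "\<lambda>x. (t x, z x)" N] by simp

definition ok :: "test list \<Rightarrow> bool" where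
  "ok As \<longleftrightarrow> (\<forall>A\<in>set As. fst (snd A) \<in> sets borel)"

lemma ok_simps [simp]: "ok []" "ok (A # As) \<longleftrightarrow> fst (snd A) \<in> sets borel \<and> ok As"
  by (auto simp: ok_def)

lemma ok_take: "ok As \<Longrightarrow> ok (take k As)" and ok_drop: "ok As \<Longrightarrow> ok (drop k As)"
  by (auto simp: ok_def dest: in_set_takeD in_set_dropD)

lemma measurable_triple_test:
  assumes [measurable]: "h \<in> borel_measurable N" "a \<in> borel_measurable N" "s \<in> measurable N (count_space UNIV)"
    and A: "fst (snd A) \<in> sets borel"
  shows "Measurable.pred N (\<lambda>x. tmem (h x, a x, s x) A)"
proof -
  obtain b D K where A': "A = (b, D, K)" by (cases A)
  have [measurable]: "D \<in> sets borel" using A A' by simp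
  have [measurable]: "K \<in> sets (count_space UNIV)" by simp
  show ?thesis unfolding A' tmem.simps by measurable
qed

lemma measurable_walk_test:
  assumes "ok As"
  shows "Measurable.pred (borel \<Otimes>\<^sub>M Om) (\<lambda>x. list_all2 tmem (walk (fst x) (snd x) u us) As)"
  using assms
proof (induction us arbitrary: u As)
  case (Cons v us)
  show ?case
  proof (cases As)
    case (Cons A As')
    have [measurable]: "Measurable.pred (borel \<Otimes>\<^sub>M Om) (\<lambda>x. list_all2 tmem (walk (fst x) (snd x) v us) As')"
      using Cons.IH Cons.prems Cons by simp
    have [measurable]: "Measurable.pred (borel \<Otimes>\<^sub>M Om) (\<lambda>x. tmem (trip (fst x) (snd x) u v) A)"
      unfolding trip_def using Cons.prems Cons by (intro measurable_triple_test measurable_eval) auto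
    show ?thesis by (simp add: Cons)
  qed simp
qed simp

lemma measurable_info_test:
  assumes "ok As"
  shows "Measurable.pred (borel \<Otimes>\<^sub>M Om) (\<lambda>x. list_all2 tmem (info (fst x) (snd x) us) As)"
proof (cases us)
  case (Cons v vs)
  show ?thesis
  proof (cases As)
    case (Cons A As')
    have [measurable]: "Measurable.pred (borel \<Otimes>\<^sub>M Om) (\<lambda>x. list_all2 tmem (walk (fst x) (snd x) v vs) As')"
      using measurable_walk_test assms Cons by simp
    have [measurable]: "Measurable.pred (borel \<Otimes>\<^sub>M Om)
        (\<lambda>x. tmem (fst x, fst x - bt (snd x) v, gpath (snd x) v (fst x - bt (snd x) v)) A)"
      using assms Cons by (intro measurable_triple_test measurable_eval) auto
    show ?thesis by (simp add: Cons \<open>us = v # vs\<close>)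
  qed (simp add: Cons)
qed simp

lemma measurable_Yset [measurable (raw)]:
  assumes [measurable]: "t \<in> borel_measurable N" "c \<in> borel_measurable N" "w \<in> measurable N Om"
  shows "Measurable.pred N (\<lambda>x. u \<in> Yset (t x) (c x) (w x))"
  by (cases u) simp_all

lemma measurable_Ymatch [measurable (raw)]:
  assumes [measurable]: "t \<in> borel_measurable N" "c \<in> borel_measurable N" "w \<in> measurable N Om"
    and ok: "ok As"
  shows "Measurable.pred N (\<lambda>x. Ymatch (t x) (c x) (w x) As)"
proof -
  have [measurable]: "Measurable.pred N (\<lambda>x. list_all2 tmem (walk (t x) (w x) [] us) As)" for us
    using measurable_compose[OF _ measurable_walk_test[OF ok], of "\<lambda>x. (t x, w x)" N "[]" us] by simp
  show ?thesis unfolding Ymatch_def set_eq_iff by measurable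
qed

lemma measurable_Xmatch [measurable (raw)]:
  assumes [measurable]: "t \<in> borel_measurable N" "w \<in> measurable N Om"
    and ok: "ok As"
  shows "Measurable.pred N (\<lambda>x. Xmatch (t x) (w x) As)"
proof -
  have [measurable]: "Measurable.pred N (\<lambda>x. list_all2 tmem (info (t x) (w x) us) As)" for us
    using measurable_compose[OF _ measurable_info_test[OF ok], of "\<lambda>x. (t x, w x)" N us] by simp
  show ?thesis unfolding Xmatch_def set_eq_iff mem_Collect_eq by measurable
qed

lemma measurable_good [measurable]: "Measurable.pred Om good"
  unfolding good_def[abs_def] by measurable

lemma AE_good: "AE \<omega> in Om. good \<omega>"
proof -
  have "AE s in lborel. s \<noteq> (0::real)" by (rule AE_lborel_singleton)
  then have pos: "AE s in Exq. s > 0"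
    by (subst AE_density) (auto simp: exponential_density_def elim!: eventually_mono)
  have "AE \<omega> in Om. ginter \<omega> u j > 0" for u j
  proof -
    have [measurable]: "(\<lambda>e. e j) \<in> borel_measurable Arr"
    proof -
      have "(\<lambda>e. e j) \<in> measurable Arr Exq" by measurable
      then show ?thesis by simp
    qed
    have "AE e in Arr. e j > 0"
      using AE_PiM_component[where P = "\<lambda>s. s > 0" and M = "\<lambda>_. Exq" and i = j and I = UNIV] pos
        Exq.prob_space_axioms by auto
    then have "AE x in Arr \<Otimes>\<^sub>M Coin. fst x j > 0"
      by (intro ArrCoin.AE_pair_measure) (auto elim!: eventually_mono)
    then have *: "AE x in M0. fst (snd x) j > 0"
      by (intro M0.AE_pair_measure) auto
    have d: "distr Om M0 (\<lambda>\<omega>. \<omega> u) = M0"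
      unfolding Om_eq by (rule distr_PiM_component) (auto intro: M0.prob_space_axioms)
    have "AE x in distr Om M0 (\<lambda>\<omega>. \<omega> u). fst (snd x) j > 0" unfolding d by (rule *)
    from AE_distrD[OF measurable_omega this] show ?thesis
      by (simp only: ginter_def)
  qed
  then show ?thesis by (auto simp: good_def AE_all_countable)
qed

end

section \<open>Integral equations for the matching probabilities\<close>

lemma Ymatch_cong_root:
  assumes e: "ginter \<omega> [] = ginter \<omega>' []" and s: "\<And>k. sub \<omega> k = sub \<omega>' k"
  shows "Ymatch t c \<omega> As \<longleftrightarrow> Ymatch t c \<omega>' As"
proof -
  have age: "age \<omega> k = age \<omega>' k" for k
    by (simp add: daughter_age_def e)
  have bt: "bt \<omega> u = bt \<omega>' u" for u
    by (cases u) (simp_all add: age s)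
  have gp: "gpath \<omega> (k # u) = gpath \<omega>' (k # u)" for k u
    using sub_data(1)[of \<omega> k u] sub_data(1)[of \<omega>' k u] s by simp
  have Y: "Yset t c \<omega> = Yset t c \<omega>'"
    by (simp add: Yset_def age s)
  have "trip t \<omega> u v = trip t \<omega>' u v" if "v \<noteq> []" for u v
    using that gp by (cases v) (simp_all add: trip_def bt del: bt.simps)
  then have "walk t \<omega> u us = walk t \<omega>' u us" if "[] \<notin> set us" for u us
    using that by (induction us arbitrary: u) auto
  moreover have "[] \<notin> set us" if "set us = Yset t c \<omega>'" for us
    using that by simp
  ultimately show ?thesis unfolding Ymatch_def Y by metis
qed

definition glue :: "real \<Rightarrow> omega \<Rightarrow> omega \<Rightarrow> omega" where
  "glue s \<omega>1 \<omega>0 u = (case u of [] \<Rightarrow> (gpath \<omega>1 [], case_nat s (ginter \<omega>1 []), gcoin \<omega>1 [])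
     | k # w \<Rightarrow> (case k of 0 \<Rightarrow> \<omega>0 w | Suc j \<Rightarrow> \<omega>1 (j # w)))"

lemma glue_simps [simp]:
  "ginter (glue s \<omega>1 \<omega>0) [] 0 = s" "tlw (glue s \<omega>1 \<omega>0) = \<omega>1" "sub (glue s \<omega>1 \<omega>0) 0 = \<omega>0"
proof -
  show "tlw (glue s \<omega>1 \<omega>0) = \<omega>1"
  proof
    fix u show "tlw (glue s \<omega>1 \<omega>0) u = \<omega>1 u"
      by (cases u) (auto simp: tlw_def glue_def gpath_def ginter_def gcoin_def)
  qed
qed (auto simp: glue_def ginter_def sub_def)

lemma good_glue: "good (glue s \<omega>1 \<omega>0) \<longleftrightarrow> s > 0 \<and> good \<omega>1 \<and> good \<omega>0"
proof
  assume "good (glue s \<omega>1 \<omega>0)"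
  then show "s > 0 \<and> good \<omega>1 \<and> good \<omega>0"
    using good_tlw good_sub[of "glue s \<omega>1 \<omega>0" 0] by (auto simp: good_def dest: spec[of _ "[]"]) (metis glue_simps(1), metis glue_simps(2))
next
  assume *: "s > 0 \<and> good \<omega>1 \<and> good \<omega>0"
  show "good (glue s \<omega>1 \<omega>0)"
    unfolding good_def
  proof (intro allI)
    fix u j
    show "ginter (glue s \<omega>1 \<omega>0) u j > 0"
    proof (cases u)
      case Nil
      then show ?thesis using * by (cases j) (auto simp: glue_def ginter_def good_def)
    next
      case (Cons k w)
      then show ?thesis using * by (cases k) (auto simp: glue_def ginter_def good_def)
    qed
  qed
qed

definition glue_index :: "nat list \<Rightarrow> nat list + nat list" where
  "glue_index u = (case u of [] \<Rightarrow> Inl [] | k # w \<Rightarrow> (case k of 0 \<Rightarrow> Inr w | Suc j \<Rightarrow> Inl (j # w)))"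

lemma inj_glue_index: "inj glue_index"
  by (auto simp: inj_def glue_index_def split: list.splits nat.splits)

context genus_data
begin

lemma nn_integral_M0:
  assumes [measurable]: "F \<in> borel_measurable M0"
  shows "(\<integral>\<^sup>+x. F x \<partial>M0) = (\<integral>\<^sup>+z. \<integral>\<^sup>+e. \<integral>\<^sup>+c. F (z, e, c) \<partial>Coin \<partial>Arr \<partial>MZ)"
proof -
  have "(\<integral>\<^sup>+x. F x \<partial>M0) = (\<integral>\<^sup>+z. \<integral>\<^sup>+y. F (z, y) \<partial>(Arr \<Otimes>\<^sub>M Coin) \<partial>MZ)"
    by (subst ArrCoin.nn_integral_fst) auto
  also have "\<dots> = (\<integral>\<^sup>+z. \<integral>\<^sup>+e. \<integral>\<^sup>+c. F (z, e, c) \<partial>Coin \<partial>Arr \<partial>MZ)"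
    by (intro nn_integral_cong, subst measure_pmf.nn_integral_fst[symmetric]) auto
  finally show ?thesis .
qed

definition shift_root :: "real \<times> path \<times> (nat \<Rightarrow> real) \<times> bool \<Rightarrow> path \<times> (nat \<Rightarrow> real) \<times> bool" where
  "shift_root x = (fst (snd x), case_nat (fst x) (fst (snd (snd x))), snd (snd (snd x)))"

lemma measurable_case_nat_Arr: "(\<lambda>(s, e). case_nat s e) \<in> measurable (Exq \<Otimes>\<^sub>M Arr) Arr"
  unfolding split_beta' by (intro measurable_case_nat' measurable_fst measurable_snd)

lemma measurable_shift_root [measurable]: "shift_root \<in> measurable (Exq \<Otimes>\<^sub>M M0) M0"
proof -
  have 1: "(\<lambda>x. (fst x, fst (snd (snd x)))) \<in> measurable (Exq \<Otimes>\<^sub>M M0) (Exq \<Otimes>\<^sub>M Arr)"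
    by measurable
  have [measurable]: "(\<lambda>x. case_nat (fst x) (fst (snd (snd x)))) \<in> measurable (Exq \<Otimes>\<^sub>M M0) Arr"
    using measurable_compose[OF 1 measurable_case_nat_Arr] by simp
  show ?thesis unfolding shift_root_def[abs_def] by measurable
qed

lemma distr_shift_root: "distr (Exq \<Otimes>\<^sub>M M0) M0 shift_root = M0"
proof (rule measure_eqI)
  fix A assume "A \<in> sets (distr (Exq \<Otimes>\<^sub>M M0) M0 shift_root)"
  then have A: "A \<in> sets M0" by simp
  interpret S: sequence_space Exq by unfold_locales
  interpret EZ: pair_sigma_finite Exq MZ by unfold_locales
  define F :: "path \<times> (nat \<Rightarrow> real) \<times> bool \<Rightarrow> ennreal" where "F = indicator A"
  have F[measurable]: "F \<in> borel_measurable M0" unfolding F_def using A by simp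
  have Fs: "(\<lambda>x. F (shift_root x)) \<in> borel_measurable (Exq \<Otimes>\<^sub>M M0)" by measurable
  have "emeasure (distr (Exq \<Otimes>\<^sub>M M0) M0 shift_root) A = (\<integral>\<^sup>+x. F x \<partial>distr (Exq \<Otimes>\<^sub>M M0) M0 shift_root)"
    using A by (simp add: F_def)
  also have "\<dots> = (\<integral>\<^sup>+x. F (shift_root x) \<partial>(Exq \<Otimes>\<^sub>M M0))"
    by (intro nn_integral_distr) auto
  also have "\<dots> = (\<integral>\<^sup>+s. \<integral>\<^sup>+y. F (shift_root (s, y)) \<partial>M0 \<partial>Exq)"
    using Fs by (rule M0.nn_integral_fst[symmetric])
  also have "\<dots> = (\<integral>\<^sup>+s. \<integral>\<^sup>+z. \<integral>\<^sup>+e. \<integral>\<^sup>+c. F (shift_root (s, z, e, c)) \<partial>Coin \<partial>Arr \<partial>MZ \<partial>Exq)"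
    by (intro nn_integral_cong nn_integral_M0) measurable
  also have "\<dots> = (\<integral>\<^sup>+z. \<integral>\<^sup>+s. \<integral>\<^sup>+e. \<integral>\<^sup>+c. F (shift_root (s, z, e, c)) \<partial>Coin \<partial>Arr \<partial>Exq \<partial>MZ)"
    by (intro EZ.Fubini'[symmetric]) measurable
  also have "\<dots> = (\<integral>\<^sup>+z. \<integral>\<^sup>+e. \<integral>\<^sup>+c. F (z, e, c) \<partial>Coin \<partial>Arr \<partial>MZ)"
  proof (intro nn_integral_cong)
    fix z assume [measurable]: "z \<in> space MZ"
    define H where "H e = (\<integral>\<^sup>+c. F (z, e, c) \<partial>Coin)" for e
    have H: "H \<in> borel_measurable Arr" unfolding H_def by measurable
    have "(\<integral>\<^sup>+s. \<integral>\<^sup>+e. \<integral>\<^sup>+c. F (shift_root (s, z, e, c)) \<partial>Coin \<partial>Arr \<partial>Exq) =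
      (\<integral>\<^sup>+s. \<integral>\<^sup>+e. H (case_nat s e) \<partial>Arr \<partial>Exq)"
      by (simp add: shift_root_def H_def)
    also have "\<dots> = (\<integral>\<^sup>+x. H (case x of (s, e) \<Rightarrow> case_nat s e) \<partial>(Exq \<Otimes>\<^sub>M Arr))"
      using measurable_compose[OF measurable_case_nat_Arr H]
      by (subst Arr.nn_integral_fst[symmetric]) auto
    also have "\<dots> = (\<integral>\<^sup>+e. H e \<partial>distr (Exq \<Otimes>\<^sub>M Arr) Arr (\<lambda>(s, e). case_nat s e))"
      using measurable_case_nat_Arr H by (intro nn_integral_distr[symmetric]) auto
    also have "\<dots> = (\<integral>\<^sup>+e. H e \<partial>Arr)" using S.PiM_iter by simp
    finally show "(\<integral>\<^sup>+s. \<integral>\<^sup>+e. \<integral>\<^sup>+c. F (shift_root (s, z, e, c)) \<partial>Coin \<partial>Arr \<partial>Exq) =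
      (\<integral>\<^sup>+e. \<integral>\<^sup>+c. F (z, e, c) \<partial>Coin \<partial>Arr)" by (simp add: H_def)
  qed
  also have "\<dots> = (\<integral>\<^sup>+x. F x \<partial>M0)" by (rule nn_integral_M0[symmetric]) measurable
  also have "\<dots> = emeasure M0 A" using A by (simp add: F_def)
  finally show "emeasure (distr (Exq \<Otimes>\<^sub>M M0) M0 shift_root) A = emeasure M0 A" .
qed simp

definition reroot :: "(path \<times> bool) \<times> path \<times> (nat \<Rightarrow> real) \<times> bool \<Rightarrow> path \<times> (nat \<Rightarrow> real) \<times> bool" where
  "reroot x = (fst (fst x), fst (snd (snd x)), snd (fst x))"

lemma measurable_reroot [measurable]: "reroot \<in> measurable ((MZ \<Otimes>\<^sub>M Coin) \<Otimes>\<^sub>M M0) M0"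
  unfolding reroot_def[abs_def] by measurable

sublocale ZC: pair_prob_space MZ Coin
  by unfold_locales

lemma distr_reroot: "distr ((MZ \<Otimes>\<^sub>M Coin) \<Otimes>\<^sub>M M0) M0 reroot = M0"
proof (rule measure_eqI)
  fix A assume "A \<in> sets (distr ((MZ \<Otimes>\<^sub>M Coin) \<Otimes>\<^sub>M M0) M0 reroot)"
  then have A: "A \<in> sets M0" by simp
  define F :: "path \<times> (nat \<Rightarrow> real) \<times> bool \<Rightarrow> ennreal" where "F = indicator A"
  have F[measurable]: "F \<in> borel_measurable M0" unfolding F_def using A by simp
  have Fs: "(\<lambda>x. F (reroot x)) \<in> borel_measurable ((MZ \<Otimes>\<^sub>M Coin) \<Otimes>\<^sub>M M0)" by measurable
  interpret CA: pair_sigma_finite Coin Arr by unfold_locales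
  have "emeasure (distr ((MZ \<Otimes>\<^sub>M Coin) \<Otimes>\<^sub>M M0) M0 reroot) A = (\<integral>\<^sup>+x. F x \<partial>distr ((MZ \<Otimes>\<^sub>M Coin) \<Otimes>\<^sub>M M0) M0 reroot)"
    using A by (simp add: F_def)
  also have "\<dots> = (\<integral>\<^sup>+x. F (reroot x) \<partial>((MZ \<Otimes>\<^sub>M Coin) \<Otimes>\<^sub>M M0))"
    by (intro nn_integral_distr) auto
  also have "\<dots> = (\<integral>\<^sup>+q. \<integral>\<^sup>+y. F (reroot (q, y)) \<partial>M0 \<partial>(MZ \<Otimes>\<^sub>M Coin))"
    using Fs by (rule M0.nn_integral_fst[symmetric])
  also have "\<dots> = (\<integral>\<^sup>+z. \<integral>\<^sup>+c. \<integral>\<^sup>+y. F (reroot ((z, c), y)) \<partial>M0 \<partial>Coin \<partial>MZ)"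
    by (subst measure_pmf.nn_integral_fst[symmetric]) auto
  also have "\<dots> = (\<integral>\<^sup>+z. \<integral>\<^sup>+c. \<integral>\<^sup>+z'. \<integral>\<^sup>+e. \<integral>\<^sup>+c'. F (reroot ((z, c), z', e, c')) \<partial>Coin \<partial>Arr \<partial>MZ \<partial>Coin \<partial>MZ)"
    by (intro nn_integral_cong nn_integral_M0) auto
  also have "\<dots> = (\<integral>\<^sup>+z. \<integral>\<^sup>+c. \<integral>\<^sup>+e. F (z, e, c) \<partial>Arr \<partial>Coin \<partial>MZ)"
    by (simp add: reroot_def MZ.emeasure_space_1)
  also have "\<dots> = (\<integral>\<^sup>+z. \<integral>\<^sup>+e. \<integral>\<^sup>+c. F (z, e, c) \<partial>Coin \<partial>Arr \<partial>MZ)"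
    by (intro nn_integral_cong CA.Fubini'[symmetric]) auto
  also have "\<dots> = (\<integral>\<^sup>+x. F x \<partial>M0)" by (rule nn_integral_M0[symmetric]) measurable
  also have "\<dots> = emeasure M0 A" using A by (simp add: F_def)
  finally show "emeasure (distr ((MZ \<Otimes>\<^sub>M Coin) \<Otimes>\<^sub>M M0) M0 reroot) A = emeasure M0 A" .
qed simp

lemma glue_eq: "glue s \<omega>1 \<omega>0 = fun_upd (interleave glue_index \<omega>1 \<omega>0) [] (shift_root (s, interleave glue_index \<omega>1 \<omega>0 []))"
proof
  fix u
  show "glue s \<omega>1 \<omega>0 u = fun_upd (interleave glue_index \<omega>1 \<omega>0) [] (shift_root (s, interleave glue_index \<omega>1 \<omega>0 [])) u"
    by (cases u) (auto simp: glue_def interleave_def glue_index_def shift_root_def gpath_def ginter_def gcoin_def split: nat.splits)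
qed

lemma nn_integral_glue:
  assumes G: "G \<in> borel_measurable Om"
  shows "(\<integral>\<^sup>+\<omega>. G \<omega> \<partial>Om) = (\<integral>\<^sup>+s. \<integral>\<^sup>+\<omega>1. \<integral>\<^sup>+\<omega>0. G (glue s \<omega>1 \<omega>0) \<partial>Om \<partial>Om \<partial>Exq)"
proof -
  have "(\<integral>\<^sup>+\<omega>. G \<omega> \<partial>Om) = (\<integral>\<^sup>+s. \<integral>\<^sup>+\<omega>. G (fun_upd \<omega> [] (shift_root (s, \<omega> []))) \<partial>Om \<partial>Exq)"
    using G unfolding Om_eq
    by (intro nn_integral_PiM_replace M0.prob_space_axioms measurable_shift_root distr_shift_root)
  also have "\<dots> = (\<integral>\<^sup>+s. \<integral>\<^sup>+\<omega>1. \<integral>\<^sup>+\<omega>0. G (glue s \<omega>1 \<omega>0) \<partial>Om \<partial>Om \<partial>Exq)"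
    unfolding glue_eq
  proof (rule nn_integral_cong)
    fix s :: real
    have "(\<lambda>\<omega>. fun_upd \<omega> [] (shift_root (s, \<omega> []))) \<in> measurable (\<Pi>\<^sub>M u\<in>UNIV. M0) (\<Pi>\<^sub>M u\<in>UNIV. M0)"
      by (intro measurable_fun_upd[where J = UNIV] measurable_compose[OF _ measurable_shift_root]) auto
    from measurable_compose[OF this G[unfolded Om_eq]]
    show "(\<integral>\<^sup>+\<omega>. G (fun_upd \<omega> [] (shift_root (s, \<omega> []))) \<partial>Om) =
      (\<integral>\<^sup>+\<omega>1. \<integral>\<^sup>+\<omega>0. G (fun_upd (interleave glue_index \<omega>1 \<omega>0) [] (shift_root (s, interleave glue_index \<omega>1 \<omega>0 []))) \<partial>Om \<partial>Om)"
      unfolding Om_eq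
      by (intro nn_integral_PiM_interleave[OF M0.prob_space_axioms inj_glue_index,
          of "\<lambda>\<omega>. G (fun_upd \<omega> [] (shift_root (s, \<omega> [])))"])
  qed
  finally show ?thesis .
qed

lemma nn_integral_reroot:
  assumes G: "G \<in> borel_measurable Om"
  shows "(\<integral>\<^sup>+\<omega>. G \<omega> \<partial>Om) =
    (\<integral>\<^sup>+q. \<integral>\<^sup>+\<omega>. G (fun_upd \<omega> [] (fst q, ginter \<omega> [], snd q)) \<partial>Om \<partial>(MZ \<Otimes>\<^sub>M Coin))"
proof -
  have "(\<integral>\<^sup>+\<omega>. G \<omega> \<partial>Om) = (\<integral>\<^sup>+q. \<integral>\<^sup>+\<omega>. G (fun_upd \<omega> [] (reroot (q, \<omega> []))) \<partial>Om \<partial>(MZ \<Otimes>\<^sub>M Coin))"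
    using G unfolding Om_eq
    by (intro nn_integral_PiM_replace M0.prob_space_axioms measurable_reroot distr_reroot)
  then show ?thesis by (simp add: reroot_def ginter_def)
qed

definition yP :: "real \<Rightarrow> real \<Rightarrow> test list \<Rightarrow> real" where
  "yP t c As = measure Om {\<omega> \<in> space Om. Ymatch t c \<omega> As}"

definition xP :: "real \<Rightarrow> test list \<Rightarrow> real" where
  "xP t As = measure Om {\<omega> \<in> space Om. Xmatch t \<omega> As}"

lemma yP_bounds: "0 \<le> yP t c As" "yP t c As \<le> 1" and xP_bounds: "0 \<le> xP t As" "xP t As \<le> 1"
  by (auto simp: yP_def xP_def)

lemma measurable_yP [measurable (raw)]:
  assumes [measurable]: "t \<in> borel_measurable N" "c \<in> borel_measurable N" and ok: "ok As"
  shows "(\<lambda>x. yP (t x) (c x) As) \<in> borel_measurable N"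
proof -
  note measurable_Ymatch[OF _ _ _ ok, measurable (raw)]
  have "{x \<in> space (N \<Otimes>\<^sub>M Om). Ymatch (t (fst x)) (c (fst x)) (snd x) As} \<in> sets (N \<Otimes>\<^sub>M Om)"
    by measurable
  moreover have "{x \<in> space (N \<Otimes>\<^sub>M Om). snd x \<in> {\<omega> \<in> space Om. Ymatch (t (fst x)) (c (fst x)) \<omega> As}} =
    {x \<in> space (N \<Otimes>\<^sub>M Om). Ymatch (t (fst x)) (c (fst x)) (snd x) As}"
    by (auto simp: space_pair_measure)
  ultimately have "(\<lambda>x. emeasure Om {\<omega> \<in> space Om. Ymatch (t x) (c x) \<omega> As}) \<in> borel_measurable N"
    by (intro Om.measurable_emeasure) auto
  then show ?thesis unfolding yP_def measure_def by measurable
qed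

lemma measurable_xP [measurable (raw)]:
  assumes [measurable]: "t \<in> borel_measurable N" and ok: "ok As"
  shows "(\<lambda>x. xP (t x) As) \<in> borel_measurable N"
proof -
  note measurable_Xmatch[OF _ _ ok, measurable (raw)]
  have "{x \<in> space (N \<Otimes>\<^sub>M Om). Xmatch (t (fst x)) (snd x) As} \<in> sets (N \<Otimes>\<^sub>M Om)"
    by measurable
  moreover have "{x \<in> space (N \<Otimes>\<^sub>M Om). snd x \<in> {\<omega> \<in> space Om. Xmatch (t (fst x)) \<omega> As}} =
    {x \<in> space (N \<Otimes>\<^sub>M Om). Xmatch (t (fst x)) (snd x) As}"
    by (auto simp: space_pair_measure)
  ultimately have "(\<lambda>x. emeasure Om {\<omega> \<in> space Om. Xmatch (t x) \<omega> As}) \<in> borel_measurable N"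
    by (intro Om.measurable_emeasure) auto
  then show ?thesis unfolding xP_def measure_def by measurable
qed

lemma nn_integral_of_bool:
  assumes [measurable]: "Measurable.pred Om P"
  shows "(\<integral>\<^sup>+\<omega>. of_bool (P \<omega>) \<partial>Om) = ennreal (measure Om {\<omega> \<in> space Om. P \<omega>})"
proof -
  have "(\<integral>\<^sup>+\<omega>. of_bool (P \<omega>) \<partial>Om) = (\<integral>\<^sup>+\<omega>. indicator {\<omega> \<in> space Om. P \<omega>} \<omega> \<partial>Om)"
    by (intro nn_integral_cong) (simp add: indicator_def)
  also have "\<dots> = emeasure Om {\<omega> \<in> space Om. P \<omega>}"
    by (rule nn_integral_indicator) measurable
  finally show ?thesis by (simp add: Om.emeasure_eq_measure)
qed

lemma nn_integral_Ymatch: "ok As \<Longrightarrow> (\<integral>\<^sup>+\<omega>. of_bool (Ymatch t c \<omega> As) \<partial>Om) = ennreal (yP t c As)"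
  unfolding yP_def by (intro nn_integral_of_bool measurable_Ymatch) auto

lemma nn_integral_Xmatch: "ok As \<Longrightarrow> (\<integral>\<^sup>+\<omega>. of_bool (Xmatch t \<omega> As) \<partial>Om) = ennreal (xP t As)"
  unfolding xP_def by (intro nn_integral_of_bool measurable_Xmatch) auto

definition conv :: "(test list \<Rightarrow> real) \<Rightarrow> (test list \<Rightarrow> real) \<Rightarrow> test list \<Rightarrow> real" where
  "conv y x As = (\<Sum>k\<le>length As. y (take k As) * x (drop k As))"

lemma yP_equation:
  assumes ok: "ok As"
  shows "yP t c As = (\<integral>s. exponential_density g s *
    (if s < c \<and> s \<le> t then conv (yP (t - s) (c - s)) (xP (t - s)) As else of_bool (As = [])) \<partial>lborel)"
proof -
  define R where "R s = (if s < c \<and> s \<le> t then conv (yP (t - s) (c - s)) (xP (t - s)) As else of_bool (As = []))" for s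
  note ok' = ok_take[OF ok] ok_drop[OF ok]
  have R[measurable]: "R \<in> borel_measurable borel"
    unfolding R_def conv_def using ok' by measurable
  have R0: "R s \<ge> 0" for s
    by (auto simp: R_def conv_def yP_bounds xP_bounds intro!: sum_nonneg)
  have YP: "Measurable.pred Om (\<lambda>\<omega>. Ymatch t c \<omega> As)" using ok by (intro measurable_Ymatch) auto
  define G :: "omega \<Rightarrow> ennreal" where "G \<omega> = of_bool (good \<omega> \<and> Ymatch t c \<omega> As)" for \<omega>
  have [measurable]: "G \<in> borel_measurable Om" unfolding G_def using YP by measurable
  have "ennreal (yP t c As) = (\<integral>\<^sup>+\<omega>. of_bool (Ymatch t c \<omega> As) \<partial>Om)"
    using nn_integral_Ymatch[OF ok] by simp
  also have "\<dots> = (\<integral>\<^sup>+\<omega>. G \<omega> \<partial>Om)"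
    using AE_good by (intro nn_integral_cong_AE) (auto simp: G_def elim!: eventually_mono)
  also have "\<dots> = (\<integral>\<^sup>+s. \<integral>\<^sup>+\<omega>1. \<integral>\<^sup>+\<omega>0. G (glue s \<omega>1 \<omega>0) \<partial>Om \<partial>Om \<partial>Exq)"
    by (rule nn_integral_glue) measurable
  also have "\<dots> = (\<integral>\<^sup>+s. of_bool (s > 0) * ennreal (R s) \<partial>Exq)"
  proof (rule nn_integral_cong)
    fix s :: real
    show "(\<integral>\<^sup>+\<omega>1. \<integral>\<^sup>+\<omega>0. G (glue s \<omega>1 \<omega>0) \<partial>Om \<partial>Om) = of_bool (s > 0) * ennreal (R s)"
    proof (cases "s > 0")
      case False
      then show ?thesis by (simp add: G_def good_glue)
    next
      case s: True
      have "(\<integral>\<^sup>+\<omega>1. \<integral>\<^sup>+\<omega>0. G (glue s \<omega>1 \<omega>0) \<partial>Om \<partial>Om) =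
        (\<integral>\<^sup>+\<omega>1. \<integral>\<^sup>+\<omega>0. (if s < c \<and> s \<le> t
          then \<Sum>k\<le>length As. of_bool (Ymatch (t - s) (c - s) \<omega>1 (take k As)) * of_bool (Xmatch (t - s) \<omega>0 (drop k As))
          else of_bool (As = [])) \<partial>Om \<partial>Om)"
      proof (rule nn_integral_cong_AE, use AE_good in eventually_elim, rule nn_integral_cong_AE, use AE_good in eventually_elim)
        fix \<omega>1 \<omega>0 assume good: "good \<omega>1" "good \<omega>0"
        then have gg: "good (glue s \<omega>1 \<omega>0)" using s by (simp add: good_glue)
        have *: "of_bool (\<exists>k\<le>length As. Ymatch (t - s) (c - s) \<omega>1 (take k As) \<and> Xmatch (t - s) \<omega>0 (drop k As)) =
          (\<Sum>k\<le>length As. of_bool (Ymatch (t - s) (c - s) \<omega>1 (take k As)) * of_bool (Xmatch (t - s) \<omega>0 (drop k As)) :: ennreal)"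
        proof (cases "\<exists>k\<le>length As. Ymatch (t - s) (c - s) \<omega>1 (take k As) \<and> Xmatch (t - s) \<omega>0 (drop k As)")
          case True
          then obtain k where k: "k \<le> length As" "Ymatch (t - s) (c - s) \<omega>1 (take k As)" "Xmatch (t - s) \<omega>0 (drop k As)"
            by blast
          have "\<not> Ymatch (t - s) (c - s) \<omega>1 (take j As)" if "j \<le> length As" "j \<noteq> k" for j
            using Ymatch_card[of "t - s" "c - s" \<omega>1 "take j As"] Ymatch_card[OF k(2)] that k(1) by auto
          then have "(\<Sum>k\<le>length As. of_bool (Ymatch (t - s) (c - s) \<omega>1 (take k As)) * of_bool (Xmatch (t - s) \<omega>0 (drop k As)) :: ennreal) =
            (\<Sum>j\<le>length As. if j = k then 1 else 0)"
            using k by (intro sum.cong) auto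
          then show ?thesis using True k by simp
        next
          case False
          then show ?thesis by (auto intro!: sum.neutral[symmetric])
        qed
        show "G (glue s \<omega>1 \<omega>0) = (if s < c \<and> s \<le> t
          then \<Sum>k\<le>length As. of_bool (Ymatch (t - s) (c - s) \<omega>1 (take k As)) * of_bool (Xmatch (t - s) \<omega>0 (drop k As))
          else of_bool (As = []))"
          unfolding G_def *[symmetric] using Ymatch_rec[OF gg, of t c As] gg by simp
      qed
      also have "\<dots> = ennreal (R s)"
      proof (cases "s < c \<and> s \<le> t")
        case False
        then show ?thesis by (auto simp: R_def Om.emeasure_space_1)
      next
        case True
        have YP: "Measurable.pred Om (\<lambda>\<omega>. Ymatch (t - s) (c - s) \<omega> (take k As))" 
          and XP: "Measurable.pred Om (\<lambda>\<omega>. Xmatch (t - s) \<omega> (drop k As))" for k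
          using ok' by (intro measurable_Ymatch measurable_Xmatch; simp)+
        define Yb where "Yb k \<omega> = (of_bool (Ymatch (t - s) (c - s) \<omega> (take k As)) :: ennreal)" for k \<omega>
        define Xb where "Xb k \<omega> = (of_bool (Xmatch (t - s) \<omega> (drop k As)) :: ennreal)" for k \<omega>
        have [measurable]: "Yb k \<in> borel_measurable Om" "Xb k \<in> borel_measurable Om" for k
          unfolding Yb_def Xb_def using YP[of k] XP[of k] by measurable
        have "(\<integral>\<^sup>+\<omega>1. \<integral>\<^sup>+\<omega>0. (\<Sum>k\<le>length As. of_bool (Ymatch (t - s) (c - s) \<omega>1 (take k As)) * of_bool (Xmatch (t - s) \<omega>0 (drop k As))) \<partial>Om \<partial>Om)
          = (\<Sum>k\<le>length As. (\<integral>\<^sup>+\<omega>1. of_bool (Ymatch (t - s) (c - s) \<omega>1 (take k As)) \<partial>Om) * (\<integral>\<^sup>+\<omega>0. of_bool (Xmatch (t - s) \<omega>0 (drop k As)) \<partial>Om))"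
          unfolding Yb_def[symmetric] Xb_def[symmetric]
          by (simp add: nn_integral_sum nn_integral_cmult nn_integral_multc)
        also have "\<dots> = (\<Sum>k\<le>length As. ennreal (yP (t - s) (c - s) (take k As)) * ennreal (xP (t - s) (drop k As)))"
          using ok' by (simp add: nn_integral_Ymatch nn_integral_Xmatch)
        also have "\<dots> = ennreal (R s)"
          using True by (simp add: R_def conv_def ennreal_mult'' yP_bounds xP_bounds flip: sum_ennreal)
        finally show ?thesis using True by simp
      qed
      finally show ?thesis using s by simp
    qed
  qed
  also have "\<dots> = (\<integral>\<^sup>+s. ennreal (exponential_density g s) * (of_bool (s > 0) * ennreal (R s)) \<partial>lborel)"
    by (subst nn_integral_density) auto
  also have "\<dots> = (\<integral>\<^sup>+s. ennreal (exponential_density g s * R s) \<partial>lborel)"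
  proof (rule nn_integral_cong_AE)
    have "AE s in lborel. s \<noteq> (0::real)" by (rule AE_lborel_singleton)
    then show "AE s in lborel. ennreal (exponential_density g s) * (of_bool (s > 0) * ennreal (R s)) = ennreal (exponential_density g s * R s)"
    proof eventually_elim
      case (elim s)
      then show ?case using R0[of s] exponential_density_nonneg[OF g, of s]
        by (cases "s > 0") (auto simp: ennreal_mult exponential_density_def)
    qed
  qed
  finally have 1: "ennreal (yP t c As) = (\<integral>\<^sup>+s. ennreal (exponential_density g s * R s) \<partial>lborel)" .
  have 2: "(\<integral>s. exponential_density g s * R s \<partial>lborel) = enn2real (\<integral>\<^sup>+s. ennreal (exponential_density g s * R s) \<partial>lborel)"
    using R0 exponential_density_nonneg[OF g] by (intro integral_eq_nn_integral) auto
  have "yP t c As = (\<integral>s. exponential_density g s * R s \<partial>lborel)"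
    unfolding 2 1[symmetric] by (simp add: yP_bounds)
  then show ?thesis unfolding R_def .
qed

lemma xP_reroot:
  assumes ok: "ok As" and t: "t \<ge> 0"
    and R: "\<And>z c \<omega>. good \<omega> \<Longrightarrow> of_bool (Xmatch t (fun_upd \<omega> [] (z, ginter \<omega> [], c)) As) =
      (\<Sum>i<n. a i z c * of_bool (Ymatch t (r i z) \<omega> (Bs i)))"
    and a: "\<And>i z c. i < n \<Longrightarrow> a i z c \<ge> (0::real)" "\<And>i c. i < n \<Longrightarrow> (\<lambda>z. a i z c) \<in> borel_measurable MZ"
    and Bs: "\<And>i. i < n \<Longrightarrow> ok (Bs i)" "\<And>i. i < n \<Longrightarrow> r i \<in> borel_measurable MZ"
  shows "xP t As = (\<integral>z. (\<Sum>i<n. (f * a i z True + (1 - f) * a i z False) * yP t (r i z) (Bs i)) \<partial>MZ)"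
proof -
  have XP[measurable]: "Measurable.pred Om (\<lambda>\<omega>. Xmatch t \<omega> As)" using ok by (intro measurable_Xmatch) auto
  define G :: "omega \<Rightarrow> ennreal" where "G \<omega> = of_bool (good \<omega> \<and> Xmatch t \<omega> As)" for \<omega>
  have [measurable]: "G \<in> borel_measurable Om" unfolding G_def by measurable
  have gi: "good (fun_upd \<omega> [] (z, ginter \<omega> [], c)) \<longleftrightarrow> good \<omega>" for \<omega> z c
    by (auto simp: good_def ginter_def)
  have Y[measurable]: "Measurable.pred Om (\<lambda>\<omega>. Ymatch t (r i z) \<omega> (Bs i))" if "i < n" for i z
    using Bs that by (intro measurable_Ymatch) auto
  have F: "(\<integral>\<^sup>+\<omega>. G (fun_upd \<omega> [] (z, ginter \<omega> [], c)) \<partial>Om) = (\<Sum>i<n. ennreal (a i z c * yP t (r i z) (Bs i)))" for z c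
  proof -
    have "(\<integral>\<^sup>+\<omega>. G (fun_upd \<omega> [] (z, ginter \<omega> [], c)) \<partial>Om) = (\<integral>\<^sup>+\<omega>. (\<Sum>i<n. ennreal (a i z c) * of_bool (Ymatch t (r i z) \<omega> (Bs i))) \<partial>Om)"
    proof (rule nn_integral_cong_AE, use AE_good in eventually_elim)
      fix \<omega> assume good: "good \<omega>"
      have "G (fun_upd \<omega> [] (z, ginter \<omega> [], c)) = ennreal (of_bool (Xmatch t (fun_upd \<omega> [] (z, ginter \<omega> [], c)) As))"
        using gi good by (simp add: G_def)
      also have "\<dots> = (\<Sum>i<n. ennreal (a i z c * of_bool (Ymatch t (r i z) \<omega> (Bs i))))"
        unfolding R[OF good] using a by (subst sum_ennreal) auto
      also have "\<dots> = (\<Sum>i<n. ennreal (a i z c) * of_bool (Ymatch t (r i z) \<omega> (Bs i)))"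
        by (intro sum.cong) auto
      finally show "G (fun_upd \<omega> [] (z, ginter \<omega> [], c)) = (\<Sum>i<n. ennreal (a i z c) * of_bool (Ymatch t (r i z) \<omega> (Bs i)))" .
    qed
    also have "\<dots> = (\<Sum>i<n. ennreal (a i z c) * (\<integral>\<^sup>+\<omega>. of_bool (Ymatch t (r i z) \<omega> (Bs i)) \<partial>Om))"
    proof -
      have "(\<lambda>\<omega>. of_bool (Ymatch t (r i z) \<omega> (Bs i)) :: ennreal) \<in> borel_measurable Om" if "i < n" for i
        using Y[OF that] by measurable
      then show ?thesis by (subst nn_integral_sum) (auto intro!: sum.cong nn_integral_cmult)
    qed
    also have "\<dots> = (\<Sum>i<n. ennreal (a i z c * yP t (r i z) (Bs i)))"
      using Bs by (intro sum.cong) (auto simp: nn_integral_Ymatch ennreal_mult'' yP_bounds)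
    finally show ?thesis .
  qed
  have my: "(\<lambda>z. yP t (r i z) (Bs i)) \<in> borel_measurable MZ" if "i < n" for i
    using Bs that by (intro measurable_yP) auto
  have "ennreal (xP t As) = (\<integral>\<^sup>+\<omega>. of_bool (Xmatch t \<omega> As) \<partial>Om)"
    using nn_integral_Xmatch[OF ok] by simp
  also have "\<dots> = (\<integral>\<^sup>+\<omega>. G \<omega> \<partial>Om)"
    using AE_good by (intro nn_integral_cong_AE) (auto simp: G_def elim!: eventually_mono)
  also have "\<dots> = (\<integral>\<^sup>+q. (\<Sum>i<n. ennreal (a i (fst q) (snd q) * yP t (r i (fst q)) (Bs i))) \<partial>(MZ \<Otimes>\<^sub>M Coin))"
    by (subst nn_integral_reroot) (auto simp: F)
  also have "\<dots> = (\<integral>\<^sup>+z. \<integral>\<^sup>+c. (\<Sum>i<n. ennreal (a i z c * yP t (r i z) (Bs i))) \<partial>Coin \<partial>MZ)"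
  proof (subst measure_pmf.nn_integral_fst[symmetric])
    have "(\<lambda>q. a i (fst q) (snd q)) \<in> borel_measurable (MZ \<Otimes>\<^sub>M Coin)" if "i < n" for i
    proof -
      have "(\<lambda>q. a i (fst q) True * of_bool (snd q) + a i (fst q) False * of_bool (\<not> snd q)) \<in> borel_measurable (MZ \<Otimes>\<^sub>M Coin)"
        using a(2)[OF that] by measurable
      moreover have "(\<lambda>q. a i (fst q) True * of_bool (snd q) + a i (fst q) False * of_bool (\<not> snd q)) = (\<lambda>q. a i (fst q) (snd q))"
      proof
        fix q show "a i (fst q) True * of_bool (snd q) + a i (fst q) False * of_bool (\<not> snd q) = a i (fst q) (snd q)"
          by (cases "snd q") auto
      qed
      ultimately show ?thesis by simp
    qed
    moreover have "(\<lambda>q. yP t (r i (fst q)) (Bs i)) \<in> borel_measurable (MZ \<Otimes>\<^sub>M Coin)" if "i < n" for i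
      by (rule measurable_compose[OF measurable_fst my[OF that]])
    ultimately show "(\<lambda>q. \<Sum>i<n. ennreal (a i (fst q) (snd q) * yP t (r i (fst q)) (Bs i))) \<in> borel_measurable (MZ \<Otimes>\<^sub>M Coin)"
      by (intro borel_measurable_sum measurable_compose[OF _ measurable_ennreal] borel_measurable_times) auto
  qed simp
  also have "\<dots> = (\<integral>\<^sup>+z. ennreal (\<Sum>i<n. (f * a i z True + (1 - f) * a i z False) * yP t (r i z) (Bs i)) \<partial>MZ)"
  proof (rule nn_integral_cong)
    fix z
    have nn: "0 \<le> a i z c * yP t (r i z) (Bs i)" if "i < n" for i c using a that yP_bounds by simp
    have s: "(\<Sum>i<n. ennreal (a i z c * yP t (r i z) (Bs i))) = ennreal (\<Sum>i<n. a i z c * yP t (r i z) (Bs i))" for c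
      using nn by (intro sum_ennreal) auto
    have "(\<integral>\<^sup>+c. (\<Sum>i<n. ennreal (a i z c * yP t (r i z) (Bs i))) \<partial>Coin) =
      ennreal f * ennreal (\<Sum>i<n. a i z True * yP t (r i z) (Bs i)) + ennreal (1 - f) * ennreal (\<Sum>i<n. a i z False * yP t (r i z) (Bs i))"
      unfolding s using f by (subst nn_integral_bernoulli_pmf) (auto simp: mult.commute)
    also have "\<dots> = ennreal (f * (\<Sum>i<n. a i z True * yP t (r i z) (Bs i)) + (1 - f) * (\<Sum>i<n. a i z False * yP t (r i z) (Bs i)))"
    proof -
      have "0 \<le> (\<Sum>i<n. a i z c * yP t (r i z) (Bs i))" for c
        using nn by (intro sum_nonneg) auto
      then show ?thesis using f by (simp only: ennreal_plus ennreal_mult mult_nonneg_nonneg diff_ge_0_iff_ge less_imp_le)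
    qed
    also have "f * (\<Sum>i<n. a i z True * yP t (r i z) (Bs i)) + (1 - f) * (\<Sum>i<n. a i z False * yP t (r i z) (Bs i)) =
      (\<Sum>i<n. (f * a i z True + (1 - f) * a i z False) * yP t (r i z) (Bs i))"
      by (simp add: sum_distrib_left distrib_right sum.distrib mult.assoc)
    finally show "(\<integral>\<^sup>+c. (\<Sum>i<n. ennreal (a i z c * yP t (r i z) (Bs i))) \<partial>Coin) =
      ennreal (\<Sum>i<n. (f * a i z True + (1 - f) * a i z False) * yP t (r i z) (Bs i))" .
  qed
  finally have 1: "ennreal (xP t As) = (\<integral>\<^sup>+z. ennreal (\<Sum>i<n. (f * a i z True + (1 - f) * a i z False) * yP t (r i z) (Bs i)) \<partial>MZ)" .
  have 2: "(\<integral>z. (\<Sum>i<n. (f * a i z True + (1 - f) * a i z False) * yP t (r i z) (Bs i)) \<partial>MZ) =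
    enn2real (\<integral>\<^sup>+z. ennreal (\<Sum>i<n. (f * a i z True + (1 - f) * a i z False) * yP t (r i z) (Bs i)) \<partial>MZ)"
  proof (intro integral_eq_nn_integral)
    show "(\<lambda>z. \<Sum>i<n. (f * a i z True + (1 - f) * a i z False) * yP t (r i z) (Bs i)) \<in> borel_measurable MZ"
      using a(2) my by (intro borel_measurable_sum borel_measurable_times borel_measurable_add borel_measurable_const) auto
    have "0 \<le> f * a i z True + (1 - f) * a i z False" if "i < n" for i z
      using a(1)[OF that] f by simp
    then show "AE z in MZ. 0 \<le> (\<Sum>i<n. (f * a i z True + (1 - f) * a i z False) * yP t (r i z) (Bs i))"
      using yP_bounds(1) by (intro AE_I2 sum_nonneg mult_nonneg_nonneg) auto
  qed
  show ?thesis unfolding 2 1[symmetric] by (simp add: xP_bounds)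
qed

definition life_bound :: "real \<Rightarrow> path \<Rightarrow> real" where
  "life_bound t z = (if ereal t < lifetime z then t + 1 else real_of_ereal (lifetime z))"

lemma measurable_life_bound [measurable]: "life_bound t \<in> borel_measurable MZ"
  unfolding life_bound_def[abs_def] by measurable

lemma root_bound_reroot: "root_bound t (fun_upd \<omega> [] (z, e, c)) = life_bound t z"
  by (simp add: root_bound_def life_bound_def gpath_def)

lemma Ymatch_reroot: "Ymatch t r (fun_upd \<omega> [] (z, ginter \<omega> [], c)) As \<longleftrightarrow> Ymatch t r \<omega> As"
  by (rule Ymatch_cong_root) (auto simp: ginter_def sub_def)

lemma xP_Nil_equation:
  assumes t: "t \<ge> 0"
  shows "xP t [] = (\<integral>z. (f * of_bool (\<not> ereal t < lifetime z) + (1 - f)) * yP t (life_bound t z) [] \<partial>MZ)"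
proof -
  have "xP t [] = (\<integral>z. (\<Sum>i<1::nat. (f * of_bool (\<not> (ereal t < lifetime z \<and> True)) +
      (1 - f) * of_bool (\<not> (ereal t < lifetime z \<and> False))) * yP t (life_bound t z) []) \<partial>MZ)"
  proof (rule xP_reroot[where a = "\<lambda>i z c. of_bool (\<not> (ereal t < lifetime z \<and> c))" and r = "\<lambda>i. life_bound t"
        and Bs = "\<lambda>i. []"])
    fix z c \<omega> assume "good \<omega>"
    then have "good (fun_upd \<omega> [] (z, ginter \<omega> [], c))" by (auto simp: good_def ginter_def)
    from Xmatch_rec(1)[OF this t]
    show "of_bool (Xmatch t (fun_upd \<omega> [] (z, ginter \<omega> [], c)) []) =
      (\<Sum>i<1::nat. of_bool (\<not> (ereal t < lifetime z \<and> c)) * of_bool (Ymatch t (life_bound t z) \<omega> []) :: real)"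
      by (simp add: root_bound_reroot Ymatch_reroot) (simp add: gpath_def gcoin_def)
  qed (use t in auto)
  then show ?thesis by simp
qed

lemma xP_Cons_equation:
  assumes t: "t \<ge> 0" and ok: "ok ((b, D, K) # As)"
  shows "xP t ((b, D, K) # As) = (if t \<le> b then
    (\<integral>z. f * of_bool (ereal t < lifetime z \<and> t \<in> D \<and> z t \<in> K) * yP t (life_bound t z) As +
       (f * of_bool (\<not> ereal t < lifetime z) + (1 - f)) * yP t (life_bound t z) ((b, D, K) # As) \<partial>MZ) else 0)"
proof -
  let ?a = "\<lambda>i z c. if i = (0::nat) then of_bool (t \<le> b \<and> ereal t < lifetime z \<and> c \<and> t \<in> D \<and> z t \<in> K)
      else of_bool (t \<le> b \<and> \<not> (ereal t < lifetime z \<and> c)) :: real"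
  let ?Bs = "\<lambda>i. if i = (0::nat) then As else (b, D, K) # As"
  have zt: "(\<lambda>z. z t) \<in> measurable MZ (count_space UNIV)" by (intro measurable_eval) auto
  have [measurable]: "Measurable.pred MZ (\<lambda>z. z t \<in> K)"
    using measurable_compose[OF zt, of "\<lambda>k. k \<in> K" "count_space UNIV"] by simp
  have "xP t ((b, D, K) # As) = (\<integral>z. (\<Sum>i<2. (f * ?a i z True + (1 - f) * ?a i z False) * yP t (life_bound t z) (?Bs i)) \<partial>MZ)"
  proof (rule xP_reroot[where a = ?a and r = "\<lambda>i. life_bound t" and Bs = ?Bs])
    fix z c \<omega> assume "good \<omega>"
    then have "good (fun_upd \<omega> [] (z, ginter \<omega> [], c))" by (auto simp: good_def ginter_def)
    from Xmatch_rec(2)[OF this t, of b D K As]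
    have "Xmatch t (fun_upd \<omega> [] (z, ginter \<omega> [], c)) ((b, D, K) # As) \<longleftrightarrow> t \<le> b \<and>
      (if ereal t < lifetime z \<and> c then t \<in> D \<and> z t \<in> K \<and> Ymatch t (life_bound t z) \<omega> As
       else Ymatch t (life_bound t z) \<omega> ((b, D, K) # As))"
      unfolding root_bound_reroot Ymatch_reroot by (simp add: gpath_def gcoin_def)
    then show "of_bool (Xmatch t (fun_upd \<omega> [] (z, ginter \<omega> [], c)) ((b, D, K) # As)) =
      (\<Sum>i<2. ?a i z c * of_bool (Ymatch t (life_bound t z) \<omega> (?Bs i)) :: real)"
      by (cases "ereal t < lifetime z"; cases c) (simp_all add: eval_nat_numeral)
  qed (use t ok in auto)
  then show ?thesis by (simp add: eval_nat_numeral mult.assoc)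
qed

end

section \<open>Primitives of locally integrable functions\<close>

lemma integrable_pair_product:
  fixes u h :: "real \<Rightarrow> real"
  assumes [measurable]: "integrable lborel u" "integrable lborel h"
  shows "integrable (lborel \<Otimes>\<^sub>M lborel) (\<lambda>z. u (fst z) * h (snd z))"
proof (rule lborel_pair.Fubini_integrable)
  show "(\<lambda>z. u (fst z) * h (snd z)) \<in> borel_measurable (lborel \<Otimes>\<^sub>M lborel)"
    by measurable
  have "(\<lambda>x. \<integral>y. norm (u (fst (x, y)) * h (snd (x, y))) \<partial>lborel) = (\<lambda>x. norm (u x) * (\<integral>y. norm (h y) \<partial>lborel))"
    by (simp add: abs_mult)
  then show "integrable lborel (\<lambda>x. \<integral>y. norm (u (fst (x, y)) * h (snd (x, y))) \<partial>lborel)"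
    using assms by simp
qed (use assms in auto)

lemma integrable_pair_dominated:
  fixes u h :: "real \<Rightarrow> real"
  assumes "integrable lborel u" "integrable lborel h"
    and "H \<in> borel_measurable (borel \<Otimes>\<^sub>M borel)" "\<And>x y. \<bar>H (x, y)\<bar> \<le> u x * h y"
  shows "integrable (lborel \<Otimes>\<^sub>M lborel) H"
proof (rule Bochner_Integration.integrable_bound[OF integrable_pair_product[OF assms(1,2)]])
  have "sets (lborel \<Otimes>\<^sub>M lborel :: (real \<times> real) measure) = sets (borel \<Otimes>\<^sub>M borel)"
    by (intro sets_pair_measure_cong) auto
  then show "H \<in> borel_measurable (lborel \<Otimes>\<^sub>M lborel)"
    using assms(3) by (simp cong: measurable_cong_sets)
  have "norm (H z) \<le> norm (u (fst z) * h (snd z))" for z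
    using assms(4)[of "fst z" "snd z"] by simp
  then show "AE z in lborel \<Otimes>\<^sub>M lborel. norm (H z) \<le> norm (u (fst z) * h (snd z))"
    by simp
qed

lemma integral_swap:
  fixes u h :: "real \<Rightarrow> real"
  assumes "integrable lborel u" "integrable lborel h"
    and "(\<lambda>z. H (fst z) (snd z)) \<in> borel_measurable (borel \<Otimes>\<^sub>M borel)" "\<And>x y. \<bar>H x y\<bar> \<le> u x * h y"
  shows "(\<integral>x. (\<integral>y. H x y \<partial>lborel) \<partial>lborel) = (\<integral>y. (\<integral>x. H x y \<partial>lborel) \<partial>lborel)"
    and "integrable lborel (\<lambda>x. \<integral>y. H x y \<partial>lborel)"
    and "integrable lborel (\<lambda>y. \<integral>x. H x y \<partial>lborel)"
proof -
  have "integrable (lborel \<Otimes>\<^sub>M lborel) (\<lambda>z. H (fst z) (snd z))"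
    using assms by (intro integrable_pair_dominated[OF assms(1,2)]) auto
  then have I: "integrable (lborel \<Otimes>\<^sub>M lborel) (\<lambda>(x, y). H x y)" by (simp add: split_beta')
  show "(\<integral>x. (\<integral>y. H x y \<partial>lborel) \<partial>lborel) = (\<integral>y. (\<integral>x. H x y \<partial>lborel) \<partial>lborel)"
    using lborel_pair.Fubini_integral[OF I] by simp
  show "integrable lborel (\<lambda>x. \<integral>y. H x y \<partial>lborel)"
    using lborel_pair.integrable_fst[OF I] by simp
  show "integrable lborel (\<lambda>y. \<integral>x. H x y \<partial>lborel)"
    using lborel_pair.integrable_snd[OF I] by simp
qed

lemma integrable_mult_bounded:
  fixes u h :: "real \<Rightarrow> real"
  assumes u: "integrable lborel u" and h: "h \<in> borel_measurable borel" "\<And>x. \<bar>h x\<bar> \<le> B"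
  shows "integrable lborel (\<lambda>x. u x * h x)"
proof (rule Bochner_Integration.integrable_bound[of _ "\<lambda>x. B * u x"])
  show "(\<lambda>x. u x * h x) \<in> borel_measurable lborel" using u h by measurable
  have "\<bar>h x\<bar> \<le> \<bar>B\<bar>" for x using h(2)[of x] by simp
  then show "AE x in lborel. norm (u x * h x) \<le> norm (B * u x)"
    by (auto simp: abs_mult mult.commute intro!: mult_right_mono)
qed (use u in simp)

lemma measurable_primitive:
  fixes u :: "real \<Rightarrow> real"
  assumes [measurable]: "u \<in> borel_measurable borel"
  shows "(\<lambda>x. \<integral>y. indicator {..x} y * u y \<partial>lborel) \<in> borel_measurable borel"
proof -
  have "(\<lambda>z. indicator {..fst z} (snd z) * u (snd z)) \<in> borel_measurable (borel \<Otimes>\<^sub>M lborel)"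
    unfolding indicator_def atMost_iff by measurable
  then show ?thesis
    by (intro lborel.borel_measurable_lebesgue_integral) (simp add: split_beta')
qed

text \<open>\<open>F'\<close> need only be defined on \<open>(0, \<infinity>)\<close>; this is absolute continuity of \<open>F\<close> on \<open>[0, \<infinity>)\<close>.\<close>
definition ac :: "(real \<Rightarrow> real) \<Rightarrow> (real \<Rightarrow> real) \<Rightarrow> bool" where
  "ac F F' \<longleftrightarrow> (\<forall>t\<ge>0. integrable lborel (\<lambda>x. indicator {0<..t} x * F' x) \<and>
     F t = F 0 + (\<integral>x. indicator {0<..t} x * F' x \<partial>lborel))"

lemma acI:
  assumes "\<And>t. t \<ge> 0 \<Longrightarrow> integrable lborel (\<lambda>x. indicator {0<..t} x * F' x)"
    and "\<And>t. t \<ge> 0 \<Longrightarrow> F t = F 0 + (\<integral>x. indicator {0<..t} x * F' x \<partial>lborel)"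
  shows "ac F F'"
  using assms unfolding ac_def by blast

lemma ac_integrable: "ac F F' \<Longrightarrow> t \<ge> 0 \<Longrightarrow> integrable lborel (\<lambda>x. indicator {0<..t} x * F' x)"
  unfolding ac_def by blast

lemma ac_integral: "ac F F' \<Longrightarrow> t \<ge> 0 \<Longrightarrow> (\<integral>x. indicator {0<..t} x * F' x \<partial>lborel) = F t - F 0"
  unfolding ac_def by (metis add_diff_cancel_left')

lemma ac_cong:
  assumes "ac F F'" "\<And>t. t \<ge> 0 \<Longrightarrow> F t = G t" "\<And>t. t > 0 \<Longrightarrow> F' t = G' t"
  shows "ac G G'"
proof -
  have e: "(\<lambda>x. indicator {0<..t} x * G' x) = (\<lambda>x. indicator {0<..t} x * F' x)" for t
    using assms(3) by (auto simp: indicator_def)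
  show ?thesis
    unfolding ac_def e
  proof (intro allI impI)
    fix t :: real assume "t \<ge> 0"
    then show "integrable lborel (\<lambda>x. indicator {0<..t} x * F' x) \<and>
      G t = G 0 + (\<integral>x. indicator {0<..t} x * F' x \<partial>lborel)"
      using assms(1) unfolding ac_def assms(2)[OF \<open>t \<ge> 0\<close>, symmetric] assms(2)[OF order_refl, symmetric] by blast
  qed
qed

lemma ac_const: "ac (\<lambda>_. c) (\<lambda>_. 0)"
  by (simp add: ac_def)

lemma ac_add: "ac F F' \<Longrightarrow> ac G G' \<Longrightarrow> ac (\<lambda>t. F t + G t) (\<lambda>t. F' t + G' t)"
  by (rule acI) (simp_all add: distrib_left ac_integrable ac_integral)

lemma ac_mult:
  assumes F: "ac F F'" and G: "ac G G'"
  shows "ac (\<lambda>t. F t * G t) (\<lambda>t. F' t * G t + F t * G' t)"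
  unfolding ac_def
proof (intro allI impI)
  fix t :: real assume t: "t \<ge> 0"
  define u where "u x = indicator {0<..t} x * F' x" for x
  define h where "h x = indicator {0<..t} x * G' x" for x
  have iu: "integrable lborel u" and ih: "integrable lborel h"
    using ac_integrable[OF F t] ac_integrable[OF G t] unfolding u_def h_def by auto
  have mu[measurable]: "u \<in> borel_measurable borel" and mh[measurable]: "h \<in> borel_measurable borel"
    using iu ih by auto
  define U where "U x = (\<integral>y. indicator {..x} y * u y \<partial>lborel)" for x
  define H where "H x = (\<integral>y. indicator {..x} y * h y \<partial>lborel)" for x
  have mU: "U \<in> borel_measurable borel" and mH: "H \<in> borel_measurable borel"
    unfolding U_def H_def by (intro measurable_primitive; measurable)+
  have bnd: "\<bar>\<integral>y. indicator {..x} y * k y \<partial>lborel\<bar> \<le> (\<integral>y. \<bar>k y\<bar> \<partial>lborel)"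
    if k: "integrable lborel k" for k :: "real \<Rightarrow> real" and x
  proof -
    have "\<bar>\<integral>y. indicator {..x} y * k y \<partial>lborel\<bar> \<le> (\<integral>y. \<bar>indicator {..x} y * k y\<bar> \<partial>lborel)"
      using integral_abs_bound by blast
    also have "\<dots> \<le> (\<integral>y. \<bar>k y\<bar> \<partial>lborel)"
      using k by (intro integral_mono integrable_abs integrable_mult_indicator[where 'b = real, simplified]) (auto simp: indicator_def)
    finally show ?thesis .
  qed
  have FU: "F x = F 0 + U x" and GH: "G x = G 0 + H x" if "0 \<le> x" "x \<le> t" for x
  proof -
    have "(\<lambda>y. indicator {..x} y * u y) = (\<lambda>y. indicator {0<..x} y * F' y)"
      "(\<lambda>y. indicator {..x} y * h y) = (\<lambda>y. indicator {0<..x} y * G' y)"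
      using that by (auto simp: u_def h_def indicator_def)
    then show "F x = F 0 + U x" "G x = G 0 + H x"
      using ac_integral[OF F that(1)] ac_integral[OF G that(1)] by (simp_all add: U_def H_def)
  qed
  have eq: "indicator {0<..t} x * (F' x * G x + F x * G' x) = (u x * G 0 + u x * H x) + (h x * F 0 + h x * U x)" for x
    using FU[of x] GH[of x] by (auto simp: u_def h_def indicator_def algebra_simps)
  have i1: "integrable lborel (\<lambda>x. u x * H x)" and i2: "integrable lborel (\<lambda>x. h x * U x)"
    using integrable_mult_bounded[OF iu mH, of "\<integral>y. \<bar>h y\<bar> \<partial>lborel"] integrable_mult_bounded[OF ih mU, of "\<integral>y. \<bar>u y\<bar> \<partial>lborel"]
      bnd[OF ih] bnd[OF iu] by (auto simp: U_def H_def)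
  have I: "integrable lborel (\<lambda>x. indicator {0<..t} x * (F' x * G x + F x * G' x))"
    unfolding eq using iu ih i1 i2 by auto
  define Q where "Q x y = of_bool (x \<le> y) * (u x * h y)" for x y :: real
  have mQ: "(\<lambda>z. Q (fst z) (snd z)) \<in> borel_measurable (borel \<Otimes>\<^sub>M borel)"
    unfolding Q_def by measurable
  have "(\<integral>x. h x * U x \<partial>lborel) = (\<integral>y. (\<integral>x. Q x y \<partial>lborel) \<partial>lborel)"
  proof (intro Bochner_Integration.integral_cong refl)
    fix y
    have "(\<integral>x. Q x y \<partial>lborel) = (\<integral>x. h y * (indicator {..y} x * u x) \<partial>lborel)"
      by (intro Bochner_Integration.integral_cong) (auto simp: Q_def indicator_def)
    then show "h y * U y = (\<integral>x. Q x y \<partial>lborel)" by (simp add: U_def)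
  qed
  also have "\<dots> = (\<integral>x. (\<integral>y. Q x y \<partial>lborel) \<partial>lborel)"
    using integral_swap(1)[of "\<lambda>x. \<bar>u x\<bar>" "\<lambda>x. \<bar>h x\<bar>" Q] iu ih mQ by (auto simp: Q_def abs_mult)
  finally have s: "(\<integral>x. h x * U x \<partial>lborel) = (\<integral>x. (\<integral>y. Q x y \<partial>lborel) \<partial>lborel)" .
  have "u x * H x + (\<integral>y. Q x y \<partial>lborel) = u x * (\<integral>y. h y \<partial>lborel)" for x
  proof -
    have ii: "integrable lborel (\<lambda>y. indicator {..x} y * h y)" "integrable lborel (\<lambda>y. of_bool (x \<le> y) * h y)"
      using integrable_mult_bounded[OF ih, of "indicator {..x}" 1] integrable_mult_bounded[OF ih, of "\<lambda>y. of_bool (x \<le> y)" 1]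
      by (auto simp: mult.commute indicator_def)
    have "(\<integral>y. Q x y \<partial>lborel) = u x * (\<integral>y. of_bool (x \<le> y) * h y \<partial>lborel)"
      by (simp add: Q_def mult.left_commute)
    moreover have "(\<integral>y. indicator {..x} y * h y + of_bool (x \<le> y) * h y \<partial>lborel) = (\<integral>y. h y \<partial>lborel)"
    proof (rule integral_cong_AE)
      have "AE y in lborel. y \<noteq> x" by (rule AE_lborel_singleton)
      then show "AE y in lborel. indicator {..x} y * h y + of_bool (x \<le> y) * h y = h y"
        by eventually_elim (auto simp: indicator_def)
    qed (use ii in auto)
    moreover have "(\<integral>y. indicator {..x} y * h y + of_bool (x \<le> y) * h y \<partial>lborel) =
      H x + (\<integral>y. of_bool (x \<le> y) * h y \<partial>lborel)"
      unfolding H_def by (rule Bochner_Integration.integral_add[OF ii])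
    ultimately show ?thesis by (simp only: distrib_left[symmetric])
  qed
  then have sum: "(\<integral>x. u x * H x \<partial>lborel) + (\<integral>x. h x * U x \<partial>lborel) = (\<integral>x. u x \<partial>lborel) * (\<integral>y. h y \<partial>lborel)"
  proof -
    have iQ: "integrable lborel (\<lambda>x. \<integral>y. Q x y \<partial>lborel)"
      using integral_swap(2)[of "\<lambda>x. \<bar>u x\<bar>" "\<lambda>x. \<bar>h x\<bar>" Q] iu ih mQ by (auto simp: Q_def abs_mult)
    assume *: "\<And>x. u x * H x + (\<integral>y. Q x y \<partial>lborel) = u x * (\<integral>y. h y \<partial>lborel)"
    have "(\<integral>x. u x * H x \<partial>lborel) + (\<integral>x. (\<integral>y. Q x y \<partial>lborel) \<partial>lborel) = (\<integral>x. u x * H x + (\<integral>y. Q x y \<partial>lborel) \<partial>lborel)"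
      using i1 iQ by simp
    also have "\<dots> = (\<integral>x. u x \<partial>lborel) * (\<integral>y. h y \<partial>lborel)" unfolding * by simp
    finally show ?thesis unfolding s .
  qed
  have "F t - F 0 = (\<integral>x. u x \<partial>lborel)" "G t - G 0 = (\<integral>x. h x \<partial>lborel)"
    using ac_integral[OF F t] ac_integral[OF G t] by (simp_all add: u_def h_def)
  then have "F t * G t = F 0 * G 0 + (\<integral>x. indicator {0<..t} x * (F' x * G x + F x * G' x) \<partial>lborel)"
  proof -
    assume d: "F t - F 0 = (\<integral>x. u x \<partial>lborel)" "G t - G 0 = (\<integral>x. h x \<partial>lborel)"
    have "(\<integral>x. indicator {0<..t} x * (F' x * G x + F x * G' x) \<partial>lborel) =
      (\<integral>x. u x \<partial>lborel) * G 0 + (\<integral>x. h x \<partial>lborel) * F 0 +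
      ((\<integral>x. u x * H x \<partial>lborel) + (\<integral>x. h x * U x \<partial>lborel))"
      unfolding eq using iu ih i1 i2 by simp
    then show ?thesis unfolding sum d[symmetric] by (simp add: algebra_simps)
  qed
  then show "integrable lborel (\<lambda>x. indicator {0<..t} x * (F' x * G x + F x * G' x)) \<and>
    F t * G t = F 0 * G 0 + (\<integral>x. indicator {0<..t} x * (F' x * G x + F x * G' x) \<partial>lborel)"
    using I by blast
qed

lemma ac_cmult: "ac F F' \<Longrightarrow> ac (\<lambda>t. c * F t) (\<lambda>t. c * F' t)"
  using ac_mult[OF ac_const, of F F' c] by simp

lemma ac_min:
  assumes "ac F F'" "b \<ge> 0"
  shows "ac (\<lambda>t. F (min t b)) (\<lambda>t. if t \<le> b then F' t else 0)"
  unfolding ac_def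
proof (intro allI impI)
  fix t :: real assume "t \<ge> 0"
  have "(\<lambda>x. indicator {0<..t} x * (if x \<le> b then F' x else 0)) = (\<lambda>x. indicator {0<..min t b} x * F' x)"
    by (auto simp: indicator_def)
  then show "integrable lborel (\<lambda>x. indicator {0<..t} x * (if x \<le> b then F' x else 0)) \<and>
    F (min t b) = F (min 0 b) + (\<integral>x. indicator {0<..t} x * (if x \<le> b then F' x else 0) \<partial>lborel)"
    using ac_integrable[OF assms(1), of "min t b"] ac_integral[OF assms(1), of "min t b"] assms(2) \<open>t \<ge> 0\<close>
    by simp
qed

lemma ac_FTC:
  assumes c: "continuous_on {0..} F" and d: "\<And>t. t > 0 \<Longrightarrow> (F has_real_derivative F' t) (at t)"
    and i: "\<And>t. t \<ge> 0 \<Longrightarrow> integrable lborel (\<lambda>x. indicator {0<..t} x * F' x)"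
  shows "ac F F'"
  unfolding ac_def
proof (intro allI impI conjI i)
  fix t :: real assume t: "t \<ge> 0"
  have "(F' has_integral F t - F 0) {0..t}"
    using t d by (intro fundamental_theorem_of_calculus_interior continuous_on_subset[OF c])
      (auto simp: has_real_derivative_iff_has_vector_derivative)
  then have "((\<lambda>x. indicator {0<..t} x * F' x) has_integral F t - F 0) {0..t}"
    by (rule has_integral_spike_finite[of "{0}", rotated 2]) auto
  then have "((\<lambda>x. indicator {0<..t} x * F' x) has_integral F t - F 0) UNIV"
    by (rule has_integral_on_superset) auto
  with has_integral_integral_lborel[OF i[OF t]] have "F t - F 0 = (\<integral>x. indicator {0<..t} x * F' x \<partial>lborel)"
    using has_integral_unique by blast
  then show "F t = F 0 + (\<integral>x. indicator {0<..t} x * F' x \<partial>lborel)" by simp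
qed

section \<open>The scale function\<close>

locale genus_scale = genus_data g f MZ for g f MZ +
  fixes v W :: "real \<Rightarrow> real"
  assumes dens: "lifetime_density MZ v" and scale: "scale_function g v W"
begin

definition v0 :: "real \<Rightarrow> real" where "v0 s = indicator {0<..} s * v s"
definition Wp :: "real \<Rightarrow> real" where "Wp t = indicator {0..} t * W t"
definition W0 :: "real \<Rightarrow> real" where "W0 t = W (max 0 t)"
definition V :: "real \<Rightarrow> real" where "V t = 1 - f + f * W0 t"
definition cv :: "real \<Rightarrow> real" where "cv t = (\<integral>l. v0 l * Wp (t - l) \<partial>lborel)"
definition wp :: "real \<Rightarrow> real" where "wp t = indicator {0<..} t * (g * (Wp t - cv t))"

lemma v0_integrable [simp]: "integrable lborel v0"
  using dens unfolding lifetime_density_def set_integrable_def v0_def[abs_def] by simp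

lemma v0_measurable [measurable]: "v0 \<in> borel_measurable borel"
  using borel_measurable_integrable[OF v0_integrable] by simp

lemma v0_nonneg: "v0 s \<ge> 0"
  using dens by (auto simp: lifetime_density_def v0_def indicator_def)

lemma v0_eq_0: "s \<le> 0 \<Longrightarrow> v0 s = 0"
  by (simp add: v0_def)

lemma W_0: "W 0 = 1" and W_cont: "continuous_on {0..} W" and W_mono: "mono_on {0..} W"
  using scale by (auto simp: scale_function_def)

lemma W0_mono: "s \<le> t \<Longrightarrow> W0 s \<le> W0 t"
  unfolding W0_def by (intro mono_onD[OF W_mono]) auto

lemma W0_ge_1: "W0 t \<ge> 1"
  using mono_onD[OF W_mono, of 0 "max 0 t"] by (simp add: W0_def W_0)

lemma W0_eq: "t \<ge> 0 \<Longrightarrow> W0 t = W t"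
  by (simp add: W0_def)

lemma W0_continuous: "continuous_on UNIV W0"
  unfolding W0_def by (rule continuous_on_compose2[OF W_cont]) (auto intro!: continuous_intros)

lemma W0_measurable [measurable]: "W0 \<in> borel_measurable borel"
  by (rule borel_measurable_continuous_onI[OF W0_continuous])

lemma Wp_eq: "Wp t = indicator {0..} t * W0 t"
  by (simp add: Wp_def W0_def indicator_def)

lemma Wp_measurable [measurable]: "Wp \<in> borel_measurable borel"
  unfolding Wp_eq[abs_def] by measurable

lemma Wp_nonneg: "Wp t \<ge> 0" and Wp_le: "t \<le> R \<Longrightarrow> Wp t \<le> W0 R" and Wp_neg: "t < 0 \<Longrightarrow> Wp t = 0"
proof -
  show "Wp t \<ge> 0" using W0_ge_1[of t] by (simp add: Wp_eq indicator_def)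
  show "Wp t \<le> W0 R" if "t \<le> R"
    using W0_mono[OF that] W0_ge_1[of R] by (simp add: Wp_eq indicator_def)
qed (simp add: Wp_def)

lemma V_ge_1: "V t \<ge> 1"
  using W0_ge_1[of t] f by (simp add: V_def algebra_simps)

lemma V_pos: "V t > 0"
  using V_ge_1[of t] by simp

lemma V_0: "V 0 = 1"
  by (simp add: V_def W0_eq W_0)

lemma V_mono: "s \<le> t \<Longrightarrow> V s \<le> V t"
  using W0_mono f by (simp add: V_def)

lemma V_eq_Wf: "t \<ge> 0 \<Longrightarrow> V t = Wf f W t"
  by (simp add: V_def Wf_def W0_eq)

lemma V_measurable [measurable]: "V \<in> borel_measurable borel"
  unfolding V_def[abs_def] by measurable

lemma V_continuous: "continuous_on UNIV V"
  unfolding V_def by (intro continuous_intros W0_continuous)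

lemma convolution_integrable: "integrable lborel (\<lambda>l. v0 l * Wp (t - l))"
proof -
  have "integrable lborel (\<lambda>l. v0 l * (indicator {0..} l * Wp (t - l)))"
    by (rule integrable_mult_bounded[OF v0_integrable, of _ "W0 t"])
      (use Wp_nonneg Wp_le in \<open>auto simp: indicator_def W0_ge_1 order_trans[OF zero_le_one]\<close>)
  moreover have "(\<lambda>l. v0 l * (indicator {0..} l * Wp (t - l))) = (\<lambda>l. v0 l * Wp (t - l))"
    by (auto simp: v0_def indicator_def)
  ultimately show ?thesis by simp
qed

lemma cv_bounds: "0 \<le> cv t" "cv t \<le> W0 t * (\<integral>l. v0 l \<partial>lborel)"
proof -
  show "0 \<le> cv t" unfolding cv_def by (intro Bochner_Integration.integral_nonneg) (simp add: v0_nonneg Wp_nonneg)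
  have "cv t \<le> (\<integral>l. W0 t * v0 l \<partial>lborel)"
    unfolding cv_def
  proof (intro integral_mono convolution_integrable)
    fix l
    show "v0 l * Wp (t - l) \<le> W0 t * v0 l"
    proof (cases "l \<le> 0")
      case False
      then show ?thesis
        using mult_left_mono[OF Wp_le[of "t - l" t] v0_nonneg[of l]] by (simp add: mult.commute)
    qed (simp add: v0_eq_0)
  qed simp
  then show "cv t \<le> W0 t * (\<integral>l. v0 l \<partial>lborel)" by simp
qed

lemma cv_nonpos: "t \<le> 0 \<Longrightarrow> cv t = 0"
proof -
  assume "t \<le> 0"
  then have "v0 l * Wp (t - l) = 0" for l
    by (cases "l \<le> 0") (simp_all add: v0_eq_0 Wp_neg)
  then have "(\<lambda>l. v0 l * Wp (t - l)) = (\<lambda>l. 0)" by blast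
  then show ?thesis by (simp add: cv_def)
qed

lemma cv_measurable [measurable]: "cv \<in> borel_measurable borel"
proof -
  have "(\<lambda>z. v0 (snd z) * Wp (fst z - snd z)) \<in> borel_measurable (borel \<Otimes>\<^sub>M lborel)" by measurable
  then show ?thesis
    unfolding cv_def[abs_def] by (intro lborel.borel_measurable_lebesgue_integral) (simp add: split_beta')
qed

lemma wp_measurable [measurable]: "wp \<in> borel_measurable borel"
  unfolding wp_def[abs_def] by measurable

lemma wp_bound: "t \<le> R \<Longrightarrow> \<bar>wp t\<bar> \<le> g * (W0 R * (1 + (\<integral>l. v0 l \<partial>lborel)))"
proof -
  assume tR: "t \<le> R"
  let ?I = "\<integral>l. v0 l \<partial>lborel"
  have I: "?I \<ge> 0" by (intro Bochner_Integration.integral_nonneg) (simp add: v0_nonneg)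
  have "cv t \<le> W0 R * ?I"
    using cv_bounds(2)[of t] mult_right_mono[OF W0_mono[OF tR] I] by linarith
  then have "\<bar>Wp t - cv t\<bar> \<le> W0 R + W0 R * ?I"
    using Wp_nonneg[of t] Wp_le[OF tR] cv_bounds(1)[of t] W0_ge_1[of R] I by (auto simp: abs_le_iff)
  then have "\<bar>Wp t - cv t\<bar> \<le> W0 R * (1 + ?I)"
    by (simp add: distrib_left)
  then have "g * \<bar>Wp t - cv t\<bar> \<le> g * (W0 R * (1 + ?I))"
    by (rule mult_left_mono) (use g in simp)
  moreover have "0 \<le> g * (W0 R * (1 + ?I))"
    using g W0_ge_1[of R] I by simp
  ultimately show ?thesis
    using g by (auto simp: wp_def indicator_def abs_mult)
qed

lemma wp_eq: "t \<noteq> 0 \<Longrightarrow> wp t = g * (Wp t - cv t)"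
  by (auto simp: wp_def indicator_def Wp_neg cv_nonpos)

lemma W_deriv: "t > 0 \<Longrightarrow> (W has_real_derivative wp t) (at t)"
proof -
  assume t: "t > 0"
  have "(LINT u:{0..t}|lborel. W u * v (t - u)) = cv t"
  proof -
    have "cv t = (\<integral>u. v0 (t - u) * Wp u \<partial>lborel)"
      unfolding cv_def by (subst lborel_integral_real_affine[where c = "-1" and t = t]) simp_all
    moreover have "(LINT u:{0..t}|lborel. W u * v (t - u)) = (\<integral>u. v0 (t - u) * Wp u + indicator {t} u * (W t * v 0) \<partial>lborel)"
      unfolding set_lebesgue_integral_def
      using t by (intro Bochner_Integration.integral_cong) (auto simp: v0_def Wp_def indicator_def)
    moreover have "(\<integral>u. v0 (t - u) * Wp u + indicator {t} u * (W t * v 0) \<partial>lborel) = (\<integral>u. v0 (t - u) * Wp u \<partial>lborel)"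
    proof (rule integral_cong_AE)
      have "AE u in lborel. u \<noteq> t" by (rule AE_lborel_singleton)
      then show "AE u in lborel. v0 (t - u) * Wp u + indicator {t} u * (W t * v 0) = v0 (t - u) * Wp u"
        by eventually_elim (auto simp: indicator_def)
    qed measurable
    ultimately show ?thesis by simp
  qed
  moreover have "Wp t = W t" using t by (simp add: Wp_def)
  ultimately show ?thesis
    using scale t wp_eq[of t] unfolding scale_function_def by auto
qed

lemma integrable_bounded_interval:
  fixes h :: "real \<Rightarrow> real"
  assumes [measurable]: "h \<in> borel_measurable borel" and "\<And>x. 0 < x \<Longrightarrow> x \<le> t \<Longrightarrow> \<bar>h x\<bar> \<le> B"
  shows "integrable lborel (\<lambda>x. indicator {0<..t} x * h x)"
proof -
  have "integrable lborel (indicator {0<..t} :: real \<Rightarrow> real)"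
    by (cases "0 \<le> t") auto
  then have "integrable lborel (\<lambda>x. indicator {0<..t} x * (indicator {0<..t} x * h x))"
  proof (rule integrable_mult_bounded[where B = "\<bar>B\<bar>"])
    fix x show "\<bar>indicator {0<..t} x * h x\<bar> \<le> \<bar>B\<bar>"
      using assms(2)[of x] by (auto simp: indicator_def)
  qed measurable
  moreover have "(\<lambda>x. indicator {0<..t} x * (indicator {0<..t} x * h x)) = (\<lambda>x. indicator {0<..t} x * h x)"
    by (auto simp: indicator_def)
  ultimately show ?thesis by simp
qed

lemma wp_integrable: "integrable lborel (\<lambda>x. indicator {0<..t} x * wp x)"
  by (rule integrable_bounded_interval[OF wp_measurable]) (rule wp_bound)

lemma ac_W: "ac W wp"
  by (intro ac_FTC W_cont W_deriv wp_integrable)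

lemma ac_inverse_V: "ac (\<lambda>t. 1 / V t) (\<lambda>t. - (f * wp t) / (V t)\<^sup>2)"
proof (rule ac_FTC)
  have "V t \<noteq> 0" for t using V_pos[of t] by simp
  then show "continuous_on {0..} (\<lambda>t. 1 / V t)"
    by (intro continuous_intros continuous_on_subset[OF V_continuous]) auto
  fix t :: real
  {
    assume t: "t > 0"
    have "((\<lambda>t. 1 - f + f * W t) has_real_derivative f * wp t) (at t)"
      using W_deriv[OF t] by (auto intro!: derivative_eq_intros)
    then have "(V has_real_derivative f * wp t) (at t)"
    proof (rule has_field_derivative_transform_within_open[of _ _ _ "{0<..}"])
      fix x :: real assume "x \<in> {0<..}"
      then show "1 - f + f * W x = V x" by (simp add: V_def W0_eq)
    qed (use t in auto)
    then show "((\<lambda>t. 1 / V t) has_real_derivative - (f * wp t) / (V t)\<^sup>2) (at t)"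
      using V_pos[of t] by (auto intro!: derivative_eq_intros simp: power2_eq_square)
  }
  have "integrable lborel (\<lambda>x. (indicator {0<..t} x * wp x) * (- f / (V x)\<^sup>2))"
  proof (rule integrable_mult_bounded[OF wp_integrable, where B = 1])
    fix x
    have "1 \<le> (V x)\<^sup>2" using V_ge_1[of x] by (simp add: one_le_power)
    then have "f / (V x)\<^sup>2 \<le> 1" using f by (subst divide_le_eq_1_pos) auto
    then show "\<bar>- f / (V x)\<^sup>2\<bar> \<le> 1" using f by simp
  qed measurable
  then show "integrable lborel (\<lambda>x. indicator {0<..t} x * (- (f * wp x) / (V x)\<^sup>2))"
    by (simp add: mult_ac)
qed

section \<open>Convolutions with the scale function\<close>

definition cm :: "(real \<Rightarrow> real) \<Rightarrow> real \<Rightarrow> real" where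
  "cm p t = (\<integral>a. p a * Wp (t - a) \<partial>lborel)"

definition sub_density :: "(real \<Rightarrow> real) \<Rightarrow> bool" where
  "sub_density p \<longleftrightarrow> p \<in> borel_measurable borel \<and> (\<forall>a. 0 \<le> p a \<and> p a \<le> 1) \<and> (\<forall>a\<le>0. p a = 0)"

lemma sub_densityD:
  assumes "sub_density p"
  shows "p \<in> borel_measurable borel" "0 \<le> p a" "p a \<le> 1" "a \<le> 0 \<Longrightarrow> p a = 0"
  using assms by (auto simp: sub_density_def)

lemma cm_eq_interval:
  assumes "sub_density p"
  shows "(\<lambda>a. p a * Wp (t - a)) = (\<lambda>a. indicator {0<..t} a * (p a * Wp (t - a)))"
proof
  fix a show "p a * Wp (t - a) = indicator {0<..t} a * (p a * Wp (t - a))"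
    using sub_densityD(4)[OF assms, of a] Wp_neg[of "t - a"] by (cases "a \<le> 0"; cases "a \<le> t") auto
qed

lemma cm_integrable:
  assumes "sub_density p"
  shows "integrable lborel (\<lambda>a. p a * Wp (t - a))"
proof -
  note [measurable] = sub_densityD(1)[OF assms]
  show ?thesis
    unfolding cm_eq_interval[OF assms, of t]
  proof (rule integrable_bounded_interval[where B = "W0 t"])
    fix a :: real assume "0 < a"
    then have "Wp (t - a) \<le> W0 t" by (intro Wp_le) simp
    then show "\<bar>p a * Wp (t - a)\<bar> \<le> W0 t"
      using sub_densityD(2,3)[OF assms, of a] Wp_nonneg[of "t - a"]
      by (simp add: abs_mult) (metis mult_left_le_one_le order_trans)
  qed measurable
qed

lemma cm_measurable:
  assumes "sub_density p"
  shows "cm p \<in> borel_measurable borel"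
proof -
  note [measurable] = sub_densityD(1)[OF assms]
  have "(\<lambda>z. p (snd z) * Wp (fst z - snd z)) \<in> borel_measurable (borel \<Otimes>\<^sub>M lborel)" by measurable
  then show ?thesis
    unfolding cm_def[abs_def] by (intro lborel.borel_measurable_lebesgue_integral) (simp add: split_beta')
qed

lemma cm_nonneg: "sub_density p \<Longrightarrow> 0 \<le> cm p t"
  unfolding cm_def by (intro Bochner_Integration.integral_nonneg mult_nonneg_nonneg) (simp_all add: sub_densityD Wp_nonneg)

lemma cm_nonpos: "sub_density p \<Longrightarrow> t \<le> 0 \<Longrightarrow> cm p t = 0"
  unfolding cm_def by (subst cm_eq_interval) auto

lemma cm_wp:
  assumes p: "sub_density p"
  shows "(\<integral>a. p a * wp (t - a) \<partial>lborel) = g * cm p t - g * (\<integral>l. v0 l * cm p (t - l) \<partial>lborel)"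
proof -
  note [measurable] = sub_densityD(1)[OF p]
  define H where "H a l = p a * (v0 l * Wp (t - a - l))" for a l
  have mH: "(\<lambda>z. H (fst z) (snd z)) \<in> borel_measurable (borel \<Otimes>\<^sub>M borel)"
    unfolding H_def by measurable
  have bH: "\<bar>H a l\<bar> \<le> (indicator {0<..t} a * W0 t) * v0 l" for a l
  proof (cases "0 < l \<and> 0 < a \<and> a \<le> t")
    case True
    then have "Wp (t - a - l) \<le> W0 t" by (intro Wp_le) auto
    then have "p a * Wp (t - a - l) \<le> W0 t"
      using sub_densityD(2,3)[OF p, of a] Wp_nonneg[of "t - a - l"] by (metis mult_left_le_one_le order_trans)
    then have "p a * Wp (t - a - l) * v0 l \<le> W0 t * v0 l" by (rule mult_right_mono[OF _ v0_nonneg])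
    then show ?thesis using True sub_densityD(2)[OF p, of a] v0_nonneg[of l] Wp_nonneg[of "t - a - l"]
      by (simp add: H_def abs_mult mult_ac)
  next
    case False
    then have "H a l = 0"
      using v0_eq_0[of l] sub_densityD(4)[OF p, of a] Wp_neg[of "t - a - l"] by (cases "l \<le> 0"; cases "a \<le> 0") (auto simp: H_def)
    then show ?thesis using v0_nonneg[of l] W0_ge_1[of t] by (simp add: indicator_def)
  qed
  have iu: "integrable lborel (\<lambda>a. indicator {0<..t} a * W0 t)"
    by (rule integrable_bounded_interval[where B = "W0 t"]) (use W0_ge_1[of t] in auto)
  note sw = integral_swap[OF iu v0_integrable mH bH]
  have 1: "(\<integral>l. H a l \<partial>lborel) = p a * cv (t - a)" for a
    by (simp add: H_def cv_def)
  have 2: "(\<integral>a. H a l \<partial>lborel) = v0 l * cm p (t - l)" for l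
  proof -
    have "(\<integral>a. H a l \<partial>lborel) = (\<integral>a. v0 l * (p a * Wp (t - l - a)) \<partial>lborel)"
      by (intro Bochner_Integration.integral_cong) (auto simp: H_def algebra_simps)
    then show ?thesis by (simp add: cm_def)
  qed
  have icv: "integrable lborel (\<lambda>a. p a * cv (t - a))" using sw(2) by (simp add: 1)
  have "(\<integral>a. p a * wp (t - a) \<partial>lborel) = (\<integral>a. g * (p a * Wp (t - a)) - g * (p a * cv (t - a)) \<partial>lborel)"
  proof (rule integral_cong_AE)
    have "AE a in lborel. a \<noteq> t" by (rule AE_lborel_singleton)
    then show "AE a in lborel. p a * wp (t - a) = g * (p a * Wp (t - a)) - g * (p a * cv (t - a))"
      by eventually_elim (simp add: wp_eq algebra_simps)
  qed measurable
  also have "\<dots> = g * cm p t - g * (\<integral>a. p a * cv (t - a) \<partial>lborel)"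
    using cm_integrable[OF p, of t] icv by (simp add: cm_def)
  also have "(\<integral>a. p a * cv (t - a) \<partial>lborel) = (\<integral>l. v0 l * cm p (t - l) \<partial>lborel)"
    using sw(1) by (simp add: 1 2)
  finally show ?thesis .
qed

lemma ac_cm:
  assumes p: "sub_density p"
  shows "ac (cm p) (\<lambda>t. p t + g * cm p t - g * (\<integral>l. v0 l * cm p (t - l) \<partial>lborel))"
proof -
  note [measurable] = sub_densityD(1)[OF p]
  have "ac (cm p) (\<lambda>t. p t + (\<integral>a. p a * wp (t - a) \<partial>lborel))"
  proof (rule acI)
    fix t :: real assume t: "t \<ge> 0"
    define B where "B = g * (W0 t * (1 + (\<integral>l. v0 l \<partial>lborel)))"
    have B0: "B \<ge> 0" using wp_bound[of t t] by (simp add: B_def)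
    define H where "H \<tau> a = indicator {0<..t} \<tau> * (p a * wp (\<tau> - a))" for \<tau> a
    have mH: "(\<lambda>z. H (fst z) (snd z)) \<in> borel_measurable (borel \<Otimes>\<^sub>M borel)"
      unfolding H_def by measurable
    have bH: "\<bar>H \<tau> a\<bar> \<le> (indicator {0<..t} \<tau> * B) * (indicator {0<..t} a * 1)" for \<tau> a
    proof (cases "0 < \<tau> \<and> \<tau> \<le> t \<and> 0 < a \<and> a \<le> t")
      case True
      then have "\<bar>wp (\<tau> - a)\<bar> \<le> B" unfolding B_def by (intro wp_bound) auto
      then have "p a * \<bar>wp (\<tau> - a)\<bar> \<le> B"
        using sub_densityD(2,3)[OF p, of a] by (metis abs_ge_zero mult_left_le_one_le order_trans)
      then show ?thesis using True sub_densityD(2)[OF p, of a] by (simp add: H_def abs_mult)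
    next
      case False
      then have "H \<tau> a = 0"
        using sub_densityD(4)[OF p, of a] by (cases "a \<le> 0") (auto simp: H_def wp_def indicator_def)
      then show ?thesis using B0 by (simp add: indicator_def)
    qed
    have i1: "integrable lborel (\<lambda>a. indicator {0<..t} a * B)" "integrable lborel (\<lambda>a. indicator {0<..t} a * 1 :: real)"
      by (rule integrable_bounded_interval[where B = B] integrable_bounded_interval[where B = 1]; simp add: B0)+
    note sw = integral_swap[OF i1 mH bH]
    have e: "(\<integral>a. H \<tau> a \<partial>lborel) = indicator {0<..t} \<tau> * (\<integral>a. p a * wp (\<tau> - a) \<partial>lborel)" for \<tau>
      by (simp add: H_def)
    have inner: "(\<integral>\<tau>. H \<tau> a \<partial>lborel) = p a * Wp (t - a) - indicator {0<..t} a * p a" for a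
    proof (cases "0 < a")
      case False
      then show ?thesis using sub_densityD(4)[OF p, of a] by (simp add: H_def)
    next
      case a: True
      have "(\<integral>\<tau>. indicator {0<..t} \<tau> * wp (\<tau> - a) \<partial>lborel) = (\<integral>s. indicator {0<..t - a} s * wp s \<partial>lborel)"
      proof -
        have "(\<integral>\<tau>. indicator {0<..t} \<tau> * wp (\<tau> - a) \<partial>lborel) = (\<integral>s. indicator {0<..t} (a + s) * wp s \<partial>lborel)"
          by (subst lborel_integral_real_affine[where c = 1 and t = a]) simp_all
        also have "(\<lambda>s. indicator {0<..t} (a + s) * wp s) = (\<lambda>s. indicator {0<..t - a} s * wp s)"
          using a by (auto simp: wp_def indicator_def)
        finally show ?thesis .
      qed
      also have "\<dots> = Wp (t - a) - indicator {0<..t} a"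
        using ac_integral[OF ac_W, of "t - a"] a by (cases "a \<le> t") (auto simp: Wp_def W_0)
      finally have "(\<integral>\<tau>. indicator {0<..t} \<tau> * wp (\<tau> - a) \<partial>lborel) = Wp (t - a) - indicator {0<..t} a" .
      moreover have "(\<integral>\<tau>. H \<tau> a \<partial>lborel) = p a * (\<integral>\<tau>. indicator {0<..t} \<tau> * wp (\<tau> - a) \<partial>lborel)"
        unfolding H_def mult.left_commute[of _ "p a"] by simp
      ultimately show ?thesis by (simp add: right_diff_distrib mult.commute)
    qed
    have ip: "integrable lborel (\<lambda>x. indicator {0<..t} x * p x)"
      by (rule integrable_bounded_interval[where B = 1]) (use sub_densityD[OF p] in auto)
    have ic: "integrable lborel (\<lambda>\<tau>. indicator {0<..t} \<tau> * (\<integral>a. p a * wp (\<tau> - a) \<partial>lborel))"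
      using sw(2) by (simp add: e)
    show "integrable lborel (\<lambda>x. indicator {0<..t} x * (p x + (\<integral>a. p a * wp (x - a) \<partial>lborel)))"
      using ip ic by (simp add: distrib_left)
    have "(\<integral>\<tau>. indicator {0<..t} \<tau> * (\<integral>a. p a * wp (\<tau> - a) \<partial>lborel) \<partial>lborel) =
      (\<integral>a. p a * Wp (t - a) - indicator {0<..t} a * p a \<partial>lborel)"
      using sw(1) unfolding e inner .
    also have "\<dots> = cm p t - (\<integral>a. indicator {0<..t} a * p a \<partial>lborel)"
      using ip cm_integrable[OF p, of t] by (simp add: cm_def)
    finally show "cm p t = cm p 0 + (\<integral>x. indicator {0<..t} x * (p x + (\<integral>a. p a * wp (x - a) \<partial>lborel)) \<partial>lborel)"
      using ip ic cm_nonpos[OF p, of 0] by (simp add: distrib_left)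
  qed
  then show ?thesis by (rule ac_cong) (simp_all add: cm_wp[OF p] algebra_simps)
qed

end

section \<open>The lifetime law\<close>

context genus_scale
begin

lemma v0_cut_integrable: "integrable lborel (\<lambda>l. v0 l * indicator {..t} l)"
  by (rule integrable_mult_bounded[OF v0_integrable, where B = 1]) auto

lemma life_le_pos:
  assumes "t > 0"
  shows "measure MZ {z \<in> space MZ. lifetime z \<le> ereal t} = (\<integral>l. v0 l * indicator {..t} l \<partial>lborel)"
proof -
  have "measure MZ {z \<in> space MZ. lifetime z \<le> ereal t} = (LINT s:{0<..t}|lborel. v s)"
    using dens assms unfolding lifetime_density_def by blast
  also have "\<dots> = (\<integral>l. v0 l * indicator {..t} l \<partial>lborel)"
    unfolding set_lebesgue_integral_def
    by (intro Bochner_Integration.integral_cong) (auto simp: v0_def indicator_def)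
  finally show ?thesis .
qed

lemma v0_cut_tendsto_0:
  "(\<lambda>n. \<integral>l. v0 l * indicator {..1 / real (Suc n)} l \<partial>lborel) \<longlonglongrightarrow> (\<integral>l. (0::real) \<partial>(lborel :: real measure))"
proof (rule integral_dominated_convergence[where w = v0 and f = "\<lambda>l. 0" and
      s = "\<lambda>n l. v0 l * indicator {..1 / real (Suc n)} l"])
  show "AE l in lborel. (\<lambda>n. v0 l * indicator {..1 / real (Suc n)} l) \<longlonglongrightarrow> 0"
  proof (rule AE_I2)
    fix l :: real
    show "(\<lambda>n. v0 l * indicator {..1 / real (Suc n)} l) \<longlonglongrightarrow> 0"
    proof (cases "l \<le> 0")
      case False
      then have "eventually (\<lambda>n. 1 / real (Suc n) < l) sequentially"
        using order_tendstoD(2)[OF LIMSEQ_inverse_real_of_nat, of l] by (simp add: inverse_eq_divide)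
      then have "eventually (\<lambda>n. v0 l * indicator {..1 / real (Suc n)} l = 0) sequentially"
        by eventually_elim (auto simp: indicator_def)
      then show ?thesis by (rule tendsto_eventually)
    qed (simp add: v0_eq_0)
  qed
qed (auto simp: v0_nonneg indicator_def)

lemma life_le_0: "measure MZ {z \<in> space MZ. lifetime z \<le> 0} = 0"
proof -
  have "(\<lambda>n. \<integral>l. v0 l * indicator {..1 / real (Suc n)} l \<partial>lborel) \<longlonglongrightarrow> (\<integral>l. (0::real) \<partial>(lborel :: real measure))"
    by (rule v0_cut_tendsto_0)
  moreover have "measure MZ {z \<in> space MZ. lifetime z \<le> 0} \<le> (\<integral>l. v0 l * indicator {..1 / real (Suc n)} l \<partial>lborel)" for n
  proof -
    have "measure MZ {z \<in> space MZ. lifetime z \<le> 0} \<le> measure MZ {z \<in> space MZ. lifetime z \<le> ereal (1 / real (Suc n))}"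
    proof (intro MZ.finite_measure_mono subsetI)
      fix z assume "z \<in> {z \<in> space MZ. lifetime z \<le> 0}"
      moreover have "(0::ereal) \<le> ereal (1 / real (Suc n))" by simp
      ultimately show "z \<in> {z \<in> space MZ. lifetime z \<le> ereal (1 / real (Suc n))}"
        using order_trans by blast
    qed measurable
    then show ?thesis using life_le_pos[of "1 / real (Suc n)"] by simp
  qed
  ultimately have "measure MZ {z \<in> space MZ. lifetime z \<le> 0} \<le> 0"
    using LIMSEQ_le_const by fastforce
  then show ?thesis by (simp add: measure_le_0_iff)
qed

lemma life_le:
  assumes "t \<ge> 0"
  shows "measure MZ {z \<in> space MZ. lifetime z \<le> ereal t} = (\<integral>l. v0 l * indicator {..t} l \<partial>lborel)"
proof (cases "t = 0")
  case True
  have "(\<lambda>l. v0 l * indicator {..t} l) = (\<lambda>l. 0)"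
    using True by (auto simp: v0_def indicator_def)
  then show ?thesis using True life_le_0 by (simp add: zero_ereal_def)
qed (use assms life_le_pos in auto)

lemma PL_eq: "t \<ge> 0 \<Longrightarrow> PL MZ t = 1 - (\<integral>l. v0 l * indicator {..t} l \<partial>lborel)"
proof -
  assume t: "t \<ge> 0"
  have "PL MZ t = measure MZ (space MZ - {z \<in> space MZ. lifetime z \<le> ereal t})"
    unfolding PL_def by (intro arg_cong[where f = "measure MZ"]) auto
  also have "\<dots> = 1 - measure MZ {z \<in> space MZ. lifetime z \<le> ereal t}"
    by (rule MZ.prob_compl) measurable
  finally show ?thesis using life_le[OF t] by simp
qed

lemma PL_bounds: "0 \<le> PL MZ t" "PL MZ t \<le> 1"
  by (auto simp: PL_def)

lemma life_integral:
  assumes [measurable]: "\<phi> \<in> borel_measurable borel" and t: "t \<ge> 0"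
  shows "(\<integral>z. of_bool (\<not> ereal t < lifetime z) * \<phi> (real_of_ereal (lifetime z)) \<partial>MZ) =
    (\<integral>l. v0 l * (indicator {..t} l * \<phi> l) \<partial>lborel)"
proof -
  let ?d = "density MZ (\<lambda>z. ennreal (of_bool (lifetime z < \<infinity>)))"
  let ?L = "\<lambda>z. real_of_ereal (lifetime z)"
  define \<nu>1 where "\<nu>1 = distr ?d borel ?L"
  define \<nu>2 where "\<nu>2 = density lborel (\<lambda>l. ennreal (v0 l))"
  have e1: "emeasure \<nu>1 X = emeasure MZ {z \<in> space MZ. lifetime z < \<infinity> \<and> ?L z \<in> X}" if [measurable]: "X \<in> sets borel" for X
  proof -
    have "emeasure \<nu>1 X = emeasure ?d {z \<in> space MZ. ?L z \<in> X}"
    proof -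
      have "?L -` X \<inter> space ?d = {z \<in> space MZ. ?L z \<in> X}" by auto
      then show ?thesis unfolding \<nu>1_def by (subst emeasure_distr) simp_all
    qed
    also have "\<dots> = (\<integral>\<^sup>+z. ennreal (of_bool (lifetime z < \<infinity>)) * indicator {z \<in> space MZ. ?L z \<in> X} z \<partial>MZ)"
      by (rule emeasure_density) measurable
    also have "\<dots> = (\<integral>\<^sup>+z. indicator {z \<in> space MZ. lifetime z < \<infinity> \<and> ?L z \<in> X} z \<partial>MZ)"
      by (intro nn_integral_cong) (auto simp: indicator_def)
    finally show ?thesis by simp
  qed
  have e2: "emeasure \<nu>2 X = ennreal (\<integral>l. v0 l * indicator X l \<partial>lborel)" if [measurable]: "X \<in> sets borel" for X
  proof -
    have "emeasure \<nu>2 X = (\<integral>\<^sup>+l. ennreal (v0 l) * indicator X l \<partial>lborel)"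
      unfolding \<nu>2_def by (rule emeasure_density) measurable
    also have "\<dots> = (\<integral>\<^sup>+l. ennreal (v0 l * indicator X l) \<partial>lborel)"
      by (intro nn_integral_cong) (auto simp: indicator_def)
    also have "\<dots> = ennreal (\<integral>l. v0 l * indicator X l \<partial>lborel)"
      by (intro nn_integral_eq_integral integrable_mult_bounded[OF v0_integrable, where B = 1])
        (auto simp: v0_nonneg indicator_def)
    finally show ?thesis .
  qed
  have sp: "sets \<nu>1 = sets borel" "space \<nu>1 = UNIV" "sets \<nu>2 = sets borel" "space \<nu>2 = UNIV"
    by (simp_all add: \<nu>1_def \<nu>2_def)
  interpret n1: finite_measure \<nu>1
    by (rule finite_measureI) (simp add: sp e1)
  interpret n2: finite_measure \<nu>2
    by (rule finite_measureI) (simp add: sp e2)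
  have n12: "finite_borel_measure \<nu>1" "finite_borel_measure \<nu>2"
    by unfold_locales (simp_all add: sp)
  have "cdf \<nu>1 = cdf \<nu>2"
  proof
    fix x :: real
    have "{z \<in> space MZ. lifetime z < \<infinity> \<and> ?L z \<in> {..x}} = {z \<in> space MZ. lifetime z \<le> ereal x}"
    proof -
      have "lifetime z < \<infinity> \<and> ?L z \<le> x \<longleftrightarrow> lifetime z \<le> ereal x" for z
        using lifetime_nonneg[of z] by (cases "lifetime z") auto
      then show ?thesis by simp
    qed
    then have 1: "cdf \<nu>1 x = measure MZ {z \<in> space MZ. lifetime z \<le> ereal x}"
      by (simp add: cdf_def measure_def e1)
    have 2: "cdf \<nu>2 x = (\<integral>l. v0 l * indicator {..x} l \<partial>lborel)"
    proof -
      have "0 \<le> (\<integral>l. v0 l * indicator {..x} l \<partial>lborel)"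
        by (intro Bochner_Integration.integral_nonneg) (auto simp: v0_nonneg indicator_def)
      then show ?thesis by (simp add: cdf_def measure_def e2)
    qed
    show "cdf \<nu>1 x = cdf \<nu>2 x"
    proof (cases "x \<ge> 0")
      case True
      then show ?thesis using 1 2 life_le by simp
    next
      case False
      have "\<not> lifetime z \<le> ereal x" for z
        using lifetime_nonneg[of z] False order_trans[of 0 "lifetime z" "ereal x"] by auto
      moreover have "(\<lambda>l. v0 l * indicator {..x} l) = (\<lambda>l. 0)"
        using False by (auto simp: v0_def indicator_def)
      ultimately show ?thesis using 1 2 by simp
    qed
  qed
  then have eq: "\<nu>1 = \<nu>2"
    by (rule cdf_unique'[OF n12])
  have "(\<integral>z. of_bool (\<not> ereal t < lifetime z) * \<phi> (?L z) \<partial>MZ) =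
    (\<integral>z. of_bool (lifetime z < \<infinity>) *\<^sub>R (indicator {..t} (?L z) * \<phi> (?L z)) \<partial>MZ)"
  proof (intro Bochner_Integration.integral_cong refl)
    fix z
    show "of_bool (\<not> ereal t < lifetime z) * \<phi> (?L z) = of_bool (lifetime z < \<infinity>) *\<^sub>R (indicator {..t} (?L z) * \<phi> (?L z))"
      using lifetime_nonneg[of z] by (cases "lifetime z") (auto simp: indicator_def)
  qed
  also have "\<dots> = (\<integral>z. indicator {..t} (?L z) * \<phi> (?L z) \<partial>?d)"
    by (rule integral_density[symmetric]) auto
  also have "\<dots> = (\<integral>l. indicator {..t} l * \<phi> l \<partial>\<nu>1)"
    unfolding \<nu>1_def by (rule integral_distr[symmetric]) auto
  also have "\<dots> = (\<integral>l. v0 l *\<^sub>R (indicator {..t} l * \<phi> l) \<partial>lborel)"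
    unfolding eq \<nu>2_def by (rule integral_density) (auto simp: v0_nonneg)
  finally show ?thesis by simp
qed

definition pz :: "real \<Rightarrow> nat set \<Rightarrow> real" where
  "pz a K = measure MZ {z \<in> space MZ. ereal a < lifetime z \<and> z a \<in> K}"

lemma pred_eval: "Measurable.pred MZ (\<lambda>z. z t \<in> K)"
proof -
  have zt: "(\<lambda>z. z t) \<in> measurable MZ (count_space UNIV)" by (intro measurable_eval) auto
  show ?thesis using measurable_compose[OF zt, of "\<lambda>k. k \<in> K" "count_space UNIV"] by simp
qed

lemma pz_bounds: "0 \<le> pz a K" "pz a K \<le> PL MZ a" "pz a K \<le> 1"
proof -
  show "pz a K \<le> PL MZ a"
    unfolding pz_def PL_def by (rule MZ.finite_measure_mono) auto
qed (auto simp: pz_def)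

lemma pz_UNIV: "pz a UNIV = PL MZ a"
  by (simp add: pz_def PL_def)

lemma pz_measurable [measurable]: "(\<lambda>a. pz a K) \<in> borel_measurable borel"
proof -
  have ev: "(\<lambda>x. snd x (fst x)) \<in> measurable (borel \<Otimes>\<^sub>M MZ) (count_space UNIV)"
    by (intro measurable_eval) auto
  have [measurable]: "Measurable.pred (borel \<Otimes>\<^sub>M MZ) (\<lambda>x. snd x (fst x) \<in> K)"
    using measurable_compose[OF ev, of "\<lambda>k. k \<in> K" "count_space UNIV"] by simp
  have "{x \<in> space (borel \<Otimes>\<^sub>M MZ). ereal (fst x) < lifetime (snd x) \<and> snd x (fst x) \<in> K} \<in> sets (borel \<Otimes>\<^sub>M MZ)"
    by measurable
  moreover have "{x \<in> space (borel \<Otimes>\<^sub>M MZ). snd x \<in> {z \<in> space MZ. ereal (fst x) < lifetime z \<and> z (fst x) \<in> K}} =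
     {x \<in> space (borel \<Otimes>\<^sub>M MZ). ereal (fst x) < lifetime (snd x) \<and> snd x (fst x) \<in> K}"
    by (auto simp: space_pair_measure)
  ultimately have "(\<lambda>a. emeasure MZ {z \<in> space MZ. ereal a < lifetime z \<and> z a \<in> K}) \<in> borel_measurable borel"
    by (intro MZ.measurable_emeasure) auto
  then show ?thesis unfolding pz_def measure_def by measurable
qed

lemma PL_measurable [measurable]: "PL MZ \<in> borel_measurable borel"
  using pz_measurable[of UNIV] by (simp add: pz_UNIV)

definition pd :: "real set \<Rightarrow> nat set \<Rightarrow> real \<Rightarrow> real" where
  "pd D K a = indicator {0<..} a * indicator D a * pz a K"

lemma sub_density_pd:
  assumes [measurable]: "D \<in> sets borel"
  shows "sub_density (pd D K)"
  using pz_bounds unfolding sub_density_def pd_def[abs_def] by (auto simp: indicator_def)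

lemma renewal:
  assumes t: "t \<ge> 0"
  shows "W t = 1 + g * cm (pd UNIV UNIV) t"
proof -
  define H where "H \<tau> l = indicator {0<..t} \<tau> * (v0 l * Wp (\<tau> - l))" for \<tau> l
  have mH: "(\<lambda>z. H (fst z) (snd z)) \<in> borel_measurable (borel \<Otimes>\<^sub>M borel)"
    unfolding H_def by measurable
  have bH: "\<bar>H \<tau> l\<bar> \<le> (indicator {0<..t} \<tau> * W0 t) * v0 l" for \<tau> l
  proof (cases "0 < \<tau> \<and> \<tau> \<le> t \<and> 0 < l")
    case True
    then have "Wp (\<tau> - l) \<le> W0 t" by (intro Wp_le) auto
    from mult_right_mono[OF this v0_nonneg[of l]] show ?thesis
      using True v0_nonneg[of l] Wp_nonneg[of "\<tau> - l"] by (simp add: H_def abs_mult mult.commute)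
  next
    case False
    then have "H \<tau> l = 0" using v0_eq_0[of l] by (cases "l \<le> 0") (auto simp: H_def)
    then show ?thesis using v0_nonneg[of l] W0_ge_1[of t] by (simp add: indicator_def)
  qed
  have iu: "integrable lborel (\<lambda>a. indicator {0<..t} a * W0 t)"
    by (rule integrable_bounded_interval[where B = "W0 t"]) (use W0_ge_1[of t] in auto)
  note sw = integral_swap[OF iu v0_integrable mH bH]
  define H2 where "H2 a l = (indicator {0<..t} a * Wp a) * (v0 l * indicator {..t - a} l)" for a l
  have mH2: "(\<lambda>z. H2 (fst z) (snd z)) \<in> borel_measurable (borel \<Otimes>\<^sub>M borel)"
    unfolding H2_def indicator_def atMost_iff by measurable
  have bH2: "\<bar>H2 a l\<bar> \<le> (indicator {0<..t} a * W0 t) * v0 l" for a l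
  proof -
    have "\<bar>Wp a\<bar> \<le> W0 t" if "a \<le> t" using Wp_le[OF that] Wp_nonneg[of a] by simp
    then show ?thesis
      using v0_nonneg[of l] W0_ge_1[of t] by (auto simp: H2_def indicator_def abs_mult intro!: mult_right_mono)
  qed
  note sw2 = integral_swap[OF iu v0_integrable mH2 bH2]
  have 1: "(\<integral>\<tau>. H \<tau> l \<partial>lborel) = (\<integral>a. H2 a l \<partial>lborel)" for l
  proof (cases "l > 0")
    case False
    then have "H \<tau> l = 0" "H2 \<tau> l = 0" for \<tau> by (auto simp: H_def H2_def v0_eq_0)
    then show ?thesis by simp
  next
    case l: True
    have "(\<integral>\<tau>. H \<tau> l \<partial>lborel) = (\<integral>s. indicator {0<..t} (l + s) * (v0 l * Wp s) \<partial>lborel)"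
      unfolding H_def by (subst lborel_integral_real_affine[where c = 1 and t = l]) simp_all
    also have "\<dots> = (\<integral>s. H2 s l \<partial>lborel)"
    proof (rule integral_cong_AE)
      have "AE s in lborel. s \<noteq> (0::real)" by (rule AE_lborel_singleton)
      then show "AE s in lborel. indicator {0<..t} (l + s) * (v0 l * Wp s) = H2 s l"
        by eventually_elim (use l in \<open>auto simp: H2_def Wp_def indicator_def\<close>)
    qed (auto simp: H2_def[abs_def] indicator_def)
    finally show ?thesis .
  qed
  have "(\<integral>\<tau>. indicator {0<..t} \<tau> * cv \<tau> \<partial>lborel) = (\<integral>\<tau>. (\<integral>l. H \<tau> l \<partial>lborel) \<partial>lborel)"
    by (simp add: H_def cv_def)
  also have "\<dots> = (\<integral>a. (\<integral>l. H2 a l \<partial>lborel) \<partial>lborel)"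
    using sw(1) sw2(1) 1 by simp
  also have "\<dots> = (\<integral>a. indicator {0<..t} a * Wp a * (1 - PL MZ (t - a)) \<partial>lborel)"
    by (intro Bochner_Integration.integral_cong) (auto simp: H2_def PL_eq indicator_def)
  finally have cv: "(\<integral>\<tau>. indicator {0<..t} \<tau> * cv \<tau> \<partial>lborel) = (\<integral>a. indicator {0<..t} a * Wp a * (1 - PL MZ (t - a)) \<partial>lborel)" .
  have icv: "integrable lborel (\<lambda>\<tau>. indicator {0<..t} \<tau> * cv \<tau>)"
    using sw(2) by (simp add: H_def cv_def)
  have iW: "integrable lborel (\<lambda>\<tau>. indicator {0<..t} \<tau> * Wp \<tau>)"
    by (rule integrable_bounded_interval[where B = "W0 t"]) (use Wp_nonneg Wp_le in auto)
  have iWP: "integrable lborel (\<lambda>a. indicator {0<..t} a * Wp a * (1 - PL MZ (t - a)))"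
    by (rule integrable_mult_bounded[OF iW, where B = 1]) (use PL_bounds in auto)
  have "W t - 1 = (\<integral>\<tau>. indicator {0<..t} \<tau> * wp \<tau> \<partial>lborel)"
    using ac_integral[OF ac_W t] W_0 by simp
  also have "(\<lambda>\<tau>. indicator {0<..t} \<tau> * wp \<tau>) = (\<lambda>\<tau>. g * (indicator {0<..t} \<tau> * Wp \<tau> - indicator {0<..t} \<tau> * cv \<tau>))"
    by (auto simp: wp_def indicator_def)
  also have "(\<integral>\<tau>. g * (indicator {0<..t} \<tau> * Wp \<tau> - indicator {0<..t} \<tau> * cv \<tau>) \<partial>lborel) =
    g * (\<integral>a. indicator {0<..t} a * Wp a - indicator {0<..t} a * Wp a * (1 - PL MZ (t - a)) \<partial>lborel)"
    using icv iW iWP cv by simp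
  also have "(\<integral>a. indicator {0<..t} a * Wp a - indicator {0<..t} a * Wp a * (1 - PL MZ (t - a)) \<partial>lborel) =
    (\<integral>a. indicator {0<..t} a * Wp a * PL MZ (t - a) \<partial>lborel)"
    by (intro Bochner_Integration.integral_cong) (auto simp: algebra_simps)
  also have "\<dots> = (\<integral>a. indicator {0<..t} (t - a) * Wp (t - a) * PL MZ a \<partial>lborel)"
    by (subst lborel_integral_real_affine[where c = "-1" and t = t]) simp_all
  also have "\<dots> = cm (pd UNIV UNIV) t"
    unfolding cm_def
  proof (rule integral_cong_AE)
    have "AE a in lborel. a \<noteq> (0::real)" "AE a in lborel. a \<noteq> t" by (rule AE_lborel_singleton)+
    then show "AE a in lborel. indicator {0<..t} (t - a) * Wp (t - a) * PL MZ a = pd UNIV UNIV a * Wp (t - a)"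
      by eventually_elim (auto simp: pd_def pz_UNIV Wp_def indicator_def)
  qed (use sub_densityD(1)[OF sub_density_pd[of UNIV UNIV]] in measurable)
  finally show ?thesis by simp
qed

end

section \<open>The explicit solution\<close>

context genus_scale
begin

text \<open>\<open>Mt A t\<close> will be the probability that \<open>(H, A, S)\<close> passes the test \<open>A\<close> and \<open>H \<le> t\<close>, and \<open>\<theta> A t\<close> the probability
  that a tree of depth \<open>t\<close> has a sampled genus and the first one, with \<open>H := t\<close>, passes the test \<open>A\<close>.\<close>

fun Mt :: "test \<Rightarrow> real \<Rightarrow> real" where
  "Mt (b, D, K) t = f * g * cm (pd D K) (min t b) / V (min t b)"

fun \<theta> :: "test \<Rightarrow> real \<Rightarrow> real" where
  "\<theta> (b, D, K) t = (if t \<le> b then f * (indicator D t * pz t K) + (1 - f) * PL MZ t * Mt (b, D, K) t +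
     (\<integral>l. v0 l * (indicator {..t} l * (V (t - l) * (Mt (b, D, K) t - Mt (b, D, K) (t - l)))) \<partial>lborel) else 0)"

lemma v0_V_integral:
  assumes t: "t \<ge> 0"
  shows "integrable lborel (\<lambda>l. v0 l * (indicator {..t} l * V (t - l)))"
    and "(\<integral>l. v0 l * (indicator {..t} l * V (t - l)) \<partial>lborel) = (1 - f) * (1 - PL MZ t) + f * cv t"
proof -
  have e: "(\<lambda>l. v0 l * (indicator {..t} l * V (t - l))) =
    (\<lambda>l. (1 - f) * (v0 l * indicator {..t} l) + f * (v0 l * Wp (t - l)))"
    by (auto simp: V_def Wp_eq indicator_def algebra_simps)
  show "integrable lborel (\<lambda>l. v0 l * (indicator {..t} l * V (t - l)))"
    unfolding e using v0_cut_integrable convolution_integrable by auto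
  show "(\<integral>l. v0 l * (indicator {..t} l * V (t - l)) \<partial>lborel) = (1 - f) * (1 - PL MZ t) + f * cv t"
    unfolding e using v0_cut_integrable convolution_integrable t by (simp add: PL_eq cv_def)
qed

lemma v0_cm_integrable:
  assumes p: "sub_density p"
  shows "integrable lborel (\<lambda>l. v0 l * cm p (t - l))"
proof -
  note [measurable] = cm_measurable[OF p]
  have bound: "\<bar>cm p s\<bar> \<le> W0 t * t" if "0 \<le> s" "s \<le> t" for s
  proof -
    have "cm p s \<le> (\<integral>a. indicator {0<..t} a * W0 t \<partial>lborel)"
      unfolding cm_def
    proof (rule integral_mono[OF cm_integrable[OF p]])
      show "integrable lborel (\<lambda>a. indicator {0<..t} a * W0 t)"
        by (rule integrable_bounded_interval[where B = "W0 t"]) (use W0_ge_1[of t] in auto)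
      fix a
      show "p a * Wp (s - a) \<le> indicator {0<..t} a * W0 t"
      proof (cases "0 < a \<and> a \<le> s")
        case True
        then have "Wp (s - a) \<le> W0 t" using that by (intro Wp_le) auto
        then have "p a * Wp (s - a) \<le> W0 t"
          using sub_densityD(2,3)[OF p, of a] Wp_nonneg[of "s - a"] by (metis mult_left_le_one_le order_trans)
        then show ?thesis using True that by simp
      next
        case False
        then have "p a * Wp (s - a) = 0"
          using sub_densityD(4)[OF p, of a] Wp_neg[of "s - a"] by auto
        moreover have "0 \<le> indicator {0<..t} a * W0 t"
          using W0_ge_1[of t] by (simp add: indicator_def)
        ultimately show ?thesis by linarith
      qed
    qed
    also have "\<dots> = W0 t * t" using that by simp
    finally show ?thesis using cm_nonneg[OF p, of s] by simp
  qed
  have "integrable lborel (\<lambda>l. v0 l * (indicator {0<..t} l * cm p (t - l)))"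
  proof (rule integrable_mult_bounded[OF v0_integrable, where B = "\<bar>W0 t * t\<bar>"])
    fix l
    show "\<bar>indicator {0<..t} l * cm p (t - l)\<bar> \<le> \<bar>W0 t * t\<bar>"
      using bound[of "t - l"] by (auto simp: indicator_def)
  qed measurable
  moreover have "(\<lambda>l. v0 l * (indicator {0<..t} l * cm p (t - l))) = (\<lambda>l. v0 l * cm p (t - l))"
  proof
    fix l show "v0 l * (indicator {0<..t} l * cm p (t - l)) = v0 l * cm p (t - l)"
      using v0_eq_0[of l] cm_nonpos[OF p, of "t - l"] by (cases "l \<le> 0"; cases "l \<le> t") auto
  qed
  ultimately show ?thesis by simp
qed

lemma Mt_measurable [measurable]: "ok [A] \<Longrightarrow> Mt A \<in> borel_measurable borel"
proof -
  assume A: "ok [A]"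
  obtain b D K where [simp]: "A = (b, D, K)" by (cases A)
  have [measurable]: "cm (pd D K) \<in> borel_measurable borel"
    using A by (intro cm_measurable sub_density_pd) simp
  have "Mt A = (\<lambda>t. f * g * cm (pd D K) (min t b) / V (min t b))" by auto
  then show ?thesis by simp
qed

lemma \<theta>_eq:
  fixes K :: "nat set"
  assumes D: "D \<in> sets borel" and t: "t > 0" "t \<le> b"
  defines "m \<equiv> \<lambda>t. f * g * cm (pd D K) t"
  shows "g * \<theta> (b, D, K) t = f * g * (pd D K t + g * cm (pd D K) t - g * (\<integral>l. v0 l * cm (pd D K) (t - l) \<partial>lborel)) -
    m t * (f * wp t) / V t"
proof -
  let ?I = "\<integral>l. v0 l * cm (pd D K) (t - l) \<partial>lborel"
  note p = sub_density_pd[OF D, of K]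
  have Mt: "Mt (b, D, K) t = m t / V t" using t by (simp add: m_def)
  have e: "(\<lambda>l. v0 l * (indicator {..t} l * (V (t - l) * (Mt (b, D, K) t - Mt (b, D, K) (t - l))))) =
    (\<lambda>l. (m t / V t) * (v0 l * (indicator {..t} l * V (t - l))) - (f * g) * (v0 l * cm (pd D K) (t - l)))"
  proof
    fix l
    show "v0 l * (indicator {..t} l * (V (t - l) * (Mt (b, D, K) t - Mt (b, D, K) (t - l)))) =
      (m t / V t) * (v0 l * (indicator {..t} l * V (t - l))) - (f * g) * (v0 l * cm (pd D K) (t - l))"
    proof (cases "0 < l \<and> l \<le> t")
      case True
      then have "min (t - l) b = t - l" using t by auto
      then have "V (t - l) * Mt (b, D, K) (t - l) = f * g * cm (pd D K) (t - l)"
        using V_pos[of "t - l"] by simp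
      then have "V (t - l) * (Mt (b, D, K) t - Mt (b, D, K) (t - l)) = (m t / V t) * V (t - l) - f * g * cm (pd D K) (t - l)"
        by (simp only: right_diff_distrib Mt) (simp add: mult.commute)
      then show ?thesis using True by (simp only:) (simp add: algebra_simps)
    next
      case False
      then show ?thesis
        using v0_eq_0[of l] cm_nonpos[OF p, of "t - l"] by (cases "l \<le> 0") auto
    qed
  qed
  have I: "(\<integral>l. v0 l * (indicator {..t} l * (V (t - l) * (Mt (b, D, K) t - Mt (b, D, K) (t - l)))) \<partial>lborel) =
    (m t / V t) * ((1 - f) * (1 - PL MZ t) + f * cv t) - f * g * ?I"
    unfolding e using v0_V_integral[of t] v0_cm_integrable[OF p, of t] t by simp
  have "\<theta> (b, D, K) t = f * (indicator D t * pz t K) + (1 - f) * PL MZ t * (m t / V t) +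
     ((m t / V t) * ((1 - f) * (1 - PL MZ t) + f * cv t) - f * g * ?I)"
    using t unfolding \<theta>.simps I by (simp only: Mt if_True)
  also have "\<dots> = f * pd D K t + (m t / V t) * (1 - f + f * cv t) - f * g * ?I"
    using t by (simp add: pd_def algebra_simps add_divide_distrib)
  finally have th0: "\<theta> (b, D, K) t = f * pd D K t + (m t / V t) * (1 - f + f * cv t) - f * g * ?I" .
  have th: "g * \<theta> (b, D, K) t = f * g * pd D K t + (m t / V t) * (g * (1 - f) + f * (g * cv t)) - f * g * (g * ?I)"
    unfolding th0 by (simp add: algebra_simps)
  have wp: "f * wp t = g * V t - (g * (1 - f) + f * (g * cv t))"
    using t by (simp add: wp_eq V_def Wp_eq algebra_simps)
  have mV: "m t / V t * (g * V t) = g * m t" using V_pos[of t] by simp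
  have "m t * (f * wp t) / V t = g * m t - (m t / V t) * (g * (1 - f) + f * (g * cv t))"
    unfolding wp mV[symmetric] by (simp add: right_diff_distrib diff_divide_distrib)
  then show ?thesis unfolding th by (simp add: m_def algebra_simps)
qed

lemma ac_Mt:
  assumes A: "ok [A]"
  shows "ac (Mt A) (\<lambda>t. g * \<theta> A t / V t)"
proof -
  obtain b D K where A': "A = (b, D, K)" by (cases A)
  have D: "D \<in> sets borel" using A A' by simp
  note p = sub_density_pd[OF D, of K]
  show ?thesis
  proof (cases "b < 0")
    case True
    then show ?thesis
      unfolding A' by (intro ac_cong[OF ac_const[of 0]]) (auto simp: cm_nonpos[OF p])
  next
    case False
    define m where "m t = f * g * cm (pd D K) t" for t
    define m' where "m' t = f * g * (pd D K t + g * cm (pd D K) t - g * (\<integral>l. v0 l * cm (pd D K) (t - l) \<partial>lborel))" for t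
    have "ac m m'" unfolding m_def m'_def by (intro ac_cmult ac_cm p)
    from ac_mult[OF this ac_inverse_V]
    have "ac (\<lambda>t. m t * (1 / V t)) (\<lambda>t. m' t * (1 / V t) + m t * (- (f * wp t) / (V t)\<^sup>2))" .
    then have "ac (\<lambda>t. m (min t b) * (1 / V (min t b)))
      (\<lambda>t. if t \<le> b then m' t * (1 / V t) + m t * (- (f * wp t) / (V t)\<^sup>2) else 0)"
      using False ac_min[of "\<lambda>t. m t * (1 / V t)" "\<lambda>t. m' t * (1 / V t) + m t * (- (f * wp t) / (V t)\<^sup>2)" b] by simp
    then show ?thesis
    proof (rule ac_cong)
      fix t :: real
      show "m (min t b) * (1 / V (min t b)) = Mt A t" by (simp add: A' m_def)
      assume t: "t > 0"
      show "(if t \<le> b then m' t * (1 / V t) + m t * (- (f * wp t) / (V t)\<^sup>2) else 0) = g * \<theta> A t / V t"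
      proof (cases "t \<le> b")
        case True
        have "g * \<theta> A t = m' t - m t * (f * wp t) / V t"
          unfolding A' m'_def m_def by (rule \<theta>_eq[OF D t True])
        then show ?thesis using True V_pos[of t] by (simp only: if_True) (simp add: field_simps power2_eq_square)
      qed (simp add: A')
    qed
  qed
qed

definition q :: "real \<Rightarrow> real" where
  "q t = 1 - f * wp t / (g * V t)"

fun Gf :: "real \<Rightarrow> test list \<Rightarrow> real" where
  "Gf t [] = 1 / V t"
| "Gf t (A # As) = Mt A t * Gf t As"

fun xh :: "real \<Rightarrow> test list \<Rightarrow> real" where
  "xh t [] = q t"
| "xh t (A # As) = \<theta> A t * Gf t As"

fun yr :: "real \<Rightarrow> real \<Rightarrow> test list \<Rightarrow> real" where
  "yr r t [] = V r / V t"
| "yr r t (A # As) = V r * (Mt A t - Mt A r) * Gf t As"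

definition yh :: "real \<Rightarrow> real \<Rightarrow> test list \<Rightarrow> real" where
  "yh t c As = yr (t - min c t) t As"

lemma conv_Nil [simp]: "conv y x [] = y [] * x []"
  by (simp add: conv_def)

lemma conv_Cons: "conv y x (A # As) = y [] * x (A # As) + conv (\<lambda>Bs. y (A # Bs)) x As"
  unfolding conv_def by (simp add: sum.atMost_Suc_shift del: sum.atMost_Suc)

lemma conv_cmult: "conv (\<lambda>Bs. c * y Bs) x As = c * conv y x As"
  by (simp add: conv_def sum_distrib_left mult.assoc)

lemma inverse_V_density: "t > 0 \<Longrightarrow> - (f * wp t) / (V t)\<^sup>2 = g * (1 / V t * q t - 1 / V t)"
  using V_pos[of t] g by (simp add: q_def field_simps power2_eq_square)

lemma ac_Gf:
  assumes "ok As"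
  shows "ac (\<lambda>t. Gf t As) (\<lambda>t. g * (conv (Gf t) (xh t) As - Gf t As))"
  using assms
proof (induction As)
  case Nil
  show ?case
    by (rule ac_cong[OF ac_inverse_V]) (simp_all only: conv_Nil Gf.simps xh.simps inverse_V_density)
next
  case (Cons A As)
  have "ac (\<lambda>t. Mt A t * Gf t As) (\<lambda>t. g * \<theta> A t / V t * Gf t As + Mt A t * (g * (conv (Gf t) (xh t) As - Gf t As)))"
    using Cons by (intro ac_mult ac_Mt) auto
  then show ?case
  proof (rule ac_cong)
    fix t :: real
    have "conv (\<lambda>Bs. Gf t (A # Bs)) (xh t) As = Mt A t * conv (Gf t) (xh t) As"
      by (simp add: conv_cmult)
    then show "g * \<theta> A t / V t * Gf t As + Mt A t * (g * (conv (Gf t) (xh t) As - Gf t As)) =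
      g * (conv (Gf t) (xh t) (A # As) - Gf t (A # As))"
      by (simp only: conv_Cons) (simp add: algebra_simps)
  qed simp
qed

lemma ac_yr:
  assumes "ok As"
  shows "ac (\<lambda>t. yr r t As) (\<lambda>t. g * (conv (yr r t) (xh t) As - yr r t As))"
proof (cases As)
  case Nil
  show ?thesis unfolding Nil
  proof (rule ac_cong[OF ac_cmult[OF ac_inverse_V, of "V r"]])
    fix t :: real
    show "V r * (1 / V t) = yr r t []" by simp
    assume "t > 0"
    then show "V r * (- (f * wp t) / (V t)\<^sup>2) = g * (conv (yr r t) (xh t) [] - yr r t [])"
      unfolding inverse_V_density[OF \<open>t > 0\<close>] by (simp add: algebra_simps)
  qed
next
  case (Cons A Bs)
  have "ac (\<lambda>t. V r * ((Mt A t + (- Mt A r)) * Gf t Bs))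
    (\<lambda>t. V r * ((g * \<theta> A t / V t + 0) * Gf t Bs + (Mt A t + (- Mt A r)) * (g * (conv (Gf t) (xh t) Bs - Gf t Bs))))"
    using assms Cons by (intro ac_cmult ac_mult ac_add ac_const ac_Mt ac_Gf) auto
  then show ?thesis unfolding Cons
  proof (rule ac_cong)
    fix t :: real
    have "conv (\<lambda>Cs. yr r t (A # Cs)) (xh t) Bs = V r * (Mt A t - Mt A r) * conv (Gf t) (xh t) Bs"
      by (simp add: conv_cmult)
    then show "V r * ((g * \<theta> A t / V t + 0) * Gf t Bs + (Mt A t + (- Mt A r)) * (g * (conv (Gf t) (xh t) Bs - Gf t Bs))) =
      g * (conv (yr r t) (xh t) (A # Bs) - yr r t (A # Bs))"
      by (simp only: conv_Cons) (simp add: algebra_simps)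
  qed (simp add: algebra_simps)
qed

lemma yr_diag: "yr r r As = of_bool (As = [])"
  using V_pos[of r] by (cases As) auto

lemma exponential_integral: "integrable lborel (exponential_density g)" "(\<integral>s. exponential_density g s \<partial>lborel) = 1"
proof -
  have n: "(\<integral>\<^sup>+s. ennreal (exponential_density g s) \<partial>lborel) = 1"
    using Exq.emeasure_space_1 by (simp add: emeasure_density)
  then show i: "integrable lborel (exponential_density g)"
    using exponential_density_nonneg[OF g] by (intro integrableI_nonneg) auto
  show "(\<integral>s. exponential_density g s \<partial>lborel) = 1"
    using exponential_density_nonneg[OF g] n by (subst integral_eq_nn_integral) auto
qed

lemma exponential_tail:
  assumes "m \<ge> 0"
  shows "(\<integral>s. exponential_density g s * indicator {m<..} s \<partial>lborel) = exp (- g * m)"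
proof -
  have ac: "ac (\<lambda>s. - exp (- g * s)) (\<lambda>s. g * exp (- g * s))"
  proof (rule ac_FTC)
    show "((\<lambda>s. - exp (- g * s)) has_real_derivative g * exp (- g * t)) (at t)" for t
      by (auto intro!: derivative_eq_intros)
    show "integrable lborel (\<lambda>x. indicator {0<..t} x * (g * exp (- g * x)))" for t
      by (rule integrable_bounded_interval[where B = g]) (use g in auto)
  qed (auto intro!: continuous_intros)
  have i: "integrable lborel (\<lambda>s. indicator {0<..m} s * (g * exp (- g * s)))"
    by (rule ac_integrable[OF ac assms])
  have "(\<integral>s. exponential_density g s * indicator {m<..} s \<partial>lborel) =
    (\<integral>s. exponential_density g s - indicator {0<..m} s * (g * exp (- g * s)) \<partial>lborel)"
  proof (rule integral_cong_AE)
    have "AE s in lborel. s \<noteq> (0::real)" by (rule AE_lborel_singleton)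
    then show "AE s in lborel. exponential_density g s * indicator {m<..} s =
      exponential_density g s - indicator {0<..m} s * (g * exp (- g * s))"
      by eventually_elim (use assms in \<open>auto simp: exponential_density_def indicator_def mult.commute\<close>)
  qed auto
  also have "\<dots> = 1 - (1 - exp (- g * m))"
    using i exponential_integral ac_integral[OF ac assms] by simp
  finally show ?thesis by simp
qed

lemma yh_equation:
  assumes ok: "ok As" and t: "t \<ge> 0" and c: "c \<ge> 0"
  defines "R \<equiv> \<lambda>s. exponential_density g s *
    (if s < c \<and> s \<le> t then conv (yh (t - s) (c - s)) (xh (t - s)) As else of_bool (As = []))"
  shows "\<exists>R'. integrable lborel R' \<and> (AE s in lborel. R s = R' s) \<and> yh t c As = (\<integral>s. R' s \<partial>lborel)"
proof -
  define m where "m = min c t"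
  define r where "r = t - m"
  have r: "0 \<le> r" "r \<le> t" and m: "0 \<le> m" using t c by (auto simp: r_def m_def)
  define C where "C \<tau> = conv (yr r \<tau>) (xh \<tau>) As" for \<tau>
  have ace: "ac (\<lambda>t. exp (g * t)) (\<lambda>t. g * exp (g * t))"
  proof (rule ac_FTC)
    show "((\<lambda>s. exp (g * s)) has_real_derivative g * exp (g * t)) (at t)" for t
      by (auto intro!: derivative_eq_intros)
    show "integrable lborel (\<lambda>x. indicator {0<..t} x * (g * exp (g * x)))" for t
    proof (rule integrable_bounded_interval[where B = "g * exp (g * t)"])
      fix x assume "x \<le> t"
      then show "\<bar>g * exp (g * x)\<bar> \<le> g * exp (g * t)" using g by simp
    qed measurable
  qed (auto intro!: continuous_intros)
  have acE: "ac (\<lambda>t. exp (g * t) * yr r t As) (\<lambda>t. g * exp (g * t) * C t)"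
    by (rule ac_cong[OF ac_mult[OF ace ac_yr[OF ok, of r]]]) (simp_all add: C_def algebra_simps)
  let ?E = "\<lambda>\<tau>. g * exp (g * \<tau>) * C \<tau>"
  have it: "integrable lborel (\<lambda>x. indicator {0<..t} x * ?E x)" and ir: "integrable lborel (\<lambda>x. indicator {0<..r} x * ?E x)"
    by (intro ac_integrable[OF acE] t r)+
  have e: "(\<lambda>x. indicator {r<..t} x * ?E x) = (\<lambda>x. indicator {0<..t} x * ?E x - indicator {0<..r} x * ?E x)"
  proof
    fix x show "indicator {r<..t} x * ?E x = indicator {0<..t} x * ?E x - indicator {0<..r} x * ?E x"
      using r by (cases "x \<le> r"; cases "0 < x"; cases "x \<le> t") (auto simp: indicator_def)
  qed
  have irt: "integrable lborel (\<lambda>x. indicator {r<..t} x * ?E x)"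
    unfolding e using it ir by simp
  have "(\<integral>x. indicator {r<..t} x * ?E x \<partial>lborel) = exp (g * t) * yr r t As - exp (g * r) * yr r r As"
    unfolding e using it ir ac_integral[OF acE t] ac_integral[OF acE r(1)] by simp
  then have "exp (- (g * t)) * (\<integral>x. indicator {r<..t} x * ?E x \<partial>lborel) = yr r t As - exp (- g * m) * of_bool (As = [])"
    unfolding yr_diag by (simp add: right_diff_distrib r_def flip: exp_add mult.assoc)
  then have y1: "yr r t As = exp (- g * m) * of_bool (As = []) + (\<integral>x. exp (- (g * t)) * (indicator {r<..t} x * ?E x) \<partial>lborel)"
    by simp
  let ?Q = "\<lambda>s. exp (- (g * t)) * (indicator {r<..t} (t - s) * ?E (t - s))"
  have y2: "(\<integral>x. exp (- (g * t)) * (indicator {r<..t} x * ?E x) \<partial>lborel) = (\<integral>s. ?Q s \<partial>lborel)"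
    by (subst lborel_integral_real_affine[where c = "-1" and t = t]) simp_all
  have iQ: "integrable lborel ?Q"
  proof -
    have "integrable lborel (\<lambda>x. exp (- (g * t)) * (indicator {r<..t} x * ?E x))" using irt by simp
    from lborel_integrable_real_affine[OF this, of "-1" t] show ?thesis by simp
  qed
  define R' where "R' s = ?Q s + of_bool (As = []) * (exponential_density g s * indicator {m<..} s)" for s
  have iR: "integrable lborel R'"
    unfolding R'_def using iQ integrable_mult_bounded[OF exponential_integral(1), of "indicator {m<..}" 1] by auto
  have yR: "yh t c As = (\<integral>s. R' s \<partial>lborel)"
    unfolding R'_def yh_def m_def[symmetric] r_def[symmetric]
    using iQ integrable_mult_bounded[OF exponential_integral(1), of "indicator {m<..}" 1] y1 y2 exponential_tail[OF m] by simp
  have AE: "AE s in lborel. R s = R' s"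
  proof -
    have "AE s in lborel. s \<noteq> (0::real)" "AE s in lborel. s \<noteq> t" "AE s in lborel. s \<noteq> c" "AE s in lborel. s \<noteq> m"
      by (rule AE_lborel_singleton)+
    then show ?thesis
    proof eventually_elim
      case (elim s)
      show ?case
      proof (cases "0 < s \<and> s < m")
        case True
        then have s: "s < c" "s \<le> t" "r < t - s" by (auto simp: m_def r_def)
        have "t - s - min (c - s) (t - s) = r" by (auto simp: r_def m_def)
        then have "conv (yh (t - s) (c - s)) (xh (t - s)) As = C (t - s)"
          by (simp add: C_def yh_def[abs_def])
        then show ?thesis using s True
          by (simp add: R_def R'_def exponential_density_def flip: exp_add mult.assoc) (simp add: algebra_simps flip: exp_add)
      next
        case False
        show ?thesis
        proof (cases "s < 0")
          case True
          then show ?thesis using r by (simp add: R_def R'_def exponential_density_def)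
        next
          case False
          then have "m < s" using \<open>\<not> (0 < s \<and> s < m)\<close> elim by auto
          then have "\<not> (s < c \<and> s \<le> t)" "\<not> r < t - s" using elim by (auto simp: m_def r_def)
          then show ?thesis using \<open>m < s\<close> by (auto simp: R_def R'_def)
        qed
      qed
    qed
  qed
  show "\<exists>R'. integrable lborel R' \<and> (AE s in lborel. R s = R' s) \<and> yh t c As = (\<integral>s. R' s \<partial>lborel)"
    using iR AE yR by blast
qed

end

section \<open>Uniqueness\<close>

context genus_scale
begin

lemma cm_mono:
  assumes "sub_density p" "sub_density p'" "\<And>a. p a \<le> p' a"
  shows "cm p t \<le> cm p' t"
  unfolding cm_def
  by (intro integral_mono cm_integrable assms mult_right_mono Wp_nonneg)

lemma Mt_full: "0 \<le> t \<Longrightarrow> t \<le> b \<Longrightarrow> Mt (b, UNIV, UNIV) t = 1 - 1 / V t"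
proof -
  assume t: "0 \<le> t" "t \<le> b"
  have "g * cm (pd UNIV UNIV) t = W t - 1" using renewal[OF t(1)] by simp
  then have "Mt (b, UNIV, UNIV) t = f * (W t - 1) / V t" using t by (simp add: mult.assoc)
  also have "f * (W t - 1) = V t - 1" using t by (simp add: V_def W0_eq algebra_simps)
  finally show ?thesis using V_pos[of t] by (simp add: diff_divide_distrib)
qed

lemma Mt_bounds:
  assumes A: "ok [A]"
  shows "0 \<le> Mt A t" "Mt A t \<le> 1"
proof -
  obtain b D K where A': "A = (b, D, K)" by (cases A)
  have D: "D \<in> sets borel" using A A' by simp
  note p = sub_density_pd[OF D, of K]
  show "0 \<le> Mt A t" using cm_nonneg[OF p] V_pos f g by (simp add: A' less_imp_le)
  show "Mt A t \<le> 1"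
  proof (cases "min t b \<le> 0")
    case True
    then show ?thesis using cm_nonpos[OF p, of "min t b"] by (simp add: A')
  next
    case False
    let ?s = "min t b"
    have "cm (pd D K) ?s \<le> cm (pd UNIV UNIV) ?s"
      using sub_density_pd[of UNIV UNIV] pz_bounds pz_UNIV
      by (intro cm_mono p) (auto simp: pd_def indicator_def PL_bounds)
    then have "f * g * cm (pd D K) ?s / V ?s \<le> f * g * cm (pd UNIV UNIV) ?s / V ?s"
      using f g V_pos[of ?s] by (intro divide_right_mono mult_left_mono) auto
    also have "\<dots> = Mt (?s, UNIV, UNIV) ?s" by simp
    also have "\<dots> \<le> 1"
      using False V_pos[of ?s] by (subst Mt_full) auto
    finally show ?thesis by (simp add: A')
  qed
qed

lemma Mt_0: "ok [A] \<Longrightarrow> Mt A 0 = 0"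
  by (cases A) (auto simp: cm_nonpos[OF sub_density_pd])

lemma Gf_bounds: "ok As \<Longrightarrow> 0 \<le> Gf t As \<and> Gf t As \<le> 1 / V t"
proof (induction As)
  case Nil
  then show ?case using V_pos[of t] by simp
next
  case (Cons A As)
  then have "0 \<le> Mt A t" "Mt A t \<le> 1" using Mt_bounds[of A t] by auto
  moreover have "0 \<le> Gf t As" "Gf t As \<le> 1 / V t" using Cons by auto
  ultimately have "Mt A t * Gf t As \<le> 1 / V t"
    using mult_left_le_one_le[of "Gf t As" "Mt A t"] by linarith
  then show ?case using \<open>0 \<le> Mt A t\<close> \<open>0 \<le> Gf t As\<close> by simp
qed

lemma yr_bound:
  assumes ok: "ok As" and r: "r \<le> t"
  shows "\<bar>yr r t As\<bar> \<le> 1"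
proof -
  have q: "V r / V t \<le> 1" using V_mono[OF r] V_pos[of t] by simp
  show ?thesis
  proof (cases As)
    case Nil
    then show ?thesis using q V_pos[of r] V_pos[of t] by simp
  next
    case (Cons A Bs)
    have M: "\<bar>Mt A t - Mt A r\<bar> \<le> 1"
      using Mt_bounds[of A t] Mt_bounds[of A r] ok Cons by auto
    have G: "\<bar>Gf t Bs\<bar> \<le> 1 / V t" using Gf_bounds[of Bs t] ok Cons by auto
    have "\<bar>yr r t As\<bar> = V r * (\<bar>Mt A t - Mt A r\<bar> * \<bar>Gf t Bs\<bar>)"
      using V_pos[of r] by (simp add: Cons abs_mult)
    also have "\<dots> \<le> V r * (1 * (1 / V t))"
      using M G V_pos[of r] by (intro mult_left_mono mult_mono) auto
    also have "\<dots> \<le> 1" using q by simp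
    finally show ?thesis .
  qed
qed

lemma yh_bound: "ok As \<Longrightarrow> c \<ge> 0 \<Longrightarrow> t \<ge> 0 \<Longrightarrow> \<bar>yh t c As\<bar> \<le> 1"
  unfolding yh_def by (intro yr_bound) (auto simp: min_def)

lemma yh_measurable [measurable (raw)]: "ok As \<Longrightarrow> (\<lambda>l. yh t l As) \<in> borel_measurable borel"
proof (cases As)
  case Nil
  then show ?thesis by (simp add: yh_def)
next
  case (Cons A Bs)
  assume "ok As"
  then have [measurable]: "Mt A \<in> borel_measurable borel" using Cons by (intro Mt_measurable) simp
  show ?thesis by (simp add: yh_def Cons)
qed

definition Xop :: "(real \<Rightarrow> real \<Rightarrow> test list \<Rightarrow> real) \<Rightarrow> real \<Rightarrow> test list \<Rightarrow> real" where
  "Xop y t As = (case As of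
     [] \<Rightarrow> (1 - f) * PL MZ t * y t (t + 1) [] + (\<integral>l. v0 l * (indicator {..t} l * y t l []) \<partial>lborel)
   | A # Bs \<Rightarrow> (if t \<le> fst A then f * (indicator (fst (snd A)) t * pz t (snd (snd A))) * y t (t + 1) Bs +
       (1 - f) * PL MZ t * y t (t + 1) As + (\<integral>l. v0 l * (indicator {..t} l * y t l As) \<partial>lborel) else 0))"

lemma measure_MZ_of_bool: "Measurable.pred MZ P \<Longrightarrow> (\<integral>z. (of_bool (P z) :: real) \<partial>MZ) = measure MZ {z \<in> space MZ. P z}"
proof -
  assume [measurable]: "Measurable.pred MZ P"
  have "(\<integral>z. (of_bool (P z) :: real) \<partial>MZ) = (\<integral>z. indicator {z \<in> space MZ. P z} z \<partial>MZ)"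
    by (intro Bochner_Integration.integral_cong) (auto simp: indicator_def)
  also have "\<dots> = measure MZ ({z \<in> space MZ. P z} \<inter> space MZ)"
    by (rule Bochner_Integration.integral_indicator)
  also have "{z \<in> space MZ. P z} \<inter> space MZ = {z \<in> space MZ. P z}" by auto
  finally show ?thesis .
qed

lemma life_split:
  assumes t: "t \<ge> 0" and [measurable]: "h \<in> borel_measurable borel" and h: "\<And>l. \<bar>h l\<bar> \<le> 1"
  shows "(\<integral>z. (f * of_bool (\<not> ereal t < lifetime z) + (1 - f)) * h (life_bound t z) \<partial>MZ) =
    (1 - f) * PL MZ t * h (t + 1) + (\<integral>l. v0 l * (indicator {..t} l * h l) \<partial>lborel)"
    and "integrable MZ (\<lambda>z. (f * of_bool (\<not> ereal t < lifetime z) + (1 - f)) * h (life_bound t z))"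
proof -
  let ?L = "\<lambda>z. real_of_ereal (lifetime z)"
  have e: "(\<lambda>z. (f * of_bool (\<not> ereal t < lifetime z) + (1 - f)) * h (life_bound t z)) =
    (\<lambda>z. (1 - f) * h (t + 1) * of_bool (ereal t < lifetime z) + of_bool (\<not> ereal t < lifetime z) * h (?L z))"
    by (auto simp: life_bound_def fun_eq_iff)
  have i1: "integrable MZ (\<lambda>z. of_bool (ereal t < lifetime z) :: real)"
    by (rule MZ.integrable_const_bound[where B = 1]) auto
  have i2: "integrable MZ (\<lambda>z. of_bool (\<not> ereal t < lifetime z) * h (?L z))"
    by (rule MZ.integrable_const_bound[where B = 1]) (use h in auto)
  show "integrable MZ (\<lambda>z. (f * of_bool (\<not> ereal t < lifetime z) + (1 - f)) * h (life_bound t z))"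
    unfolding e using i1 i2 by simp
  have "(\<integral>z. of_bool (ereal t < lifetime z) \<partial>MZ) = PL MZ t"
    unfolding PL_def by (subst measure_MZ_of_bool) auto
  then show "(\<integral>z. (f * of_bool (\<not> ereal t < lifetime z) + (1 - f)) * h (life_bound t z) \<partial>MZ) =
    (1 - f) * PL MZ t * h (t + 1) + (\<integral>l. v0 l * (indicator {..t} l * h l) \<partial>lborel)"
    unfolding e using i1 i2 life_integral[of h t] t by simp
qed

lemma xP_Xop:
  assumes ok: "ok As" and t: "t \<ge> 0"
  shows "xP t As = Xop yP t As"
proof -
  have y: "(\<lambda>l. yP t l Bs) \<in> borel_measurable borel" "\<And>l. \<bar>yP t l Bs\<bar> \<le> 1" if "ok Bs" for Bs
    using that yP_bounds by (auto intro: measurable_yP)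
  show ?thesis
  proof (cases As)
    case Nil
    then show ?thesis using xP_Nil_equation[OF t] life_split[OF t y(1)[of "[]"] y(2)] by (simp add: Xop_def)
  next
    case (Cons A Bs)
    obtain b D K where A: "A = (b, D, K)" by (cases A)
    have okB: "ok Bs" and okA: "ok ((b, D, K) # Bs)" using ok Cons A by auto
    have [measurable]: "Measurable.pred MZ (\<lambda>z. z t \<in> K)" by (rule pred_eval)
    have "(\<integral>z. of_bool (ereal t < lifetime z \<and> t \<in> D \<and> z t \<in> K) \<partial>MZ) = indicator D t * pz t K"
      unfolding pz_def by (subst measure_MZ_of_bool) (auto simp: indicator_def)
    moreover have "(\<lambda>z. f * of_bool (ereal t < lifetime z \<and> t \<in> D \<and> z t \<in> K) * yP t (life_bound t z) Bs) =
      (\<lambda>z. f * yP t (t + 1) Bs * of_bool (ereal t < lifetime z \<and> t \<in> D \<and> z t \<in> K))"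
      by (auto simp: life_bound_def fun_eq_iff)
    moreover have "integrable MZ (\<lambda>z. of_bool (ereal t < lifetime z \<and> t \<in> D \<and> z t \<in> K) :: real)"
      by (rule MZ.integrable_const_bound[where B = 1]) auto
    ultimately show ?thesis
      using xP_Cons_equation[OF t okA] life_split[OF t y(1)[OF okA] y(2)[OF okA]]
      by (simp add: Xop_def Cons A)
  qed
qed

lemma yh_full: "ok As \<Longrightarrow> t \<ge> 0 \<Longrightarrow> yh t (t + 1) As = Gf t As"
  by (cases As) (auto simp: yh_def V_0 Mt_0)

lemma q_eq: "t > 0 \<Longrightarrow> q t = (1 - f) * PL MZ t * (1 / V t) + ((1 - f) * (1 - PL MZ t) + f * cv t) / V t"
proof -
  assume t: "t > 0"
  have "f * wp t = g * (V t - (1 - f) - f * cv t)"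
    using t by (simp add: wp_eq V_def Wp_eq algebra_simps)
  then have "f * wp t / (g * V t) = (V t - (1 - f) - f * cv t) / V t"
    using g by simp
  then have "q t = (1 - f + f * cv t) / V t"
    using V_pos[of t] by (simp add: q_def field_simps)
  then show ?thesis by (simp add: add_divide_distrib diff_divide_distrib algebra_simps)
qed

lemma xh_Xop:
  assumes ok: "ok As" and t: "t > 0"
  shows "xh t As = Xop yh t As"
proof (cases As)
  case Nil
  have "(\<lambda>l. v0 l * (indicator {..t} l * yh t l [])) = (\<lambda>l. v0 l * (indicator {..t} l * V (t - l)) * (1 / V t))"
    by (auto simp: yh_def indicator_def fun_eq_iff)
  then have "(\<integral>l. v0 l * (indicator {..t} l * yh t l []) \<partial>lborel) = ((1 - f) * (1 - PL MZ t) + f * cv t) / V t"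
    using v0_V_integral[of t] t by simp
  then show ?thesis using t by (simp add: Nil Xop_def yh_full q_eq)
next
  case (Cons A Bs)
  obtain b D K where A: "A = (b, D, K)" by (cases A)
  have okB: "ok Bs" and okA: "ok (A # Bs)" using ok Cons by auto
  have "(\<lambda>l. v0 l * (indicator {..t} l * yh t l (A # Bs))) =
    (\<lambda>l. (v0 l * (indicator {..t} l * (V (t - l) * (Mt A t - Mt A (t - l))))) * Gf t Bs)"
    by (auto simp: yh_def indicator_def fun_eq_iff)
  then have "(\<integral>l. v0 l * (indicator {..t} l * yh t l (A # Bs)) \<partial>lborel) =
    (\<integral>l. v0 l * (indicator {..t} l * (V (t - l) * (Mt A t - Mt A (t - l)))) \<partial>lborel) * Gf t Bs"
    by simp
  moreover have "yh t (t + 1) Bs = Gf t Bs" "yh t (t + 1) (A # Bs) = Mt A t * Gf t Bs"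
    using yh_full[OF okB, of t] yh_full[OF okA, of t] t by auto
  ultimately show ?thesis
    unfolding Cons Xop_def A by (simp add: distrib_right mult.assoc del: Mt.simps)
qed

lemma Xop_diff:
  assumes ok: "ok As" and t: "t \<ge> 0"
    and m: "\<And>Bs. ok Bs \<Longrightarrow> (\<lambda>l. y t l Bs) \<in> borel_measurable borel" "\<And>Bs. ok Bs \<Longrightarrow> (\<lambda>l. y' t l Bs) \<in> borel_measurable borel"
    and b: "\<And>Bs l. ok Bs \<Longrightarrow> l \<ge> 0 \<Longrightarrow> \<bar>y t l Bs\<bar> \<le> 1" "\<And>Bs l. ok Bs \<Longrightarrow> l \<ge> 0 \<Longrightarrow> \<bar>y' t l Bs\<bar> \<le> 1"
    and d: "\<And>Bs l. ok Bs \<Longrightarrow> length Bs \<le> length As \<Longrightarrow> l \<ge> 0 \<Longrightarrow> \<bar>y t l Bs - y' t l Bs\<bar> \<le> \<delta>"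
  shows "\<bar>Xop y t As - Xop y' t As\<bar> \<le> \<delta>"
proof -
  have d0: "\<delta> \<ge> 0" using d[of "[]" 0] by simp
  have int: "integrable lborel (\<lambda>l. v0 l * (indicator {..t} l * u l))"
    if [measurable]: "u \<in> borel_measurable borel" and u: "\<And>l. l \<ge> 0 \<Longrightarrow> \<bar>u l\<bar> \<le> (1::real)" for u
  proof -
    have "integrable lborel (\<lambda>l. v0 l * (indicator {0..t} l * u l))"
      by (rule integrable_mult_bounded[OF v0_integrable, where B = 1]) (use u in \<open>auto simp: indicator_def\<close>)
    moreover have "(\<lambda>l. v0 l * (indicator {0..t} l * u l)) = (\<lambda>l. v0 l * (indicator {..t} l * u l))"
      by (auto simp: v0_def indicator_def)
    ultimately show ?thesis by simp
  qed
  have I: "\<bar>(\<integral>l. v0 l * (indicator {..t} l * y t l Bs) \<partial>lborel) - (\<integral>l. v0 l * (indicator {..t} l * y' t l Bs) \<partial>lborel)\<bar> \<le> \<delta> * (1 - PL MZ t)"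
    if Bs: "ok Bs" "length Bs \<le> length As" for Bs
  proof -
    note i1 = int[OF m(1)[OF Bs(1)] b(1)[OF Bs(1)]] and i2 = int[OF m(2)[OF Bs(1)] b(2)[OF Bs(1)]]
    have "\<bar>(\<integral>l. v0 l * (indicator {..t} l * y t l Bs) \<partial>lborel) - (\<integral>l. v0 l * (indicator {..t} l * y' t l Bs) \<partial>lborel)\<bar> =
      \<bar>\<integral>l. v0 l * (indicator {..t} l * y t l Bs) - v0 l * (indicator {..t} l * y' t l Bs) \<partial>lborel\<bar>"
      using i1 i2 by simp
    also have "\<dots> \<le> (\<integral>l. \<bar>v0 l * (indicator {..t} l * y t l Bs) - v0 l * (indicator {..t} l * y' t l Bs)\<bar> \<partial>lborel)"
      by (rule integral_abs_bound)
    also have "\<dots> \<le> (\<integral>l. \<delta> * (v0 l * indicator {..t} l) \<partial>lborel)"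
    proof (rule integral_mono)
      show "integrable lborel (\<lambda>l. \<bar>v0 l * (indicator {..t} l * y t l Bs) - v0 l * (indicator {..t} l * y' t l Bs)\<bar>)"
        using i1 i2 by simp
      show "integrable lborel (\<lambda>l. \<delta> * (v0 l * indicator {..t} l))" using v0_cut_integrable by simp
      fix l
      have "\<bar>v0 l * (indicator {..t} l * y t l Bs) - v0 l * (indicator {..t} l * y' t l Bs)\<bar> =
        v0 l * indicator {..t} l * \<bar>y t l Bs - y' t l Bs\<bar>"
        using v0_nonneg[of l] by (auto simp: indicator_def abs_mult simp flip: right_diff_distrib)
      also have "\<dots> \<le> v0 l * indicator {..t} l * \<delta>"
      proof (cases "l \<ge> 0")
        case True
        then show ?thesis using d[OF Bs True] v0_nonneg[of l] by (intro mult_left_mono) auto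
      qed (simp add: v0_eq_0)
      finally show "\<bar>v0 l * (indicator {..t} l * y t l Bs) - v0 l * (indicator {..t} l * y' t l Bs)\<bar> \<le> \<delta> * (v0 l * indicator {..t} l)"
        by (simp add: mult.commute)
    qed
    also have "\<dots> = \<delta> * (1 - PL MZ t)" using PL_eq[OF t] by simp
    finally show ?thesis .
  qed
  have P: "\<bar>(1 - f) * PL MZ t * y t (t + 1) Bs - (1 - f) * PL MZ t * y' t (t + 1) Bs\<bar> \<le> (1 - f) * PL MZ t * \<delta>"
    if Bs: "ok Bs" "length Bs \<le> length As" for Bs
  proof -
    have "\<bar>(1 - f) * PL MZ t * y t (t + 1) Bs - (1 - f) * PL MZ t * y' t (t + 1) Bs\<bar> = (1 - f) * PL MZ t * \<bar>y t (t + 1) Bs - y' t (t + 1) Bs\<bar>"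
      using f PL_bounds[of t] by (simp add: abs_mult flip: right_diff_distrib)
    also have "\<dots> \<le> (1 - f) * PL MZ t * \<delta>"
      using d[OF Bs, of "t + 1"] f PL_bounds[of t] t by (intro mult_left_mono) auto
    finally show ?thesis .
  qed
  have tot: "(1 - f) * PL MZ t * \<delta> + \<delta> * (1 - PL MZ t) + f * PL MZ t * \<delta> = \<delta>" by (simp add: algebra_simps)
  have fp: "0 \<le> f * PL MZ t * \<delta>" using f PL_bounds[of t] d0 by simp
  show ?thesis
  proof (cases As)
    case Nil
    then show ?thesis using I[of "[]"] P[of "[]"] tot fp unfolding Xop_def by (simp add: abs_le_iff)
  next
    case (Cons A Bs)
    obtain b D K where A: "A = (b, D, K)" by (cases A)
    have okB: "ok Bs" "length Bs \<le> length As" using ok Cons by auto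
    have okA: "ok (A # Bs)" "length (A # Bs) \<le> length As" using ok Cons by auto
    let ?p = "f * (indicator D t * pz t K)"
    have "0 \<le> ?p" "?p \<le> f * PL MZ t"
      using f pz_bounds[of t K] PL_bounds[of t] by (auto simp: indicator_def)
    moreover have "\<bar>?p * y t (t + 1) Bs - ?p * y' t (t + 1) Bs\<bar> = ?p * \<bar>y t (t + 1) Bs - y' t (t + 1) Bs\<bar>"
      using \<open>0 \<le> ?p\<close> by (metis abs_mult abs_of_nonneg right_diff_distrib)
    moreover have "\<bar>y t (t + 1) Bs - y' t (t + 1) Bs\<bar> \<le> \<delta>" using d[OF okB, of "t + 1"] t by simp
    ultimately have "\<bar>?p * y t (t + 1) Bs - ?p * y' t (t + 1) Bs\<bar> \<le> f * PL MZ t * \<delta>"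
      using d0 by (metis abs_ge_zero mult_mono order_trans)
    then show ?thesis using I[OF okA] P[OF okA] tot d0 unfolding Xop_def Cons A
      by (simp only: list.case fst_conv snd_conv) (auto simp: abs_le_iff)
  qed
qed

lemma conv_diff:
  assumes "\<And>k. k \<le> length As \<Longrightarrow> \<bar>y (take k As) - y' (take k As)\<bar> \<le> \<delta>"
    "\<And>k. k \<le> length As \<Longrightarrow> \<bar>x (drop k As) - x' (drop k As)\<bar> \<le> \<delta>"
    "\<And>k. \<bar>y' (take k As)\<bar> \<le> 1" "\<And>k. \<bar>x (drop k As)\<bar> \<le> 1"
  shows "\<bar>conv y x As - conv y' x' As\<bar> \<le> (real (length As) + 1) * (2 * \<delta>)"
proof -
  have "\<bar>conv y x As - conv y' x' As\<bar> \<le>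
    (\<Sum>k\<le>length As. \<bar>y (take k As) * x (drop k As) - y' (take k As) * x' (drop k As)\<bar>)"
    unfolding conv_def by (simp flip: sum_subtractf)
  also have "\<dots> \<le> (\<Sum>k\<le>length As. 2 * \<delta>)"
  proof (rule sum_mono)
    fix k assume "k \<in> {..length As}"
    then have k: "k \<le> length As" by simp
    have "y (take k As) * x (drop k As) - y' (take k As) * x' (drop k As) =
      (y (take k As) - y' (take k As)) * x (drop k As) + y' (take k As) * (x (drop k As) - x' (drop k As))"
      by (simp add: algebra_simps)
    then have "\<bar>y (take k As) * x (drop k As) - y' (take k As) * x' (drop k As)\<bar> \<le>
      \<bar>y (take k As) - y' (take k As)\<bar> * \<bar>x (drop k As)\<bar> + \<bar>y' (take k As)\<bar> * \<bar>x (drop k As) - x' (drop k As)\<bar>"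
      by (metis abs_mult abs_triangle_ineq)
    also have "\<dots> \<le> \<delta> * 1 + 1 * \<delta>"
      using assms(1)[OF k] assms(2)[OF k] assms(3)[of k] assms(4)[of k]
      by (intro add_mono mult_mono) auto
    finally show "\<bar>y (take k As) * x (drop k As) - y' (take k As) * x' (drop k As)\<bar> \<le> 2 * \<delta>" by simp
  qed
  also have "\<dots> = (real (length As) + 1) * (2 * \<delta>)" by simp
  finally show ?thesis .
qed

lemma yP_yh_bound:
  fixes N :: nat
  defines "C \<equiv> 2 * g * (real N + 1)"
  assumes "t \<ge> 0" "c \<ge> 0" "ok As" "length As \<le> N"
  shows "\<bar>yP t c As - yh t c As\<bar> \<le> 2 * (C * t) ^ n / fact n"
  using assms(2-5)
proof (induction n arbitrary: t c As)
  case 0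
  then show ?case using yP_bounds[of t c As] yh_bound[of As c t] by auto
next
  case (Suc n)
  note t = Suc.prems(1) and c = Suc.prems(2) and ok = Suc.prems(3) and len = Suc.prems(4)
  have C0: "C \<ge> 0" using g by (simp add: C_def)
  define P where "P s = exponential_density g s *
    (if s < c \<and> s \<le> t then conv (yP (t - s) (c - s)) (xP (t - s)) As else of_bool (As = []))" for s
  obtain R' where iR: "integrable lborel R'" and AER: "AE s in lborel. exponential_density g s *
    (if s < c \<and> s \<le> t then conv (yh (t - s) (c - s)) (xh (t - s)) As else of_bool (As = [])) = R' s"
    and yR: "yh t c As = (\<integral>s. R' s \<partial>lborel)"
    using yh_equation[OF ok t c] by blast
  have yPP: "yP t c As = (\<integral>s. P s \<partial>lborel)" unfolding P_def by (rule yP_equation[OF ok])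
  have iP: "integrable lborel P"
    unfolding P_def
  proof (rule integrable_mult_bounded[OF exponential_integral(1), where B = "real (length As) + 1"])
    show "(\<lambda>s. if s < c \<and> s \<le> t then conv (yP (t - s) (c - s)) (xP (t - s)) As else of_bool (As = [])) \<in> borel_measurable borel"
      unfolding conv_def using ok_take[OF ok] ok_drop[OF ok] by measurable
    fix s
    have "conv (yP (t - s) (c - s)) (xP (t - s)) As \<le> (\<Sum>k\<le>length As. 1)"
      unfolding conv_def using yP_bounds xP_bounds by (intro sum_mono mult_le_one) auto
    moreover have "0 \<le> conv (yP (t - s) (c - s)) (xP (t - s)) As"
      unfolding conv_def using yP_bounds xP_bounds by (intro sum_nonneg mult_nonneg_nonneg) auto
    ultimately show "\<bar>if s < c \<and> s \<le> t then conv (yP (t - s) (c - s)) (xP (t - s)) As else of_bool (As = [])\<bar> \<le> real (length As) + 1"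
      by auto
  qed
  define \<delta> where "\<delta> s = 2 * (C * (t - s)) ^ n / fact n" for s
  have AEb: "AE s in lborel. \<bar>P s - R' s\<bar> \<le> indicator {0<..t} s * (C * \<delta> s)"
  proof -
    have "AE s in lborel. s \<noteq> (0::real)" "AE s in lborel. s \<noteq> t" by (rule AE_lborel_singleton)+
    with AER show ?thesis
    proof eventually_elim
      case (elim s)
      have R: "R' s = exponential_density g s * (if s < c \<and> s \<le> t then conv (yh (t - s) (c - s)) (xh (t - s)) As else of_bool (As = []))"
        using elim by simp
      show ?case
      proof (cases "0 < s \<and> s < c \<and> s < t")
        case False
        have "\<bar>P s - R' s\<bar> = 0"
          using False elim by (auto simp: P_def R exponential_density_def)
        moreover have "0 \<le> indicator {0<..t} s * (C * \<delta> s)"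
          using C0 by (auto simp: \<delta>_def indicator_def)
        ultimately show ?thesis by linarith
      next
        case True
        then have ts: "0 < t - s" "0 \<le> c - s" by auto
        have IH: "\<bar>yP (t - s) l Bs - yh (t - s) l Bs\<bar> \<le> \<delta> s" if "ok Bs" "length Bs \<le> N" "l \<ge> 0" for Bs l
          unfolding \<delta>_def using Suc.IH[of "t - s" l Bs] ts that by simp
        have IHx: "\<bar>xP (t - s) Bs - xh (t - s) Bs\<bar> \<le> \<delta> s" if Bs: "ok Bs" "length Bs \<le> N" for Bs
        proof -
          have "\<bar>Xop yP (t - s) Bs - Xop yh (t - s) Bs\<bar> \<le> \<delta> s"
          proof (rule Xop_diff[OF Bs(1)])
            show "\<bar>yP (t - s) l Cs - yh (t - s) l Cs\<bar> \<le> \<delta> s" if "ok Cs" "length Cs \<le> length Bs" "0 \<le> l" for Cs l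
              using IH that Bs by simp
          qed (use ts yP_bounds yh_bound in \<open>auto intro: measurable_yP yh_measurable\<close>)
          then show ?thesis using xP_Xop[OF Bs(1)] xh_Xop[OF Bs(1)] ts by simp
        qed
        have "\<bar>conv (yP (t - s) (c - s)) (xP (t - s)) As - conv (yh (t - s) (c - s)) (xh (t - s)) As\<bar> \<le> (real (length As) + 1) * (2 * \<delta> s)"
          using IH IHx ok_take[OF ok] ok_drop[OF ok] len ts yh_bound xP_bounds by (intro conv_diff) auto
        also have "\<dots> \<le> (real N + 1) * (2 * \<delta> s)"
          using len C0 ts by (intro mult_right_mono) (auto simp: \<delta>_def)
        finally have cd: "\<bar>conv (yP (t - s) (c - s)) (xP (t - s)) As - conv (yh (t - s) (c - s)) (xh (t - s)) As\<bar> \<le> (real N + 1) * (2 * \<delta> s)" .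
        have ed: "0 \<le> exponential_density g s" "exponential_density g s \<le> g"
          using True g by (auto simp: exponential_density_def)
        have "\<bar>P s - R' s\<bar> = exponential_density g s * \<bar>conv (yP (t - s) (c - s)) (xP (t - s)) As - conv (yh (t - s) (c - s)) (xh (t - s)) As\<bar>"
          using True ed by (simp add: P_def R abs_mult flip: right_diff_distrib)
        also have "\<dots> \<le> g * ((real N + 1) * (2 * \<delta> s))"
          using cd ed by (intro mult_mono) auto
        also have "\<dots> = C * \<delta> s" by (simp add: C_def)
        finally show ?thesis using True by simp
      qed
    qed
  qed
  have ac: "ac (\<lambda>s. - (2 * (C * (t - s)) ^ Suc n / fact (Suc n))) (\<lambda>s. C * \<delta> s)"
  proof (rule ac_FTC)
    show "((\<lambda>s. - (2 * (C * (t - s)) ^ Suc n / fact (Suc n))) has_real_derivative C * \<delta> s) (at s)" for s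
      unfolding \<delta>_def by (rule derivative_eq_intros refl | simp)+
    have "continuous_on UNIV \<delta>" unfolding \<delta>_def by (intro continuous_intros) auto
    then have [measurable]: "\<delta> \<in> borel_measurable borel" by (rule borel_measurable_continuous_onI)
    show "integrable lborel (\<lambda>x. indicator {0<..s} x * (C * \<delta> x))" for s
    proof -
      have "continuous_on {0..s} (\<lambda>x. C * \<delta> x)"
        unfolding \<delta>_def by (intro continuous_intros) auto
      then have "bounded ((\<lambda>x. C * \<delta> x) ` {0..s})"
        by (intro compact_imp_bounded compact_continuous_image) auto
      then obtain B where "\<forall>x\<in>{0..s}. \<bar>C * \<delta> x\<bar> \<le> B"
        unfolding bounded_iff by auto
      then show ?thesis by (intro integrable_bounded_interval[where B = B]) auto
    qed
  qed (auto intro!: continuous_intros)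
  have "\<bar>yP t c As - yh t c As\<bar> = \<bar>\<integral>s. P s - R' s \<partial>lborel\<bar>"
    unfolding yPP yR using iP iR by simp
  also have "\<dots> \<le> (\<integral>s. \<bar>P s - R' s\<bar> \<partial>lborel)" by (rule integral_abs_bound)
  also have "\<dots> \<le> (\<integral>s. indicator {0<..t} s * (C * \<delta> s) \<partial>lborel)"
    using iP iR ac_integrable[OF ac t] AEb by (intro integral_mono_AE) auto
  also have "\<dots> = 2 * (C * t) ^ Suc n / fact (Suc n)"
    using ac_integral[OF ac t] by simp
  finally show ?case .
qed

lemma yP_eq_yh:
  assumes "t \<ge> 0" "c \<ge> 0" "ok As"
  shows "yP t c As = yh t c As"
proof -
  define x where "x = 2 * g * (real (length As) + 1) * t"
  have "(\<lambda>n. 2 * x ^ n / fact n) \<longlonglongrightarrow> 0"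
    using tendsto_mult_right[OF summable_LIMSEQ_zero[OF summable_exp[of x]], of 2] by (simp add: field_simps)
  moreover have "\<bar>yP t c As - yh t c As\<bar> \<le> 2 * x ^ n / fact n" for n
    unfolding x_def by (rule yP_yh_bound) (use assms in auto)
  ultimately have "\<bar>yP t c As - yh t c As\<bar> \<le> 0"
    by (intro LIMSEQ_le_const) auto
  then show ?thesis by simp
qed

lemma xP_eq_xh:
  assumes t: "t > 0" and ok: "ok As"
  shows "xP t As = xh t As"
proof -
  have "\<bar>Xop yP t As - Xop yh t As\<bar> \<le> 0"
    by (rule Xop_diff[OF ok]) (use t yP_bounds yh_bound yP_eq_yh in \<open>auto intro: measurable_yP yh_measurable\<close>)
  then show ?thesis using xP_Xop[OF ok] xh_Xop[OF ok] t by simp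
qed

end

section \<open>The probability that some genus is sampled\<close>

context genus_scale
begin

lemma \<theta>_full:
  assumes t: "t > 0"
  shows "\<theta> (t, UNIV, UNIV) t = f * wp t / (g * V t)"
proof -
  let ?A = "(t, UNIV, UNIV)"
  let ?I = "(1 - f) * (1 - PL MZ t) + f * cv t"
  have e: "(\<lambda>l. v0 l * (indicator {..t} l * (V (t - l) * (Mt ?A t - Mt ?A (t - l))))) =
    (\<lambda>l. v0 l * indicator {..t} l - (1 / V t) * (v0 l * (indicator {..t} l * V (t - l))))"
  proof
    fix l
    show "v0 l * (indicator {..t} l * (V (t - l) * (Mt ?A t - Mt ?A (t - l)))) =
      v0 l * indicator {..t} l - (1 / V t) * (v0 l * (indicator {..t} l * V (t - l)))"
    proof (cases "0 < l \<and> l \<le> t")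
      case True
      then have "Mt ?A t - Mt ?A (t - l) = 1 / V (t - l) - 1 / V t"
        using t by (simp add: Mt_full del: Mt.simps)
      then have X: "V (t - l) * (Mt ?A t - Mt ?A (t - l)) = 1 - V (t - l) / V t"
        using V_pos[of "t - l"] by (simp add: right_diff_distrib del: Mt.simps)
      show ?thesis unfolding X using True by (simp add: algebra_simps)
    next
      case False
      then show ?thesis using v0_eq_0[of l] by (cases "l \<le> 0") auto
    qed
  qed
  have I: "(\<integral>l. v0 l * (indicator {..t} l * (V (t - l) * (Mt ?A t - Mt ?A (t - l)))) \<partial>lborel) = (1 - PL MZ t) - ?I / V t"
    unfolding e using v0_cut_integrable v0_V_integral[of t] t PL_eq[of t] by simp
  have M: "Mt ?A t = 1 - 1 / V t" using t by (intro Mt_full) auto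
  have "\<theta> ?A t = f * PL MZ t + (1 - f) * PL MZ t * (1 - 1 / V t) + ((1 - PL MZ t) - ?I / V t)"
    unfolding \<theta>.simps I unfolding M by (simp add: pz_UNIV)
  also have "\<dots> = 1 - q t"
    unfolding q_eq[OF t] by (simp add: algebra_simps)
  finally show ?thesis by (simp add: q_def)
qed

lemma W_deficit:
  assumes t: "t > 0"
  shows "Wp t - cv t = W t * PL MZ t + (\<integral>l. v0 l * indicator {..t} l * (W t - Wp (t - l)) \<partial>lborel)"
    and "integrable lborel (\<lambda>l. v0 l * indicator {..t} l * (W t - Wp (t - l)))"
proof -
  have e: "(\<lambda>l. v0 l * indicator {..t} l * (W t - Wp (t - l))) = (\<lambda>l. W t * (v0 l * indicator {..t} l) - v0 l * Wp (t - l))"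
  proof
    fix l show "v0 l * indicator {..t} l * (W t - Wp (t - l)) = W t * (v0 l * indicator {..t} l) - v0 l * Wp (t - l)"
      by (cases "l \<le> t") (auto simp: Wp_neg algebra_simps)
  qed
  show "integrable lborel (\<lambda>l. v0 l * indicator {..t} l * (W t - Wp (t - l)))"
    unfolding e using v0_cut_integrable convolution_integrable by auto
  show "Wp t - cv t = W t * PL MZ t + (\<integral>l. v0 l * indicator {..t} l * (W t - Wp (t - l)) \<partial>lborel)"
  proof -
    have "(\<integral>l. v0 l * indicator {..t} l * (W t - Wp (t - l)) \<partial>lborel) = W t * (1 - PL MZ t) - cv t"
      unfolding e using v0_cut_integrable convolution_integrable t by (simp add: cv_def PL_eq)
    moreover have "Wp t = W t" using t by (simp add: Wp_def)
    ultimately show ?thesis by (simp add: algebra_simps)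
  qed
qed

lemma W_deficit_nonneg: "0 \<le> v0 l * indicator {..t} l * (W t - Wp (t - l))" if "t > 0"
proof (cases "0 < l \<and> l \<le> t")
  case True
  then have "Wp (t - l) \<le> W t" using that Wp_le[of "t - l" t] by (simp add: W0_eq)
  then show ?thesis using v0_nonneg[of l] by simp
next
  case False
  then show ?thesis using v0_eq_0[of l] by (cases "l \<le> 0") auto
qed

lemma wp_ge:
  assumes t: "t > 0"
  shows "wp t \<ge> g * (W t * PL MZ t)"
proof -
  have "0 \<le> (\<integral>l. v0 l * indicator {..t} l * (W t - Wp (t - l)) \<partial>lborel)"
    by (intro Bochner_Integration.integral_nonneg W_deficit_nonneg t)
  then have "W t * PL MZ t \<le> Wp t - cv t" using W_deficit(1)[OF t] by linarith
  then show ?thesis using mult_left_mono[of _ _ g] g t by (simp add: wp_eq)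
qed

lemma wp_nonneg: "t > 0 \<Longrightarrow> wp t \<ge> 0"
  using wp_ge[of t] g PL_bounds[of t] W0_ge_1[of t] W0_eq[of t]
  by (metis less_imp_le mult_nonneg_nonneg order_trans zero_le_one)

text \<open>Where the derivative vanishes, the deficit identity forces \<open>W\<close> to be constant just before, so a zero
  propagates backwards by any step \<open>d\<close> that lifetimes can exceed, until it reaches \<open>(0, d]\<close>.\<close>
lemma wp_zero_back:
  assumes d: "d > 0" "PL MZ d > 0" and t: "t > d" and z: "wp t = 0"
  shows "wp (t - d) = 0"
proof -
  have t0: "t > 0" using d t by simp
  let ?D = "\<lambda>l. v0 l * indicator {..t} l * (W t - Wp (t - l))"
  have W1: "W t \<ge> 1" using W0_ge_1[of t] W0_eq[of t] t0 by simp
  have "W t * PL MZ t + (\<integral>l. ?D l \<partial>lborel) = 0"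
    using z W_deficit(1)[OF t0] wp_eq[of t] g t0 by simp
  moreover have "0 \<le> W t * PL MZ t" using W1 PL_bounds[of t] by simp
  moreover have "0 \<le> (\<integral>l. ?D l \<partial>lborel)"
    by (intro Bochner_Integration.integral_nonneg W_deficit_nonneg t0)
  ultimately have "W t * PL MZ t = 0" and I0: "(\<integral>l. ?D l \<partial>lborel) = 0" by linarith+
  then have PL0: "PL MZ t = 0" using W1 by simp
  have AE: "AE l in lborel. ?D l = 0"
    using integral_nonneg_eq_0_iff_AE[OF W_deficit(2)[OF t0]] W_deficit_nonneg[OF t0] I0 by auto
  have "\<exists>l. d < l \<and> l \<le> t \<and> W t = Wp (t - l)"
  proof (rule ccontr)
    assume no: "\<not> ?thesis"
    have "AE l in lborel. v0 l * indicator {..t} l = v0 l * indicator {..d} l"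
      using AE
    proof eventually_elim
      case (elim l)
      then show ?case using no t by (auto simp: indicator_def)
    qed
    then have "(\<integral>l. v0 l * indicator {..t} l \<partial>lborel) = (\<integral>l. v0 l * indicator {..d} l \<partial>lborel)"
      by (intro integral_cong_AE) auto
    then have "PL MZ t = PL MZ d" using PL_eq[of t] PL_eq[of d] t0 d by simp
    then show False using PL0 d by simp
  qed
  then obtain l where l: "d < l" "l \<le> t" "W t = Wp (t - l)" by blast
  have const: "W s = W t" if "s \<in> {t - l<..<t}" for s
  proof -
    have "W (t - l) \<le> W s" "W s \<le> W t"
      using that l(2) by (auto intro!: mono_onD[OF W_mono])
    then show ?thesis using l by (simp add: Wp_def)
  qed
  have "((\<lambda>_. W t) has_real_derivative 0) (at (t - d))" by simp
  then have "(W has_real_derivative 0) (at (t - d))"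
    by (rule has_field_derivative_transform_within_open[of _ _ _ "{t - l<..<t}"]) (use l d const in auto)
  moreover have "(W has_real_derivative wp (t - d)) (at (t - d))" by (rule W_deriv) (use t in simp)
  ultimately show ?thesis using DERIV_unique by blast
qed

lemma wp_pos:
  assumes "t > 0"
  shows "wp t > 0"
proof -
  obtain d where d: "d > 0" "PL MZ d > 0"
  proof -
    have "eventually (\<lambda>n. (\<integral>l. v0 l * indicator {..1 / real (Suc n)} l \<partial>lborel) < 1) sequentially"
      using order_tendstoD(2)[OF v0_cut_tendsto_0, of 1] by simp
    then obtain n where "(\<integral>l. v0 l * indicator {..1 / real (Suc n)} l \<partial>lborel) < 1"
      using eventually_happens'[OF sequentially_bot] by blast
    then show ?thesis using that[of "1 / real (Suc n)"] PL_eq[of "1 / real (Suc n)"] by simp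
  qed
  have "0 < s \<Longrightarrow> s \<le> real n * d \<Longrightarrow> wp s > 0" for n s
  proof (induction n arbitrary: s)
    case (Suc n)
    show ?case
    proof (cases "s \<le> d")
      case True
      have "PL MZ d \<le> PL MZ s"
        unfolding PL_def
      proof (rule MZ.finite_measure_mono)
        show "{z \<in> space MZ. ereal d < lifetime z} \<subseteq> {z \<in> space MZ. ereal s < lifetime z}"
          using True by (auto intro: le_less_trans[of _ "ereal d"])
      qed measurable
      moreover have "W s \<ge> 1" using W0_ge_1[of s] W0_eq[of s] Suc.prems by simp
      ultimately have "0 < W s * PL MZ s" using d by (intro mult_pos_pos) auto
      then have "0 < g * (W s * PL MZ s)" by (rule mult_pos_pos[OF g])
      then show ?thesis using wp_ge[OF Suc.prems(1)] by linarith
    next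
      case False
      have "wp (s - d) > 0" using Suc False by (simp add: algebra_simps)
      then have "wp s \<noteq> 0" using wp_zero_back[OF d, of s] False by auto
      then show ?thesis using wp_nonneg[OF Suc.prems(1)] by simp
    qed
  qed simp
  moreover obtain n where "t / d \<le> real n" using real_arch_simple by blast
  then have "t \<le> real n * d" using d by (simp add: field_simps)
  ultimately show ?thesis using assms by blast
qed

end

section \<open>Measurability of the sampled triples\<close>

lemma anc_right_const:
  "\<exists>e>0. \<forall>s'. s \<le> s' \<and> s' < s + e \<longrightarrow> anc \<omega> u s' = anc \<omega> u s"
proof -
  let ?B = "{btime \<omega> (take j u) - s | j. j \<le> length u \<and> btime \<omega> (take j u) > s}"
  have fin: "finite ?B" by simp
  define e where "e = Min (insert 1 ?B)"
  have e: "e > 0" unfolding e_def using fin by (subst Min_gr_iff) auto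
  have "anc \<omega> u s' = anc \<omega> u s" if s': "s \<le> s'" "s' < s + e" for s'
  proof -
    have "j \<le> length u \<and> btime \<omega> (take j u) \<le> s' \<longleftrightarrow> j \<le> length u \<and> btime \<omega> (take j u) \<le> s" for j
    proof (cases "j \<le> length u \<and> btime \<omega> (take j u) > s")
      case True
      then have "e \<le> btime \<omega> (take j u) - s" unfolding e_def using fin by (intro Min_le) auto
      then show ?thesis using True s' by auto
    qed (use s' in auto)
    then show ?thesis by (simp add: anc_def)
  qed
  then show ?thesis using e by blast
qed

lemma anc_eq_iff:
  assumes "s \<ge> 0"
  shows "anc \<omega> u s = anc \<omega> v s \<longleftrightarrow> (\<exists>k l. k \<le> length u \<and> l \<le> length v \<and> take k u = take l v \<and>
    btime \<omega> (take k u) \<le> s \<and> (\<forall>j\<in>{k<..length u}. \<not> btime \<omega> (take j u) \<le> s) \<and>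
    btime \<omega> (take l v) \<le> s \<and> (\<forall>j\<in>{l<..length v}. \<not> btime \<omega> (take j v) \<le> s))"
proof -
  have G: "(GREATEST j. j \<le> length w \<and> btime \<omega> (take j w) \<le> s) = k \<longleftrightarrow>
    k \<le> length w \<and> btime \<omega> (take k w) \<le> s \<and> (\<forall>j\<in>{k<..length w}. \<not> btime \<omega> (take j w) \<le> s)" for w k
  proof
    assume k: "(GREATEST j. j \<le> length w \<and> btime \<omega> (take j w) \<le> s) = k"
    have 1: "k \<le> length w \<and> btime \<omega> (take k w) \<le> s"
      unfolding k[symmetric] by (rule GreatestI_nat[of _ 0 "length w"]) (use assms in \<open>auto simp: btime_def\<close>)
    have "j \<le> k" if "j \<le> length w \<and> btime \<omega> (take j w) \<le> s" for j
      unfolding k[symmetric] by (rule Greatest_le_nat[where b = "length w"]) (use that in auto)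
    with 1 show "k \<le> length w \<and> btime \<omega> (take k w) \<le> s \<and> (\<forall>j\<in>{k<..length w}. \<not> btime \<omega> (take j w) \<le> s)"
      by fastforce
  next
    assume "k \<le> length w \<and> btime \<omega> (take k w) \<le> s \<and> (\<forall>j\<in>{k<..length w}. \<not> btime \<omega> (take j w) \<le> s)"
    then show "(GREATEST j. j \<le> length w \<and> btime \<omega> (take j w) \<le> s) = k"
      by (intro Greatest_equality) (auto simp: not_less[symmetric])
  qed
  show ?thesis (is "_ \<longleftrightarrow> ?R")
  proof
    assume "anc \<omega> u s = anc \<omega> v s"
    then show ?R
      using iffD1[OF G[of u] refl] iffD1[OF G[of v] refl] unfolding anc_def by blast
  next
    assume ?R
    then obtain k l where kl: "k \<le> length u" "l \<le> length v" "take k u = take l v"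
      "btime \<omega> (take k u) \<le> s" "\<forall>j\<in>{k<..length u}. \<not> btime \<omega> (take j u) \<le> s"
      "btime \<omega> (take l v) \<le> s" "\<forall>j\<in>{l<..length v}. \<not> btime \<omega> (take j v) \<le> s"
      by blast
    have "(GREATEST j. j \<le> length u \<and> btime \<omega> (take j u) \<le> s) = k"
      "(GREATEST j. j \<le> length v \<and> btime \<omega> (take j v) \<le> s) = l"
      by (rule iffD2[OF G]; use kl in blast)+
    then show "anc \<omega> u s = anc \<omega> v s" unfolding anc_def using kl(3) by simp
  qed
qed

context genus_data
begin

lemma measurable_gen_info [measurable (raw)]:
  "t \<in> borel_measurable Om \<Longrightarrow> (\<lambda>\<omega>. snd (gen_info \<omega> p (t \<omega>) u)) \<in> borel_measurable Om"
proof (induction u arbitrary: p t)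
  case (Cons k u)
  note Cons.prems [measurable]
  have [measurable]: "(\<lambda>\<omega>. snd (gen_info \<omega> (p @ [k]) (t \<omega> + daughter_age \<omega> p k) u)) \<in> borel_measurable Om"
    by (rule Cons.IH) measurable
  have "(\<lambda>\<omega>. snd (gen_info \<omega> p (t \<omega>) (k # u))) = (\<lambda>\<omega>. if ereal (daughter_age \<omega> p k) < lifetime (gpath \<omega> p)
    then snd (gen_info \<omega> (p @ [k]) (t \<omega> + daughter_age \<omega> p k) u) else t \<omega> + daughter_age \<omega> p k)"
    by (auto simp: Let_def fun_eq_iff)
  also have "\<dots> \<in> borel_measurable Om" by measurable
  finally show ?case .
qed simp

lemma measurable_btime [measurable]: "(\<lambda>\<omega>. btime \<omega> u) \<in> borel_measurable Om"
  unfolding btime_def by (rule measurable_gen_info) simp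

lemma measurable_anc_eq [measurable]: "s \<ge> 0 \<Longrightarrow> Measurable.pred Om (\<lambda>\<omega>. anc \<omega> u s = anc \<omega> v s)"
  unfolding anc_eq_iff by measurable

lemma measurable_coal_time [measurable]:
  assumes T: "T > 0"
  shows "(\<lambda>\<omega>. coal_time T \<omega> u v) \<in> borel_measurable Om"
proof -
  define Q where "Q = insert T {s. s \<in> \<rat> \<and> 0 \<le> s \<and> s \<le> T}"
  have cQ: "countable Q" unfolding Q_def by (auto intro: countable_subset[OF _ countable_rat])
  have Q: "s \<in> Q \<Longrightarrow> 0 \<le> s \<and> s \<le> T" for s using T by (auto simp: Q_def)
  define S where "S \<omega> = {s. 0 \<le> s \<and> s \<le> T \<and> anc \<omega> u s = anc \<omega> v s}" for \<omega>
  have near: "\<exists>q\<in>Q \<inter> S \<omega>. s \<le> q" if s: "s \<in> S \<omega>" for s \<omega>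
  proof (cases "s = T")
    case True
    then show ?thesis using s by (auto simp: Q_def)
  next
    case False
    then have sT: "s < T" "0 \<le> s" "anc \<omega> u s = anc \<omega> v s" using s by (auto simp: S_def)
    obtain e1 where e1: "e1 > 0" "\<And>s'. s \<le> s' \<and> s' < s + e1 \<Longrightarrow> anc \<omega> u s' = anc \<omega> u s"
      using anc_right_const by blast
    obtain e2 where e2: "e2 > 0" "\<And>s'. s \<le> s' \<and> s' < s + e2 \<Longrightarrow> anc \<omega> v s' = anc \<omega> v s"
      using anc_right_const by blast
    obtain q where q: "q \<in> \<rat>" "s < q" "q < min T (min (s + e1) (s + e2))"
      using Rats_dense_in_real[of s "min T (min (s + e1) (s + e2))"] sT(1) e1(1) e2(1) by auto
    then have "anc \<omega> u q = anc \<omega> u s" "anc \<omega> v q = anc \<omega> v s" by (auto intro!: e1(2) e2(2))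
    then have "q \<in> Q \<inter> S \<omega>" using q sT by (simp add: Q_def S_def)
    then show ?thesis using q by (intro bexI[of _ q]) auto
  qed
  have eq: "Sup (S \<omega>) \<le> r \<longleftrightarrow> (if \<exists>q\<in>Q. anc \<omega> u q = anc \<omega> v q then \<forall>q\<in>Q. anc \<omega> u q = anc \<omega> v q \<longrightarrow> q \<le> r else Sup {} \<le> r)" for \<omega> r
  proof (cases "\<exists>q\<in>Q. anc \<omega> u q = anc \<omega> v q")
    case True
    then have ne: "S \<omega> \<noteq> {}" using Q by (auto simp: S_def)
    have bdd: "bdd_above (S \<omega>)" by (auto simp: S_def bdd_above_def)
    have "Sup (S \<omega>) \<le> r \<longleftrightarrow> (\<forall>s\<in>S \<omega>. s \<le> r)" using ne bdd by (rule cSup_le_iff)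
    also have "\<dots> \<longleftrightarrow> (\<forall>q\<in>Q. anc \<omega> u q = anc \<omega> v q \<longrightarrow> q \<le> r)"
      using near Q by (fastforce simp: S_def intro: order_trans)
    finally show ?thesis using True by simp
  next
    case False
    then have "S \<omega> = {}" using near by (force simp: S_def)
    then show ?thesis using False by simp
  qed
  have m: "Measurable.pred Om (\<lambda>\<omega>. anc \<omega> u q = anc \<omega> v q)" if "q \<in> Q" for q
    using Q[OF that] by (intro measurable_anc_eq) auto
  define qs where "qs = from_nat_into Q"
  have qs: "Q = range qs"
    unfolding qs_def using range_from_nat_into[OF _ cQ] by (auto simp: Q_def)
  have [measurable]: "Measurable.pred Om (\<lambda>\<omega>. anc \<omega> u (qs i) = anc \<omega> v (qs i))" for i
    by (rule m) (simp add: qs)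
  have [measurable]: "Measurable.pred Om (\<lambda>\<omega>. \<exists>q\<in>Q. anc \<omega> u q = anc \<omega> v q)"
    "\<And>r. Measurable.pred Om (\<lambda>\<omega>. \<forall>q\<in>Q. anc \<omega> u q = anc \<omega> v q \<longrightarrow> q \<le> r)"
    unfolding qs by simp_all
  have [measurable]: "(\<lambda>\<omega>. Sup (S \<omega>)) \<in> borel_measurable Om"
    unfolding borel_measurable_iff_le eq by measurable
  show ?thesis unfolding coal_time_def S_def[symmetric] by measurable
qed

abbreviation "N3 \<equiv> (borel \<Otimes>\<^sub>M borel \<Otimes>\<^sub>M count_space UNIV :: (real \<times> real \<times> nat) measure)"

lemma measurable_sampled_event:
  assumes T: "T > 0" and B: "B \<in> sets (\<Pi>\<^sub>M i\<in>{1..n}. N3)"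
  shows "{\<omega> \<in> space Om. Nsamp T \<omega> = Suc n \<and> (\<lambda>i\<in>{1..n}. sampled_triple T \<omega> i) \<in> B} \<in> sets Om"
proof -
  define trp where "trp us i \<omega> = (coal_time T \<omega> (us ! (i - 1)) (us ! i), T - btime \<omega> (us ! i),
    gpath \<omega> (us ! i) (T - btime \<omega> (us ! i)))" for us and i :: nat and \<omega>
  have eqv: "Nsamp T \<omega> = Suc n \<and> (\<lambda>i\<in>{1..n}. sampled_triple T \<omega> i) \<in> B \<longleftrightarrow>
    (\<exists>us. (sorted_wrt planar_less us \<and> length us = Suc n) \<and> (\<forall>u. u \<in> set us \<longleftrightarrow> alive T \<omega> u) \<and> (\<lambda>i\<in>{1..n}. trp us i \<omega>) \<in> B)" for \<omega>
  proof -
    have *: "(\<lambda>i\<in>{1..n}. sampled_triple T \<omega> i) = (\<lambda>i\<in>{1..n}. trp us i \<omega>)"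
      if "sorted_wrt planar_less us" "set us = sampled_set T \<omega>" "length us = Suc n" for us
    proof (rule restrict_ext)
      fix i assume "i \<in> {1..n}"
      then have "sgen T \<omega> (i - 1) = us ! (i - 1)" "sgen T \<omega> i = us ! i"
        using that by (auto intro!: sgen_eq)
      then show "sampled_triple T \<omega> i = trp us i \<omega>" by (simp add: sampled_triple_def trp_def)
    qed
    show ?thesis
    proof
      assume a: "Nsamp T \<omega> = Suc n \<and> (\<lambda>i\<in>{1..n}. sampled_triple T \<omega> i) \<in> B"
      then have "finite (sampled_set T \<omega>)" by (metis Nsamp_def card.infinite nat.distinct(1))
      then obtain us where us: "sorted_wrt planar_less us" "set us = sampled_set T \<omega>"
        using planar_sorted_ex by metis
      moreover have "length us = Suc n" using a sorted_planar_card[OF us(1)] us(2) by (simp add: Nsamp_def)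
      ultimately show "\<exists>us. (sorted_wrt planar_less us \<and> length us = Suc n) \<and> (\<forall>u. u \<in> set us \<longleftrightarrow> alive T \<omega> u) \<and> (\<lambda>i\<in>{1..n}. trp us i \<omega>) \<in> B"
        using * a by (intro exI[of _ us]) (auto simp: sampled_set_eq)
    next
      assume "\<exists>us. (sorted_wrt planar_less us \<and> length us = Suc n) \<and> (\<forall>u. u \<in> set us \<longleftrightarrow> alive T \<omega> u) \<and> (\<lambda>i\<in>{1..n}. trp us i \<omega>) \<in> B"
      then obtain us where us: "sorted_wrt planar_less us" "length us = Suc n" "set us = sampled_set T \<omega>" "(\<lambda>i\<in>{1..n}. trp us i \<omega>) \<in> B"
        by (auto simp: sampled_set_eq)
      then show "Nsamp T \<omega> = Suc n \<and> (\<lambda>i\<in>{1..n}. sampled_triple T \<omega> i) \<in> B"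
        using * sorted_planar_card[OF us(1)] by (simp add: Nsamp_def)
    qed
  qed
  have m: "{\<omega> \<in> space Om. \<exists>us. (sorted_wrt planar_less us \<and> length us = Suc n) \<and> (\<forall>u. u \<in> set us \<longleftrightarrow> alive T \<omega> u) \<and> (\<lambda>i\<in>{1..n}. trp us i \<omega>) \<in> B} \<in> sets Om"
  proof -
    have [measurable]: "(\<lambda>\<omega>. \<lambda>i\<in>{1..n}. trp us i \<omega>) \<in> measurable Om (\<Pi>\<^sub>M i\<in>{1..n}. N3)" for us
      unfolding trp_def using T by (intro measurable_restrict measurable_Pair measurable_coal_time measurable_eval) measurable
    note B[measurable]
    show ?thesis by measurable
  qed
  show ?thesis unfolding eqv by (rule m)
qed

end

section \<open>Boxes determine the law of a finite sequence of triples\<close>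

definition simple_test :: "test \<Rightarrow> bool" where
  "simple_test A \<longleftrightarrow> fst (snd A) \<in> sets borel \<and> (snd (snd A) = {} \<or> snd (snd A) = UNIV \<or> (\<exists>k. snd (snd A) = {k}))"

definition tbox :: "test \<Rightarrow> (real \<times> real \<times> nat) set" where
  "tbox A = {x. tmem x A}"

lemma tbox_measurable: "fst (snd A) \<in> sets borel \<Longrightarrow> tbox A \<in> sets (borel \<Otimes>\<^sub>M borel \<Otimes>\<^sub>M count_space UNIV)"
proof -
  assume A: "fst (snd A) \<in> sets borel"
  obtain b D K where A': "A = (b, D, K)" by (cases A)
  have "tbox A = {..b} \<times> D \<times> K" by (auto simp: tbox_def A')
  moreover have "D \<times> K \<in> sets (borel \<Otimes>\<^sub>M count_space UNIV)"
    using A A' by (intro pair_measureI) auto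
  ultimately show ?thesis by (simp add: pair_measureI)
qed

lemma sets_boxes:
  "sets (borel \<Otimes>\<^sub>M borel \<Otimes>\<^sub>M count_space UNIV :: (real \<times> real \<times> nat) measure) = sigma_sets UNIV (tbox ` Collect simple_test)"
proof
  let ?N = "borel \<Otimes>\<^sub>M borel \<Otimes>\<^sub>M count_space UNIV :: (real \<times> real \<times> nat) measure"
  let ?S = "sigma UNIV (tbox ` Collect simple_test)"
  have S: "sets ?S = sigma_sets UNIV (tbox ` Collect simple_test)" by (simp add: sets_measure_of)
  show "sigma_sets UNIV (tbox ` Collect simple_test) \<subseteq> sets ?N"
  proof -
    have "space ?N = UNIV" by (simp add: space_pair_measure)
    moreover have "tbox ` Collect simple_test \<subseteq> sets ?N" by (auto simp: simple_test_def intro!: tbox_measurable)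
    ultimately show ?thesis using sets.sigma_sets_subset[of "tbox ` Collect simple_test" ?N] by simp
  qed
  have basic: "tbox A \<in> sets ?S" if "simple_test A" for A
    unfolding S using that by (intro sigma_sets.Basic) auto
  have un: "(\<Union>n. tbox (real n, D, K)) = {x. fst (snd x) \<in> D \<and> snd (snd x) \<in> K}" for D K
  proof (intro set_eqI iffI)
    fix x :: "real \<times> real \<times> nat" assume "x \<in> {x. fst (snd x) \<in> D \<and> snd (snd x) \<in> K}"
    moreover obtain n where "fst x \<le> real n" using real_arch_simple by blast
    ultimately show "x \<in> (\<Union>n. tbox (real n, D, K))" by (cases x) (auto simp: tbox_def)
  qed (auto simp: tbox_def)
  have "(\<lambda>x. x) \<in> measurable ?S ?N"
  proof -
    have 1: "fst \<in> measurable ?S borel"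
      unfolding borel_measurable_iff_le
    proof
      fix b
      have "{w \<in> space ?S. fst w \<le> b} = tbox (b, UNIV, UNIV)" by (auto simp: tbox_def space_measure_of)
      then show "{w \<in> space ?S. fst w \<le> b} \<in> sets ?S" using basic[of "(b, UNIV, UNIV)"] by (simp add: simple_test_def)
    qed
    have 2: "(\<lambda>x. fst (snd x)) \<in> measurable ?S borel"
    proof (rule measurableI)
      fix D :: "real set" assume D: "D \<in> sets borel"
      have "(\<lambda>x. fst (snd x)) -` D \<inter> space ?S = (\<Union>n. tbox (real n, D, UNIV))"
        unfolding un by (auto simp: space_measure_of)
      moreover have "(\<Union>n. tbox (real n, D, UNIV)) \<in> sets ?S"
        using D by (intro sets.countable_UN) (auto intro!: basic simp: simple_test_def)
      ultimately show "(\<lambda>x. fst (snd x)) -` D \<inter> space ?S \<in> sets ?S" by simp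
    qed simp
    have 3: "(\<lambda>x. snd (snd x)) \<in> measurable ?S (count_space UNIV)"
    proof (rule measurableI)
      fix X :: "nat set"
      have eq: "(\<lambda>x. snd (snd x)) -` X \<inter> space ?S = (\<Union>k\<in>X. \<Union>n. tbox (real n, UNIV, {k}))"
        unfolding un by (auto simp: space_measure_of)
      have m: "(\<Union>n. tbox (real n, UNIV, {k})) \<in> sets ?S" for k
        by (intro sets.countable_UN) (auto intro!: basic simp: simple_test_def)
      show "(\<lambda>x. snd (snd x)) -` X \<inter> space ?S \<in> sets ?S"
        unfolding eq by (rule sets.countable_UN) (use m in blast)
    qed simp
    have "(\<lambda>x. (fst x, fst (snd x), snd (snd x))) \<in> measurable ?S ?N"
      using 1 2 3 by (intro measurable_Pair)
    then show ?thesis by simp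
  qed
  then show "sets ?N \<subseteq> sigma_sets UNIV (tbox ` Collect simple_test)"
    unfolding S[symmetric] using measurable_sets[of "\<lambda>x. x" ?S ?N] by (auto simp: space_measure_of)
qed

lemma tbox_Int:
  assumes "simple_test A" "simple_test B"
  shows "\<exists>C. simple_test C \<and> tbox A \<inter> tbox B = tbox C"
proof -
  obtain b D K b' D' K' where AB: "A = (b, D, K)" "B = (b', D', K')" by (cases A, cases B)
  have "tbox A \<inter> tbox B = tbox (min b b', D \<inter> D', K \<inter> K')" by (auto simp: tbox_def AB)
  moreover have "simple_test (min b b', D \<inter> D', K \<inter> K')"
    using assms by (auto simp: AB simple_test_def)
  ultimately show ?thesis by blast
qed

lemma sets_PiM_boxes:
  assumes I: "finite I"
  defines "G \<equiv> {Pi\<^sub>E I (\<lambda>i. tbox (A i)) | A. \<forall>i\<in>I. simple_test (A i)}"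
  shows "sets (\<Pi>\<^sub>M i\<in>I. borel \<Otimes>\<^sub>M borel \<Otimes>\<^sub>M count_space UNIV :: (real \<times> real \<times> nat) measure) = sigma_sets (Pi\<^sub>E I (\<lambda>_. UNIV)) G"
    and "Int_stable G" and "G \<subseteq> Pow (Pi\<^sub>E I (\<lambda>_. UNIV))"
proof -
  let ?E = "tbox ` Collect simple_test"
  let ?N = "borel \<Otimes>\<^sub>M borel \<Otimes>\<^sub>M count_space UNIV :: (real \<times> real \<times> nat) measure"
  let ?P = "{{f \<in> Pi\<^sub>E I (\<lambda>_. UNIV). \<forall>i\<in>j. f i \<in> A i} | A j. j \<in> {I} \<and> A \<in> Pi j (\<lambda>_. ?E)}"
  have PG: "?P = G"
  proof
    show "?P \<subseteq> G"
    proof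
      fix X assume "X \<in> ?P"
      then obtain A where X: "X = {f \<in> Pi\<^sub>E I (\<lambda>_. UNIV). \<forall>i\<in>I. f i \<in> A i}" and A: "\<forall>i\<in>I. A i \<in> ?E" by auto
      from A have "\<forall>i\<in>I. \<exists>B. simple_test B \<and> A i = tbox B" unfolding image_iff by blast
      then obtain B where B: "\<forall>i\<in>I. simple_test (B i) \<and> A i = tbox (B i)" by metis
      then have "X = Pi\<^sub>E I (\<lambda>i. tbox (B i))" unfolding X by (auto simp: PiE_iff extensional_def)
      then show "X \<in> G" unfolding G_def using B by blast
    qed
    show "G \<subseteq> ?P"
    proof
      fix X assume "X \<in> G"
      then obtain A where X: "X = Pi\<^sub>E I (\<lambda>i. tbox (A i))" and A: "\<forall>i\<in>I. simple_test (A i)" by (auto simp: G_def)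
      have "X = {f \<in> Pi\<^sub>E I (\<lambda>_. UNIV). \<forall>i\<in>I. f i \<in> tbox (A i)}" unfolding X by (auto simp: PiE_iff extensional_def)
      moreover have "(\<lambda>i. tbox (A i)) \<in> Pi I (\<lambda>_. ?E)" using A by auto
      ultimately show "X \<in> ?P"
        unfolding mem_Collect_eq by (intro exI[of _ "\<lambda>i. tbox (A i)"] exI[of _ I] conjI singletonI)
    qed
  qed
  show sub: "G \<subseteq> Pow (Pi\<^sub>E I (\<lambda>_. UNIV))" by (auto simp: G_def PiE_iff)
  have "sets (\<Pi>\<^sub>M i\<in>I. ?N) = sets (\<Pi>\<^sub>M i\<in>I. sigma UNIV ?E)"
    by (intro sets_PiM_cong refl) (simp add: sets_measure_of sets_boxes)
  also have "\<dots> = sets (sigma (Pi\<^sub>E I (\<lambda>_. UNIV)) ?P)"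
  proof (rule sets_PiM_sigma)
    show "\<exists>S\<subseteq>?E. countable S \<and> UNIV = \<Union> S" for i
    proof (intro exI[of _ "range (\<lambda>n::nat. tbox (real n, UNIV, UNIV))"] conjI)
      show "UNIV = \<Union> (range (\<lambda>n::nat. tbox (real n, UNIV, UNIV)))"
      proof (intro set_eqI iffI)
        fix x :: "real \<times> real \<times> nat"
        obtain n where "fst x \<le> real n" using real_arch_simple by blast
        then show "x \<in> \<Union> (range (\<lambda>n::nat. tbox (real n, UNIV, UNIV)))" by (cases x) (auto simp: tbox_def)
      qed simp
    qed (auto simp: simple_test_def)
  qed (use I in auto)
  also have "\<dots> = sigma_sets (Pi\<^sub>E I (\<lambda>_. UNIV)) G"
    unfolding PG using sub by (simp add: sets_measure_of)
  finally show "sets (\<Pi>\<^sub>M i\<in>I. ?N) = sigma_sets (Pi\<^sub>E I (\<lambda>_. UNIV)) G" .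
  show "Int_stable G"
  proof (rule Int_stableI)
    fix X Y assume "X \<in> G" "Y \<in> G"
    then obtain A B where A: "X = Pi\<^sub>E I (\<lambda>i. tbox (A i))" "\<forall>i\<in>I. simple_test (A i)"
      and B: "Y = Pi\<^sub>E I (\<lambda>i. tbox (B i))" "\<forall>i\<in>I. simple_test (B i)" by (auto simp: G_def)
    have "\<forall>i\<in>I. \<exists>C. simple_test C \<and> tbox (A i) \<inter> tbox (B i) = tbox C" using A B tbox_Int by blast
    then obtain C where C: "\<forall>i\<in>I. simple_test (C i) \<and> tbox (A i) \<inter> tbox (B i) = tbox (C i)" by metis
    have "X \<inter> Y = Pi\<^sub>E I (\<lambda>i. tbox (C i))"
      unfolding A B PiE_Int using C by (intro PiE_cong) auto
    then show "X \<inter> Y \<in> G" unfolding G_def using C by blast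
  qed
qed

lemma sampled_fst_le:
  assumes good: "good \<omega>" and N: "Nsamp T \<omega> = Suc n" and i: "i \<in> {1..n}"
  shows "fst (sampled_triple T \<omega> i) \<le> T"
proof -
  have "finite (sampled_set T \<omega>)" using N by (metis Nsamp_def card.infinite nat.distinct(1))
  then obtain us where us: "sorted_wrt planar_less us" "set us = sampled_set T \<omega>"
    using planar_sorted_ex by metis
  have "length us = Suc n" using N sorted_planar_card[OF us(1)] us(2) by (simp add: Nsamp_def)
  then have "sampled_triple T \<omega> i = trip T \<omega> (us ! (i - 1)) (us ! i)"
    using i by (intro sampled_triple_eq[OF good us]) auto
  then show ?thesis using bt_nonneg[OF good] by (simp add: trip_def)
qed

context genus_scale
begin

declare \<theta>.simps [simp del]

abbreviation "root_test T \<equiv> (T, UNIV, UNIV) :: test"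

lemma Gf_prod: "Gf t As = prod_list (map (\<lambda>A. Mt A t) As) / V t"
  by (induction As) auto

lemma Gf_upt: "Gf t (map A [1..<Suc n]) = (\<Prod>i\<in>{1..n}. Mt (A i) t) / V t"
proof -
  have "prod_list (map (\<lambda>i. Mt (A i) t) [1..<Suc n]) = (\<Prod>i\<in>set [1..<Suc n]. Mt (A i) t)"
    by (rule prod.distinct_set_conv_list[symmetric]) (simp del: upt_Suc)
  moreover have "set [1..<Suc n] = {1..n}" by auto
  ultimately have e: "prod_list (map (\<lambda>i. Mt (A i) t) [1..<Suc n]) = (\<Prod>i\<in>{1..n}. Mt (A i) t)"
    by (simp only:)
  show ?thesis unfolding Gf_prod map_map comp_def e ..
qed

lemma box_prob:
  assumes T: "T > 0" and A: "\<And>i. i \<in> {1..n} \<Longrightarrow> fst (snd (A i)) \<in> sets borel"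
  shows "measure Om {\<omega> \<in> space Om. Nsamp T \<omega> = Suc n \<and> (\<lambda>i\<in>{1..n}. sampled_triple T \<omega> i) \<in> Pi\<^sub>E {1..n} (\<lambda>i. tbox (A i))} =
    \<theta> (root_test T) T * Gf T (map A [1..<Suc n])"
proof -
  have ok: "ok (root_test T # map A [1..<Suc n])" using A by (auto simp: ok_def)
  have "measure Om {\<omega> \<in> space Om. Nsamp T \<omega> = Suc n \<and> (\<lambda>i\<in>{1..n}. sampled_triple T \<omega> i) \<in> Pi\<^sub>E {1..n} (\<lambda>i. tbox (A i))} =
    xP T (root_test T # map A [1..<Suc n])"
    unfolding xP_def
  proof (rule measure_eq_AE)
    show "AE \<omega> in Om. \<omega> \<in> {\<omega> \<in> space Om. Nsamp T \<omega> = Suc n \<and> (\<lambda>i\<in>{1..n}. sampled_triple T \<omega> i) \<in> Pi\<^sub>E {1..n} (\<lambda>i. tbox (A i))} \<longleftrightarrow>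
      \<omega> \<in> {\<omega> \<in> space Om. Xmatch T \<omega> (root_test T # map A [1..<Suc n])}"
      using AE_good
    proof eventually_elim
      case (elim \<omega>)
      show ?case unfolding mem_Collect_eq Xmatch_sampled[OF elim] by (auto simp: tbox_def PiE_iff)
    qed
    show "{\<omega> \<in> space Om. Nsamp T \<omega> = Suc n \<and> (\<lambda>i\<in>{1..n}. sampled_triple T \<omega> i) \<in> Pi\<^sub>E {1..n} (\<lambda>i. tbox (A i))} \<in> sets Om"
      by (rule measurable_sampled_event[OF T]) (intro sets_PiM_I_finite tbox_measurable A; simp)
    show "{\<omega> \<in> space Om. Xmatch T \<omega> (root_test T # map A [1..<Suc n])} \<in> sets Om"
      using measurable_Xmatch[of "\<lambda>_. T" Om "\<lambda>\<omega>. \<omega>", OF _ _ ok] by (simp add: pred_def)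
  qed
  then show ?thesis using xP_eq_xh[OF T ok] by (simp del: upt_Suc)
qed

lemma event_space_prob:
  assumes T: "T > 0"
  shows "measure Om {\<omega> \<in> space Om. Nsamp T \<omega> = Suc n} =
    measure Om {\<omega> \<in> space Om. Nsamp T \<omega> = Suc n \<and> (\<lambda>i\<in>{1..n}. sampled_triple T \<omega> i) \<in> Pi\<^sub>E {1..n} (\<lambda>i. tbox (root_test T))}"
    and "{\<omega> \<in> space Om. Nsamp T \<omega> = Suc n} \<in> sets Om"
proof -
  have "space (\<Pi>\<^sub>M i\<in>{1..n}. N3) = Pi\<^sub>E {1..n} (\<lambda>_. UNIV)" by (simp add: space_PiM space_pair_measure)
  then have "{\<omega> \<in> space Om. Nsamp T \<omega> = Suc n} = {\<omega> \<in> space Om. Nsamp T \<omega> = Suc n \<and> (\<lambda>i\<in>{1..n}. sampled_triple T \<omega> i) \<in> space (\<Pi>\<^sub>M i\<in>{1..n}. N3)}"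
    by simp
  then show m: "{\<omega> \<in> space Om. Nsamp T \<omega> = Suc n} \<in> sets Om"
    using measurable_sampled_event[OF T sets.top] by simp
  show "measure Om {\<omega> \<in> space Om. Nsamp T \<omega> = Suc n} =
    measure Om {\<omega> \<in> space Om. Nsamp T \<omega> = Suc n \<and> (\<lambda>i\<in>{1..n}. sampled_triple T \<omega> i) \<in> Pi\<^sub>E {1..n} (\<lambda>i. tbox (root_test T))}"
  proof (rule measure_eq_AE[OF _ m])
    show "AE \<omega> in Om. \<omega> \<in> {\<omega> \<in> space Om. Nsamp T \<omega> = Suc n} \<longleftrightarrow>
      \<omega> \<in> {\<omega> \<in> space Om. Nsamp T \<omega> = Suc n \<and> (\<lambda>i\<in>{1..n}. sampled_triple T \<omega> i) \<in> Pi\<^sub>E {1..n} (\<lambda>i. tbox (root_test T))}"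
      using AE_good
    proof eventually_elim
      case (elim \<omega>)
      have "tmem (sampled_triple T \<omega> i) (root_test T)" if "Nsamp T \<omega> = Suc n" "i \<in> {1..n}" for i
        using sampled_fst_le[OF elim that] by (cases "sampled_triple T \<omega> i") simp
      then show ?case by (auto simp: tbox_def PiE_iff)
    qed
    show "{\<omega> \<in> space Om. Nsamp T \<omega> = Suc n \<and> (\<lambda>i\<in>{1..n}. sampled_triple T \<omega> i) \<in> Pi\<^sub>E {1..n} (\<lambda>i. tbox (root_test T))} \<in> sets Om"
      by (rule measurable_sampled_event[OF T]) (intro sets_PiM_I_finite tbox_measurable; simp)
  qed
qed

lemma nonempty_prob:
  assumes T: "T > 0"
  shows "measure Om {\<omega> \<in> space Om. Nsamp T \<omega> \<ge> 1} = \<theta> (root_test T) T"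
proof -
  let ?x = "1 - 1 / V T"
  have p: "measure Om {\<omega> \<in> space Om. Nsamp T \<omega> = Suc n} = \<theta> (root_test T) T * (1 / V T) * ?x ^ n" for n
  proof -
    have "measure Om {\<omega> \<in> space Om. Nsamp T \<omega> = Suc n} = \<theta> (root_test T) T * Gf T (map (\<lambda>_. root_test T) [1..<Suc n])"
      unfolding event_space_prob(1)[OF T] by (rule box_prob[OF T]) simp
    also have "Gf T (map (\<lambda>_. root_test T) [1..<Suc n]) = ?x ^ n / V T"
      unfolding Gf_upt using T Mt_full[of T T] by (simp del: Mt.simps)
    finally show ?thesis by simp
  qed
  have s1: "(\<lambda>n. measure Om {\<omega> \<in> space Om. Nsamp T \<omega> = Suc n}) sums measure Om (\<Union>n. {\<omega> \<in> space Om. Nsamp T \<omega> = Suc n})"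
    by (rule Om.finite_measure_UNION) (use event_space_prob(2)[OF T] in \<open>auto simp: disjoint_family_on_def\<close>)
  have u: "(\<Union>n. {\<omega> \<in> space Om. Nsamp T \<omega> = Suc n}) = {\<omega> \<in> space Om. Nsamp T \<omega> \<ge> 1}"
    by (auto simp: Suc_le_eq gr0_conv_Suc)
  have s2: "(\<lambda>n. \<theta> (root_test T) T * (1 / V T) * ?x ^ n) sums (\<theta> (root_test T) T * (1 / V T) * (1 / (1 - ?x)))"
    using V_ge_1[of T] by (intro sums_mult geometric_sums) (auto simp: abs_if field_simps)
  have "measure Om {\<omega> \<in> space Om. Nsamp T \<omega> \<ge> 1} = \<theta> (root_test T) T * (1 / V T) * (1 / (1 - ?x))"
    by (rule sums_unique2[OF s1[unfolded p u] s2])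
  then show ?thesis using V_pos[of T] by simp
qed

end

section \<open>The killed sequence\<close>

locale killed_sequence = genus_scale g f MZ v W + \<mu>: prob_space \<mu>
  for g f MZ v W and \<mu> :: "(real \<times> real \<times> nat) measure" +
  fixes T :: real
  assumes T: "T > 0" and sets_\<mu>: "sets \<mu> = sets (borel \<Otimes>\<^sub>M borel \<Otimes>\<^sub>M count_space UNIV)"
    and test_prob: "\<And>A. simple_test A \<Longrightarrow> measure \<mu> {x \<in> space \<mu>. fst x \<le> T \<and> tmem x A} = Mt A T"
begin

abbreviation "Seq \<equiv> \<Pi>\<^sub>M j\<in>(UNIV :: nat set). \<mu>"

sublocale Seq: product_prob_space "\<lambda>_. \<mu>" "UNIV :: nat set"
  by unfold_locales

lemma space_\<mu>: "space \<mu> = UNIV"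
  using sets_eq_imp_space_eq[OF sets_\<mu>] by (simp add: space_pair_measure)

lemma measurable_fst_\<mu> [measurable]: "fst \<in> borel_measurable \<mu>"
  using measurable_cong_sets[OF sets_\<mu> refl] by auto

lemma tbox_sets_\<mu>: "simple_test A \<Longrightarrow> tbox A \<in> sets \<mu>"
  unfolding sets_\<mu> by (rule tbox_measurable) (simp add: simple_test_def)

lemma simple_root: "simple_test (root_test T)"
  by (simp add: simple_test_def)

lemma prob_le: "measure \<mu> {x \<in> space \<mu>. fst x \<le> T} = 1 - 1 / V T"
proof -
  have "{x \<in> space \<mu>. fst x \<le> T} = {x \<in> space \<mu>. fst x \<le> T \<and> tmem x (root_test T)}"
    by auto
  then show ?thesis using test_prob[OF simple_root] Mt_full[of T T] T by (simp del: Mt.simps)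
qed

lemma prob_gt: "measure \<mu> {x \<in> space \<mu>. T < fst x} = 1 / V T"
proof -
  have "{x \<in> space \<mu>. T < fst x} = space \<mu> - {x \<in> space \<mu>. fst x \<le> T}" by auto
  then have "measure \<mu> {x \<in> space \<mu>. T < fst x} = 1 - measure \<mu> {x \<in> space \<mu>. fst x \<le> T}"
    by (simp add: \<mu>.prob_compl)
  then show ?thesis by (simp add: prob_le)
qed

lemma measure_Seq_Collect:
  assumes "finite J" "\<And>j. j \<in> J \<Longrightarrow> X j \<in> sets \<mu>"
  shows "measure Seq {\<omega> \<in> space Seq. \<forall>j\<in>J. \<omega> j \<in> X j} = (\<Prod>j\<in>J. measure \<mu> (X j))"
proof -
  have "emeasure Seq {\<omega> \<in> space Seq. \<forall>j\<in>J. \<omega> j \<in> X j} = (\<Prod>j\<in>J. emeasure \<mu> (X j))"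
    using assms by (intro Seq.emeasure_PiM_Collect) auto
  then have "ennreal (measure Seq {\<omega> \<in> space Seq. \<forall>j\<in>J. \<omega> j \<in> X j}) = ennreal (\<Prod>j\<in>J. measure \<mu> (X j))"
    by (simp add: Seq.P.emeasure_eq_measure \<mu>.emeasure_eq_measure prod_ennreal)
  then show ?thesis by (simp add: prod_nonneg)
qed

lemma AE_killed: "AE \<omega> in Seq. \<exists>j\<ge>1. T < fst (\<omega> j)"
proof -
  have [measurable]: "(\<lambda>\<omega>. fst (\<omega> j)) \<in> borel_measurable Seq" for j
    by (rule measurable_compose[OF _ measurable_fst_\<mu>]) simp
  let ?B = "{\<omega> \<in> space Seq. \<forall>j\<ge>1. fst (\<omega> j) \<le> T}"
  have B: "?B \<in> sets Seq" by measurable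
  have "measure Seq ?B \<le> (1 - 1 / V T) ^ m" for m
  proof -
    have "measure Seq ?B \<le> measure Seq {\<omega> \<in> space Seq. \<forall>j\<in>{1..m}. \<omega> j \<in> {x \<in> space \<mu>. fst x \<le> T}}"
    proof (rule Seq.P.finite_measure_mono)
      show "?B \<subseteq> {\<omega> \<in> space Seq. \<forall>j\<in>{1..m}. \<omega> j \<in> {x \<in> space \<mu>. fst x \<le> T}}"
        by (auto simp: space_\<mu>)
    qed (simp add: space_\<mu>)
    also have "\<dots> = (1 - 1 / V T) ^ m"
      by (subst measure_Seq_Collect) (auto simp: prob_le)
    finally show ?thesis .
  qed
  moreover have "(\<lambda>m. (1 - 1 / V T) ^ m) \<longlonglongrightarrow> 0"
    using V_ge_1[of T] by (intro LIMSEQ_realpow_zero) (auto simp: field_simps)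
  ultimately have "measure Seq ?B \<le> 0" by (intro LIMSEQ_le_const) auto
  then have "measure Seq ?B = 0" by (simp add: measure_le_0_iff)
  then have "AE \<omega> in Seq. \<omega> \<notin> ?B" using Seq.P.prob_eq_0[OF B] by simp
  then show ?thesis
    using AE_space by eventually_elim (auto simp: not_le)
qed

definition ev :: "nat \<Rightarrow> (nat \<Rightarrow> real \<times> real \<times> nat) set \<Rightarrow> (nat \<Rightarrow> real \<times> real \<times> nat) set" where
  "ev n B = {\<omega> \<in> space Seq. (LEAST j. j \<ge> 1 \<and> fst (\<omega> j) > T) = Suc n \<and> (\<lambda>j\<in>{1..n}. \<omega> j) \<in> B}"

lemma ev_measurable:
  assumes B: "B \<in> sets (\<Pi>\<^sub>M i\<in>{1..n}. N3)"
  shows "ev n B \<in> sets Seq"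
proof -
  have [measurable]: "(\<lambda>\<omega>. fst (\<omega> j)) \<in> borel_measurable Seq" for j
    by (rule measurable_compose[OF _ measurable_fst_\<mu>]) simp
  have [measurable]: "(\<lambda>\<omega>. \<lambda>j\<in>{1..n}. \<omega> j) \<in> measurable Seq (\<Pi>\<^sub>M i\<in>{1..n}. \<mu>)" by measurable
  have "sets (\<Pi>\<^sub>M i\<in>{1..n}. N3) = sets (\<Pi>\<^sub>M i\<in>{1..n}. \<mu>)"
    by (intro sets_PiM_cong refl) (simp add: sets_\<mu>)
  then have [measurable]: "B \<in> sets (\<Pi>\<^sub>M i\<in>{1..n}. \<mu>)" using B by simp
  show ?thesis unfolding ev_def by measurable
qed

lemma AE_ev_iff: "AE \<omega> in Seq. (LEAST j. j \<ge> 1 \<and> fst (\<omega> j) > T) = Suc n \<longleftrightarrow>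
  (\<forall>j\<in>{1..n}. fst (\<omega> j) \<le> T) \<and> T < fst (\<omega> (Suc n))"
  using AE_killed
proof eventually_elim
  case (elim \<omega>)
  then obtain j where j: "1 \<le> j \<and> fst (\<omega> j) > T" by auto
  show ?case
  proof
    assume L: "(LEAST j. j \<ge> 1 \<and> fst (\<omega> j) > T) = Suc n"
    show "(\<forall>j\<in>{1..n}. fst (\<omega> j) \<le> T) \<and> T < fst (\<omega> (Suc n))"
      using LeastI[of "\<lambda>j. j \<ge> 1 \<and> fst (\<omega> j) > T", OF j] not_less_Least[of _ "\<lambda>j. j \<ge> 1 \<and> fst (\<omega> j) > T"]
      unfolding L by (auto simp: not_less)
  next
    assume R: "(\<forall>j\<in>{1..n}. fst (\<omega> j) \<le> T) \<and> T < fst (\<omega> (Suc n))"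
    show "(LEAST j. j \<ge> 1 \<and> fst (\<omega> j) > T) = Suc n"
    proof (rule Least_equality)
      fix k assume k: "k \<ge> 1 \<and> fst (\<omega> k) > T"
      show "Suc n \<le> k"
      proof (rule ccontr)
        assume "\<not> Suc n \<le> k"
        then have "k \<in> {1..n}" using k by auto
        then show False using R k by force
      qed
    qed (use R in auto)
  qed
qed

lemma ev_box:
  assumes A: "\<And>i. i \<in> {1..n} \<Longrightarrow> simple_test (A i)"
  shows "measure Seq (ev n (Pi\<^sub>E {1..n} (\<lambda>i. tbox (A i)))) = Gf T (map A [1..<Suc n])"
proof -
  define X where "X j = (if j \<le> n then {x \<in> space \<mu>. fst x \<le> T \<and> tmem x (A j)} else {x \<in> space \<mu>. T < fst x})" for j
  have X: "X j \<in> sets \<mu>" if "j \<in> {1..Suc n}" for j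
  proof (cases "j \<le> n")
    case True
    then have "X j = {x \<in> space \<mu>. fst x \<le> T} \<inter> tbox (A j)" by (auto simp: X_def tbox_def)
    then show ?thesis using tbox_sets_\<mu>[OF A[of j]] True that by auto
  qed (simp add: X_def)
  have m: "Pi\<^sub>E {1..n} (\<lambda>i. tbox (A i)) \<in> sets (\<Pi>\<^sub>M i\<in>{1..n}. N3)"
    using A by (intro sets_PiM_I_finite tbox_measurable) (auto simp: simple_test_def)
  have "measure Seq (ev n (Pi\<^sub>E {1..n} (\<lambda>i. tbox (A i)))) = measure Seq {\<omega> \<in> space Seq. \<forall>j\<in>{1..Suc n}. \<omega> j \<in> X j}"
  proof (rule measure_eq_AE[OF _ ev_measurable[OF m]])
    show "AE \<omega> in Seq. \<omega> \<in> ev n (Pi\<^sub>E {1..n} (\<lambda>i. tbox (A i))) \<longleftrightarrow> \<omega> \<in> {\<omega> \<in> space Seq. \<forall>j\<in>{1..Suc n}. \<omega> j \<in> X j}"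
      using AE_ev_iff[of n]
    proof eventually_elim
      case (elim \<omega>)
      have "(\<forall>j\<in>{1..Suc n}. \<omega> j \<in> X j) \<longleftrightarrow> (\<forall>j\<in>{1..n}. \<omega> j \<in> X j) \<and> \<omega> (Suc n) \<in> X (Suc n)"
        by (auto simp: atLeastAtMostSuc_conv)
      also have "\<dots> \<longleftrightarrow> (\<forall>j\<in>{1..n}. fst (\<omega> j) \<le> T \<and> \<omega> j \<in> tbox (A j)) \<and> T < fst (\<omega> (Suc n))"
        by (simp add: X_def space_\<mu> tbox_def)
      finally have "(\<forall>j\<in>{1..Suc n}. \<omega> j \<in> X j) \<longleftrightarrow> (\<forall>j\<in>{1..n}. fst (\<omega> j) \<le> T \<and> \<omega> j \<in> tbox (A j)) \<and> T < fst (\<omega> (Suc n))" .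
      then show ?case unfolding ev_def mem_Collect_eq elim by (auto simp: PiE_iff)
    qed
    have "{\<omega> \<in> space Seq. \<forall>j\<in>{1..Suc n}. \<omega> j \<in> X j} = prod_emb UNIV (\<lambda>_. \<mu>) {1..Suc n} (Pi\<^sub>E {1..Suc n} X)"
      using X[THEN sets.sets_into_space] by (auto simp: prod_emb_def space_PiM PiE_iff space_\<mu>)
    also have "\<dots> \<in> sets Seq" using X by (intro sets_PiM_I) auto
    finally show "{\<omega> \<in> space Seq. \<forall>j\<in>{1..Suc n}. \<omega> j \<in> X j} \<in> sets Seq" .
  qed
  also have "\<dots> = (\<Prod>j\<in>{1..Suc n}. measure \<mu> (X j))"
    using X by (intro measure_Seq_Collect) auto
  also have "\<dots> = (\<Prod>j\<in>{1..n}. measure \<mu> (X j)) * measure \<mu> (X (Suc n))"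
    by simp
  also have "\<dots> = (\<Prod>j\<in>{1..n}. Mt (A j) T) * (1 / V T)"
    using A by (simp add: X_def test_prob prob_gt del: Mt.simps)
  also have "\<dots> = Gf T (map A [1..<Suc n])" unfolding Gf_upt by simp
  finally show ?thesis .
qed

definition smp :: "nat \<Rightarrow> (nat \<Rightarrow> real \<times> real \<times> nat) set \<Rightarrow> omega set" where
  "smp n B = {\<omega> \<in> space Om. Nsamp T \<omega> = Suc n \<and> (\<lambda>i\<in>{1..n}. sampled_triple T \<omega> i) \<in> B}"

lemma smp_measurable: "B \<in> sets (\<Pi>\<^sub>M i\<in>{1..n}. N3) \<Longrightarrow> smp n B \<in> sets Om"
  unfolding smp_def by (rule measurable_sampled_event[OF T])

lemma smp_box:
  assumes "\<And>i. i \<in> {1..n} \<Longrightarrow> simple_test (A i)"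
  shows "measure Om (smp n (Pi\<^sub>E {1..n} (\<lambda>i. tbox (A i)))) = \<theta> (root_test T) T * measure Seq (ev n (Pi\<^sub>E {1..n} (\<lambda>i. tbox (A i))))"
proof -
  have b: "fst (snd (A i)) \<in> sets borel" if "i \<in> {1..n}" for i
    using assms[OF that] by (simp add: simple_test_def)
  have e: "measure Seq (ev n (Pi\<^sub>E {1..n} (\<lambda>i. tbox (A i)))) = Gf T (map A [1..<Suc n])"
    by (rule ev_box[OF assms])
  show ?thesis unfolding e smp_def by (rule box_prob[OF T b])
qed

lemma smp_space:
  shows "measure Om (smp n (Pi\<^sub>E {1..n} (\<lambda>_. UNIV))) = \<theta> (root_test T) T * measure Seq (ev n (Pi\<^sub>E {1..n} (\<lambda>_. UNIV)))"
proof -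
  let ?S = "Pi\<^sub>E {1..n} (\<lambda>_. UNIV) :: (nat \<Rightarrow> real \<times> real \<times> nat) set"
  let ?R = "Pi\<^sub>E {1..n} (\<lambda>_. tbox (root_test T))"
  have "space (\<Pi>\<^sub>M i\<in>{1..n}. N3) = ?S" by (simp add: space_PiM space_pair_measure)
  then have S: "?S \<in> sets (\<Pi>\<^sub>M i\<in>{1..n}. N3)" by (metis sets.top)
  have R: "?R \<in> sets (\<Pi>\<^sub>M i\<in>{1..n}. N3)"
    by (intro sets_PiM_I_finite tbox_measurable) auto
  have "smp n ?S = {\<omega> \<in> space Om. Nsamp T \<omega> = Suc n}" by (auto simp: smp_def)
  then have "measure Om (smp n ?S) = measure Om (smp n ?R)"
    using event_space_prob(1)[OF T, of n] by (simp add: smp_def)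
  also have "\<dots> = \<theta> (root_test T) T * measure Seq (ev n ?R)"
    by (rule smp_box) (rule simple_root)
  also have "measure Seq (ev n ?R) = measure Seq (ev n ?S)"
  proof (rule measure_eq_AE[OF _ ev_measurable[OF R] ev_measurable[OF S]])
    show "AE \<omega> in Seq. \<omega> \<in> ev n ?R \<longleftrightarrow> \<omega> \<in> ev n ?S"
      using AE_ev_iff[of n]
    proof eventually_elim
      case (elim \<omega>)
      have "tmem x (root_test T) \<longleftrightarrow> fst x \<le> T" for x by (cases x) simp
      then show ?case unfolding ev_def mem_Collect_eq elim by (auto simp: PiE_iff tbox_def)
    qed
  qed
  finally show ?thesis .
qed

lemma smp_ev:
  assumes B: "B \<in> sets (\<Pi>\<^sub>M i\<in>{1..n}. N3)"
  shows "measure Om (smp n B) = \<theta> (root_test T) T * measure Seq (ev n B)"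
proof -
  let ?S = "Pi\<^sub>E {1..n} (\<lambda>_. UNIV) :: (nat \<Rightarrow> real \<times> real \<times> nat) set"
  let ?G = "{Pi\<^sub>E {1..n} (\<lambda>i. tbox (A i)) | A. \<forall>i\<in>{1..n}. simple_test (A i)}"
  note pb = sets_PiM_boxes[of "{1..n}", OF finite_atLeastAtMost]
  have "space (\<Pi>\<^sub>M i\<in>{1..n}. N3) = ?S" by (simp add: space_PiM space_pair_measure)
  then have S: "?S \<in> sets (\<Pi>\<^sub>M i\<in>{1..n}. N3)" by (metis sets.top)
  have "B \<in> sigma_sets ?S ?G" using B unfolding pb(1) .
  then show ?thesis
  proof (induction rule: sigma_sets_induct_disjoint[OF pb(2,3), consumes 1, case_names basic empty compl union])
    case (basic X)
    then obtain A where X: "X = Pi\<^sub>E {1..n} (\<lambda>i. tbox (A i))" and A: "\<And>i. i \<in> {1..n} \<Longrightarrow> simple_test (A i)" by blast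
    show ?case unfolding X by (rule smp_box[OF A])
  next
    case empty
    then show ?case by (simp add: smp_def ev_def)
  next
    case (compl X)
    then have X: "X \<in> sets (\<Pi>\<^sub>M i\<in>{1..n}. N3)" unfolding pb(1) by simp
    have 1: "smp n (?S - X) = smp n ?S - smp n X" by (auto simp: smp_def)
    have 2: "ev n (?S - X) = ev n ?S - ev n X" by (auto simp: ev_def)
    have "measure Om (smp n (?S - X)) = measure Om (smp n ?S) - measure Om (smp n X)"
      unfolding 1 using smp_measurable[OF S] smp_measurable[OF X]
      by (intro Om.finite_measure_Diff) (auto simp: smp_def)
    moreover have "measure Seq (ev n (?S - X)) = measure Seq (ev n ?S) - measure Seq (ev n X)"
      unfolding 2
    proof (rule Seq.P.finite_measure_Diff[OF ev_measurable[OF S] ev_measurable[OF X]])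
      have "(\<lambda>j\<in>{1..n}. \<omega> j) \<in> ?S" for \<omega> :: "nat \<Rightarrow> real \<times> real \<times> nat" by simp
      then show "ev n X \<subseteq> ev n ?S" unfolding ev_def by blast
    qed
    ultimately show ?case using smp_space[of n] compl.IH by (simp add: right_diff_distrib)
  next
    case (union X)
    then have X: "X i \<in> sets (\<Pi>\<^sub>M i\<in>{1..n}. N3)" for i unfolding pb(1) by auto
    have 1: "smp n (\<Union>i. X i) = (\<Union>i. smp n (X i))" by (auto simp: smp_def)
    have 2: "ev n (\<Union>i. X i) = (\<Union>i. ev n (X i))" by (auto simp: ev_def)
    have s1: "(\<lambda>i. measure Om (smp n (X i))) sums measure Om (smp n (\<Union>i. X i))"
      unfolding 1
    proof (rule Om.finite_measure_UNION)
      show "disjoint_family (\<lambda>i. smp n (X i))"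
        using union(1) unfolding disjoint_family_on_def smp_def by blast
    qed (use smp_measurable[OF X] in blast)
    have "(\<lambda>i. measure Seq (ev n (X i))) sums measure Seq (ev n (\<Union>i. X i))"
      unfolding 2
    proof (rule Seq.P.finite_measure_UNION)
      show "disjoint_family (\<lambda>i. ev n (X i))"
        using union(1) unfolding disjoint_family_on_def ev_def by blast
    qed (use ev_measurable[OF X] in blast)
    then have s2: "(\<lambda>i. \<theta> (root_test T) T * measure Seq (ev n (X i))) sums (\<theta> (root_test T) T * measure Seq (ev n (\<Union>i. X i)))"
      by (rule sums_mult)
    have "(\<lambda>i. measure Om (smp n (X i))) = (\<lambda>i. \<theta> (root_test T) T * measure Seq (ev n (X i)))"
      using union(3) by auto
    then show ?case using sums_unique2[OF s1] s2 by simp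
  qed
qed

lemma sampled_law:
  assumes B: "B \<in> sets (\<Pi>\<^sub>M i\<in>{1..n}. N3)"
  shows "measure Om {\<omega> \<in> space Om. Nsamp T \<omega> = Suc n \<and> (\<lambda>i\<in>{1..n}. sampled_triple T \<omega> i) \<in> B} /
      measure Om {\<omega> \<in> space Om. Nsamp T \<omega> \<ge> 1} =
    measure Seq {\<omega> \<in> space Seq. (LEAST j. j \<ge> 1 \<and> fst (\<omega> j) > T) = Suc n \<and> (\<lambda>j\<in>{1..n}. \<omega> j) \<in> B}"
proof -
  have "\<theta> (root_test T) T > 0"
    unfolding \<theta>_full[OF T] using wp_pos[OF T] V_pos[of T] f g by simp
  then show ?thesis
    unfolding nonempty_prob[OF T] using smp_ev[OF B] by (simp add: smp_def ev_def)
qed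

end

section \<open>The law of a single triple\<close>

lemma absorbed:
  assumes M: "nat_markov_process MZ" and a: "a > 0"
  shows "AE z in MZ. lifetime z \<le> ereal a \<longrightarrow> z a = 0"
proof -
  have prob: "prob_space MZ" and ev: "(\<lambda>(t, z). z t) \<in> measurable (borel \<Otimes>\<^sub>M MZ) (count_space UNIV)"
    and rc: "AE z in MZ. \<forall>t\<ge>0. \<exists>e>0. \<forall>s. t \<le> s \<and> s < t + e \<longrightarrow> z s = z t"
    using M by (auto simp: nat_markov_process_def)
  obtain p where p0: "\<And>t. t \<ge> 0 \<Longrightarrow> p t 0 0 = (1::real)"
    and pc: "\<And>ts js. sorted_wrt (<) ts \<Longrightarrow> \<forall>t\<in>set ts. 0 \<le> t \<Longrightarrow> length js = length ts \<Longrightarrow>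
      measure MZ {z \<in> space MZ. list_all2 (\<lambda>t j. z t = j) ts js} = chain_prob p 0 1 ts js"
    using M unfolding nat_markov_process_def by blast
  interpret prob_space MZ by fact
  have zt: "(\<lambda>z. z t) \<in> measurable MZ (count_space UNIV)" for t :: real
    using measurable_compose[OF _ ev, of "\<lambda>z. (t, z)" MZ] by simp
  have [measurable]: "Measurable.pred MZ (\<lambda>z. z t = k)" for t k
    using measurable_compose[OF zt, of "\<lambda>j. j = k" "count_space UNIV"] by simp
  have step: "AE z in MZ. z q = 0 \<longrightarrow> z a = 0" if q: "0 < q" "q < a" for q
  proof -
    have "measure MZ {z \<in> space MZ. z q = 0 \<and> z a = 0} = measure MZ {z \<in> space MZ. z q = 0}"
      using pc[of "[q, a]" "[0, 0]"] pc[of "[q]" "[0]"] p0[of "a - q"] q by simp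
    moreover have "measure MZ {z \<in> space MZ. z q = 0 \<and> z a \<noteq> 0} =
      measure MZ ({z \<in> space MZ. z q = 0} - {z \<in> space MZ. z q = 0 \<and> z a = 0})"
      by (rule arg_cong[where f = "measure MZ"]) auto
    moreover have "\<dots> = measure MZ {z \<in> space MZ. z q = 0} - measure MZ {z \<in> space MZ. z q = 0 \<and> z a = 0}"
      by (rule finite_measure_Diff) auto
    ultimately have "prob {z \<in> space MZ. z q = 0 \<and> z a \<noteq> 0} = 0" by simp
    moreover have "{z \<in> space MZ. z q = 0 \<and> z a \<noteq> 0} \<in> events" by measurable
    ultimately have "AE z in MZ. z \<notin> {z \<in> space MZ. z q = 0 \<and> z a \<noteq> 0}"
      by (simp only: prob_eq_0)
    then show ?thesis using AE_space by eventually_elim auto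
  qed
  have "AE z in MZ. \<forall>q\<in>\<rat>. 0 < q \<and> q < a \<longrightarrow> z q = 0 \<longrightarrow> z a = 0"
    using step by (subst AE_ball_countable[OF countable_rat]) auto
  then show ?thesis using rc
  proof eventually_elim
    case (elim z)
    show ?case
    proof
      assume L: "lifetime z \<le> ereal a"
      then have ex: "\<exists>t>0. z t = 0" by (auto simp: lifetime_def split: if_splits)
      let ?Z = "{t. t > 0 \<and> z t = 0}"
      have inf: "Inf ?Z \<le> a" using L ex by (simp add: lifetime_def)
      have ne: "?Z \<noteq> {}" using ex by auto
      have bdd: "bdd_below ?Z" by (rule bdd_belowI[of _ 0]) auto
      obtain e where e: "e > 0" "\<And>s. a \<le> s \<Longrightarrow> s < a + e \<Longrightarrow> z s = z a"
        using elim(2) a by (meson less_imp_le)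
      have "Inf ?Z < a + e" using inf e by simp
      then obtain t where t: "t > 0" "z t = 0" "t < a + e"
        using cInf_less_iff[OF ne bdd] by auto
      show "z a = 0"
      proof (cases "a \<le> t")
        case True
        then show ?thesis using e(2)[of t] t by simp
      next
        case False
        obtain e' where e': "e' > 0" "\<And>s. t \<le> s \<Longrightarrow> s < t + e' \<Longrightarrow> z s = z t"
          using elim(2) t by (meson less_imp_le)
        obtain q where q: "q \<in> \<rat>" "t < q" "q < min a (t + e')"
          using Rats_dense_in_real[of t "min a (t + e')"] False e'(1) by auto
        then have "z q = 0" using e'(2)[of q] t by simp
        then show ?thesis using elim(1) q t by auto
      qed
    qed
  qed
qed

lemma lifetime_gt_nonzero: "a > 0 \<Longrightarrow> ereal a < lifetime z \<Longrightarrow> z a \<noteq> 0"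
proof
  assume a: "a > 0" "ereal a < lifetime z" "z a = 0"
  have "Inf {t. t > 0 \<and> z t = 0} \<le> a"
    using a by (intro cInf_lower) (auto intro: bdd_belowI[of _ 0])
  then show False using a by (auto simp: lifetime_def split: if_splits)
qed

lemma ac_right_continuous:
  assumes F: "ac F F'" and t: "t \<ge> 0"
  shows "(\<lambda>n. F (t + 1 / real (Suc n))) \<longlonglongrightarrow> F t"
proof -
  have m: "(\<lambda>x. indicator {0<..s} x * F' x) \<in> borel_measurable borel" if "s \<ge> 0" for s
    using borel_measurable_integrable[OF ac_integrable[OF F that]] by simp
  have "(\<lambda>n. \<integral>x. indicator {0<..t + 1 / real (Suc n)} x * F' x \<partial>lborel) \<longlonglongrightarrow> (\<integral>x. indicator {0<..t} x * F' x \<partial>lborel)"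
  proof (rule integral_dominated_convergence[where w = "\<lambda>x. \<bar>indicator {0<..t + 1} x * F' x\<bar>"])
    show "AE x in lborel. (\<lambda>n. indicator {0<..t + 1 / real (Suc n)} x * F' x) \<longlonglongrightarrow> indicator {0<..t} x * F' x"
    proof (rule AE_I2)
      fix x :: real
      show "(\<lambda>n. indicator {0<..t + 1 / real (Suc n)} x * F' x) \<longlonglongrightarrow> indicator {0<..t} x * F' x"
      proof (cases "x \<le> t")
        case True
        then have "indicator {0<..t + 1 / real (Suc n)} x = (indicator {0<..t} x :: real)" for n
          by (auto simp: indicator_def intro: order_trans)
        then show ?thesis by simp
      next
        case False
        then have "eventually (\<lambda>n. 1 / real (Suc n) < x - t) sequentially"
          using order_tendstoD(2)[OF LIMSEQ_inverse_real_of_nat, of "x - t"] by (simp add: inverse_eq_divide)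
        then have "eventually (\<lambda>n. indicator {0<..t + 1 / real (Suc n)} x * F' x = indicator {0<..t} x * F' x) sequentially"
          by eventually_elim (use False in \<open>auto simp: indicator_def\<close>)
        then show ?thesis by (rule tendsto_eventually)
      qed
    qed
    show "AE x in lborel. norm (indicator {0<..t + 1 / real (Suc n)} x * F' x) \<le> \<bar>indicator {0<..t + 1} x * F' x\<bar>" for n
    proof (rule AE_I2)
      fix x
      have "1 / real (Suc n) \<le> 1" by simp
      then have "x \<le> t + 1" if "x \<le> t + 1 / real (Suc n)" using that by linarith
      then show "norm (indicator {0<..t + 1 / real (Suc n)} x * F' x) \<le> \<bar>indicator {0<..t + 1} x * F' x\<bar>"
        by (auto simp: indicator_def simp del: of_nat_Suc)
    qed
    show "integrable lborel (\<lambda>x. \<bar>indicator {0<..t + 1} x * F' x\<bar>)"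
      using ac_integrable[OF F, of "t + 1"] t by simp
  qed (use m t in \<open>auto simp del: of_nat_Suc\<close>)
  then have "(\<lambda>n. F (t + 1 / real (Suc n)) - F 0) \<longlonglongrightarrow> F t - F 0"
    using t by (simp add: ac_integral[OF F] del: of_nat_Suc)
  from tendsto_add[OF this tendsto_const[of "F 0"]] show ?thesis by simp
qed

locale triple_law = genus_scale g f MZ v W for g f MZ v W +
  fixes \<mu> :: "(real \<times> real \<times> nat) measure"
  assumes markov: "nat_markov_process MZ" and law: "HAS_law g f MZ W \<mu>"
begin

definition et :: "real \<Rightarrow> real" where "et a = exp (- malthus g MZ * a)"

lemma et_pos: "et a > 0" by (simp add: et_def)

lemma et_measurable [measurable]: "et \<in> borel_measurable borel"
  unfolding et_def[abs_def] by measurable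

sublocale \<mu>: prob_space \<mu>
  using law by (simp add: HAS_law_def)

lemma sets_\<mu>: "sets \<mu> = sets (borel \<Otimes>\<^sub>M borel \<Otimes>\<^sub>M count_space UNIV)"
  using law by (simp add: HAS_law_def)

lemma space_\<mu>: "space \<mu> = UNIV"
  using sets_eq_imp_space_eq[OF sets_\<mu>] by (simp add: space_pair_measure)

lemma measurable_components [measurable]:
  "fst \<in> borel_measurable \<mu>" "(\<lambda>x. fst (snd x)) \<in> borel_measurable \<mu>" "(\<lambda>x. snd (snd x)) \<in> measurable \<mu> (count_space UNIV)"
proof -
  show "fst \<in> borel_measurable \<mu>" "(\<lambda>x. fst (snd x)) \<in> borel_measurable \<mu>"
    "(\<lambda>x. snd (snd x)) \<in> measurable \<mu> (count_space UNIV)"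
    unfolding measurable_cong_sets[OF sets_\<mu> refl] by measurable
qed

lemma pred_S [measurable]: "Measurable.pred \<mu> (\<lambda>x. snd (snd x) \<in> K)"
  using measurable_compose[OF measurable_components(3), of "\<lambda>k. k \<in> K" "count_space UNIV"] by simp

lemma pz_PZ: "a > 0 \<Longrightarrow> k \<ge> 1 \<Longrightarrow> pz a {k} = PZ MZ a k"
proof -
  assume a: "a > 0" and k: "k \<ge> 1"
  have [measurable]: "Measurable.pred MZ (\<lambda>z. z a \<in> {k})" by (rule pred_eval)
  have "AE z in MZ. ereal a < lifetime z \<and> z a \<in> {k} \<longleftrightarrow> z a = k"
    using absorbed[OF markov a] by eventually_elim (use k in \<open>auto simp: not_less[symmetric]\<close>)
  then have "AE z in MZ. z \<in> {z \<in> space MZ. ereal a < lifetime z \<and> z a \<in> {k}} \<longleftrightarrow> z \<in> {z \<in> space MZ. z a = k}"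
    by eventually_elim auto
  moreover have "{z \<in> space MZ. ereal a < lifetime z \<and> z a \<in> {k}} \<in> sets MZ" by measurable
  moreover have "{z \<in> space MZ. z a \<in> {k}} \<in> sets MZ" by measurable
  then have "{z \<in> space MZ. z a = k} \<in> sets MZ" by simp
  ultimately show ?thesis
    unfolding pz_def PZ_def by (rule measure_eq_AE)
qed

lemma pz_0: "a > 0 \<Longrightarrow> pz a {0} = 0"
proof -
  assume a: "a > 0"
  have "{z \<in> space MZ. ereal a < lifetime z \<and> z a \<in> {0}} = {}"
    using lifetime_gt_nonzero[OF a] by auto
  then show ?thesis unfolding pz_def by (simp only: measure_empty)
qed

lemma pz_sums: "a > 0 \<Longrightarrow> (\<lambda>k. pz a {Suc k}) sums PL MZ a"
proof -
  assume a: "a > 0"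
  have [measurable]: "Measurable.pred MZ (\<lambda>z. z a \<in> K)" for K by (rule pred_eval)
  have "(\<lambda>k. measure MZ {z \<in> space MZ. ereal a < lifetime z \<and> z a \<in> {Suc k}}) sums
    measure MZ (\<Union>k. {z \<in> space MZ. ereal a < lifetime z \<and> z a \<in> {Suc k}})"
  proof (rule MZ.finite_measure_UNION)
    show "range (\<lambda>k. {z \<in> space MZ. ereal a < lifetime z \<and> z a \<in> {Suc k}}) \<subseteq> sets MZ"
      by (intro image_subsetI) measurable
  qed (auto simp: disjoint_family_on_def)
  moreover have "(\<Union>k. {z \<in> space MZ. ereal a < lifetime z \<and> z a \<in> {Suc k}}) = {z \<in> space MZ. ereal a < lifetime z}"
  proof (intro set_eqI iffI)
    fix z assume z: "z \<in> {z \<in> space MZ. ereal a < lifetime z}"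
    then obtain k where "z a = Suc k" using lifetime_gt_nonzero[OF a, of z] not0_implies_Suc by auto
    then show "z \<in> (\<Union>k. {z \<in> space MZ. ereal a < lifetime z \<and> z a \<in> {Suc k}})" using z by auto
  qed auto
  ultimately show ?thesis by (simp add: pz_def PL_def)
qed

definition dA :: "real \<Rightarrow> real" where
  "dA a = indicator {0<..} a * g * et a * PL MZ a"

lemma dA_nonneg: "dA a \<ge> 0"
  using g et_pos[of a] PL_bounds[of a] by (simp add: dA_def)

lemma dA_measurable [measurable]: "dA \<in> borel_measurable borel"
  unfolding dA_def[abs_def] by measurable

lemma distr_A: "distr \<mu> borel (\<lambda>x. fst (snd x)) = density lborel (\<lambda>a. ennreal (dA a))"
proof -
  have "distr \<mu> lborel (\<lambda>x. fst (snd x)) = density lborel (\<lambda>a. ennreal (dA a))"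
    using law unfolding HAS_law_def dA_def et_def by (elim conjE) assumption
  moreover have "distr \<mu> lborel (\<lambda>x. fst (snd x)) = distr \<mu> borel (\<lambda>x. fst (snd x))"
    by (intro distr_cong) auto
  ultimately show ?thesis by simp
qed

lemma integral_A:
  fixes \<phi> :: "real \<Rightarrow> real"
  assumes [measurable]: "\<phi> \<in> borel_measurable borel"
  shows "(\<integral>x. \<phi> (fst (snd x)) \<partial>\<mu>) = (\<integral>a. dA a * \<phi> a \<partial>lborel)"
proof -
  have "(\<integral>x. \<phi> (fst (snd x)) \<partial>\<mu>) = (\<integral>a. \<phi> a \<partial>distr \<mu> borel (\<lambda>x. fst (snd x)))"
    by (rule integral_distr[symmetric]) auto
  also have "\<dots> = (\<integral>a. dA a *\<^sub>R \<phi> a \<partial>lborel)"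
    unfolding distr_A by (rule integral_density) (auto simp: dA_nonneg)
  finally show ?thesis by simp
qed

lemma dA_integrable: "integrable lborel dA" and dA_integral: "(\<integral>a. dA a \<partial>lborel) = 1"
proof -
  have "(\<integral>\<^sup>+a. ennreal (dA a) \<partial>lborel) = emeasure (distr \<mu> borel (\<lambda>x. fst (snd x))) UNIV"
    unfolding distr_A by (simp add: emeasure_density)
  also have "\<dots> = 1" by (subst emeasure_distr) (auto simp: space_\<mu>[symmetric] \<mu>.emeasure_space_1)
  finally have n: "(\<integral>\<^sup>+a. ennreal (dA a) \<partial>lborel) = 1" .
  then show "integrable lborel dA" by (intro integrableI_nonneg) (auto simp: dA_nonneg)
  show "(\<integral>a. dA a \<partial>lborel) = 1" using n by (subst integral_eq_nn_integral) (auto simp: dA_nonneg)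
qed

definition kap :: "nat set \<Rightarrow> real \<Rightarrow> real" where
  "kap K a = pz a K / PL MZ a"

lemma kap_measurable [measurable]: "kap K \<in> borel_measurable borel"
  unfolding kap_def[abs_def] by measurable

lemma kap_bounds: "0 \<le> kap K a" "kap K a \<le> 1"
  using pz_bounds[of a K] PL_bounds[of a] by (auto simp: kap_def divide_le_eq_1)

lemma PL_kap: "PL MZ a * kap K a = pz a K"
  using pz_bounds[of a K] by (auto simp: kap_def)

lemma joint_AS_single:
  assumes D: "D \<in> sets borel" and k: "k \<ge> 1"
  shows "measure \<mu> {x \<in> space \<mu>. snd (snd x) \<in> {k} \<and> fst (snd x) \<in> D} = (\<integral>a. dA a * (indicator D a * kap {k} a) \<partial>lborel)"
proof -
  have "measure \<mu> {x \<in> space \<mu>. snd (snd x) \<in> {k} \<and> fst (snd x) \<in> D} =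
    (LINT a:D \<inter> {0<..}|lborel. g * PZ MZ a k * exp (- malthus g MZ * a))"
  proof -
    have "\<forall>k D. k \<ge> 1 \<longrightarrow> D \<in> sets borel \<longrightarrow> measure \<mu> {x \<in> space \<mu>. snd (snd x) = k \<and> fst (snd x) \<in> D} =
      (LINT a:D \<inter> {0<..}|lborel. g * PZ MZ a k * exp (- malthus g MZ * a))"
      using law unfolding HAS_law_def by (elim conjE) assumption
    then have "measure \<mu> {x \<in> space \<mu>. snd (snd x) = k \<and> fst (snd x) \<in> D} =
      (LINT a:D \<inter> {0<..}|lborel. g * PZ MZ a k * exp (- malthus g MZ * a))"
      using D k by blast
    then show ?thesis by simp
  qed
  also have "\<dots> = (\<integral>a. dA a * (indicator D a * kap {k} a) \<partial>lborel)"
    unfolding set_lebesgue_integral_def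
  proof (intro Bochner_Integration.integral_cong refl)
    fix a
    show "indicator (D \<inter> {0<..}) a *\<^sub>R (g * PZ MZ a k * exp (- malthus g MZ * a)) = dA a * (indicator D a * kap {k} a)"
      using pz_PZ[OF _ k, of a] PL_kap[of a "{k}"] by (auto simp: dA_def et_def indicator_def mult_ac)
  qed
  finally show ?thesis .
qed

lemma S_pos: "measure \<mu> {x \<in> space \<mu>. snd (snd x) = 0} = 0"
proof -
  have ik: "integrable lborel (\<lambda>a. dA a * kap {k} a)" for k
    using kap_bounds by (intro integrable_mult_bounded[OF dA_integrable, where B = 1]) auto
  have "(\<lambda>n. \<integral>a. (\<Sum>k<n. dA a * kap {Suc k} a) \<partial>lborel) \<longlonglongrightarrow> (\<integral>a. dA a \<partial>lborel)"
  proof (rule integral_dominated_convergence[where w = dA])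
    have s: "(\<lambda>k. dA a * kap {Suc k} a) sums dA a" for a
    proof (cases "a > 0")
      case True
      from sums_mult[OF pz_sums[OF True], of "g * et a"]
      have "(\<lambda>k. g * et a * pz a {Suc k}) sums dA a" using True by (simp add: dA_def)
      moreover have "dA a * kap {Suc k} a = g * et a * pz a {Suc k}" for k
        using True PL_kap[of a "{Suc k}"] by (simp add: dA_def mult_ac)
      ultimately show ?thesis by simp
    qed (simp add: dA_def)
    then show "AE a in lborel. (\<lambda>n. \<Sum>k<n. dA a * kap {Suc k} a) \<longlonglongrightarrow> dA a" by (simp add: sums_def)
    show "AE a in lborel. norm (\<Sum>k<n. dA a * kap {Suc k} a) \<le> dA a" for n
    proof (rule AE_I2)
      fix a
      have nn: "0 \<le> dA a * kap {Suc k} a" for k using dA_nonneg kap_bounds by simp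
      have "(\<Sum>k<n. dA a * kap {Suc k} a) \<le> (\<Sum>k. dA a * kap {Suc k} a)"
        using s[of a] nn by (intro sum_le_suminf) (auto simp: sums_iff)
      then show "norm (\<Sum>k<n. dA a * kap {Suc k} a) \<le> dA a"
        using s[of a] nn by (simp add: sums_iff abs_of_nonneg sum_nonneg)
    qed
  qed (use dA_integrable in auto)
  moreover have "(\<integral>a. (\<Sum>k<n. dA a * kap {Suc k} a) \<partial>lborel) \<le> measure \<mu> {x \<in> space \<mu>. snd (snd x) \<noteq> 0}" for n
  proof -
    have "(\<integral>a. (\<Sum>k<n. dA a * kap {Suc k} a) \<partial>lborel) = (\<Sum>k<n. \<integral>a. dA a * kap {Suc k} a \<partial>lborel)"
      using ik by (intro Bochner_Integration.integral_sum) auto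
    also have "\<dots> = (\<Sum>k<n. measure \<mu> {x \<in> space \<mu>. snd (snd x) \<in> {Suc k}})"
      using joint_AS_single[of UNIV] by (intro sum.cong) auto
    also have "\<dots> = measure \<mu> (\<Union>k<n. {x \<in> space \<mu>. snd (snd x) \<in> {Suc k}})"
      by (rule \<mu>.finite_measure_finite_Union[symmetric]) (auto simp: disjoint_family_on_def)
    also have "\<dots> \<le> measure \<mu> {x \<in> space \<mu>. snd (snd x) \<noteq> 0}"
    proof (rule \<mu>.finite_measure_mono)
      have "{x \<in> space \<mu>. snd (snd x) \<noteq> 0} = {x \<in> space \<mu>. snd (snd x) \<in> - {0}}" by auto
      also have "\<dots> \<in> sets \<mu>" by measurable
      finally show "{x \<in> space \<mu>. snd (snd x) \<noteq> 0} \<in> sets \<mu>" .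
    qed auto
    finally show ?thesis .
  qed
  ultimately have 1: "1 \<le> measure \<mu> {x \<in> space \<mu>. snd (snd x) \<noteq> 0}"
    unfolding dA_integral by (intro LIMSEQ_le_const2) auto
  have m: "{x \<in> space \<mu>. snd (snd x) \<in> {0}} \<in> sets \<mu>" by measurable
  have "{x \<in> space \<mu>. snd (snd x) \<noteq> 0} = space \<mu> - {x \<in> space \<mu>. snd (snd x) \<in> {0}}" by auto
  then have "measure \<mu> {x \<in> space \<mu>. snd (snd x) \<noteq> 0} = 1 - measure \<mu> {x \<in> space \<mu>. snd (snd x) \<in> {0}}"
    using \<mu>.prob_compl[OF m] by simp
  then have "measure \<mu> {x \<in> space \<mu>. snd (snd x) \<in> {0}} \<le> 0" using 1 by simp
  then show ?thesis by (simp add: measure_le_0_iff)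
qed

lemma joint_AS:
  assumes D[measurable]: "D \<in> sets borel" and K: "K = {} \<or> K = UNIV \<or> (\<exists>k. K = {k})"
  shows "measure \<mu> {x \<in> space \<mu>. snd (snd x) \<in> K \<and> fst (snd x) \<in> D} = (\<integral>a. dA a * (indicator D a * kap K a) \<partial>lborel)"
  using K
proof (elim disjE exE)
  assume "K = {}"
  then show ?thesis by (simp add: kap_def pz_def)
next
  assume KU: "K = UNIV"
  have "measure \<mu> {x \<in> space \<mu>. fst (snd x) \<in> D} = (\<integral>x. indicator D (fst (snd x)) \<partial>\<mu>)"
  proof -
    have "(\<integral>x. indicator D (fst (snd x)) \<partial>\<mu>) = (\<integral>x. indicator {x \<in> space \<mu>. fst (snd x) \<in> D} x \<partial>\<mu> :: real)"
      by (intro Bochner_Integration.integral_cong) (auto simp: indicator_def)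
    also have "\<dots> = measure \<mu> ({x \<in> space \<mu>. fst (snd x) \<in> D} \<inter> space \<mu>)"
      by (rule Bochner_Integration.integral_indicator)
    also have "{x \<in> space \<mu>. fst (snd x) \<in> D} \<inter> space \<mu> = {x \<in> space \<mu>. fst (snd x) \<in> D}" by auto
    finally show ?thesis by simp
  qed
  also have "\<dots> = (\<integral>a. dA a * indicator D a \<partial>lborel)" by (rule integral_A) auto
  also have "\<dots> = (\<integral>a. dA a * (indicator D a * kap K a) \<partial>lborel)"
    by (intro Bochner_Integration.integral_cong) (auto simp: KU kap_def pz_UNIV dA_def)
  finally show ?thesis by (simp add: KU)
next
  fix k assume Kk: "K = {k}"
  show ?thesis
  proof (cases "k \<ge> 1")
    case True
    then show ?thesis using joint_AS_single[OF D] Kk by simp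
  next
    case False
    have "measure \<mu> {x \<in> space \<mu>. snd (snd x) \<in> K \<and> fst (snd x) \<in> D} \<le> measure \<mu> {x \<in> space \<mu>. snd (snd x) \<in> {0}}"
      using False Kk by (intro \<mu>.finite_measure_mono) auto
    then have "measure \<mu> {x \<in> space \<mu>. snd (snd x) \<in> K \<and> fst (snd x) \<in> D} = 0"
      using S_pos by (simp add: measure_le_0_iff)
    moreover have "(\<lambda>a. dA a * (indicator D a * kap K a)) = (\<lambda>a. 0)"
    proof
      fix a show "dA a * (indicator D a * kap K a) = 0"
        using False Kk pz_0[of a] by (cases "a > 0") (auto simp: dA_def kap_def)
    qed
    ultimately show ?thesis by simp
  qed
qed

definition FA :: "(real \<times> real \<times> nat) measure" where
  "FA = vimage_algebra (space \<mu>) (\<lambda>y. fst (snd y)) borel"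

lemma sets_FA: "sets FA = {(\<lambda>y. fst (snd y)) -` D \<inter> space \<mu> | D. D \<in> sets borel}"
  unfolding FA_def by (rule sets_vimage_algebra2) simp

lemma subalgebra_FA: "subalgebra \<mu> FA"
  unfolding subalgebra_def
proof
  show "space FA = space \<mu>" by (simp add: FA_def)
  show "sets FA \<subseteq> sets \<mu>"
    unfolding sets_FA using measurable_sets[OF measurable_components(2)] by blast
qed

sublocale FA: finite_measure_subalgebra \<mu> FA
  by unfold_locales (rule subalgebra_FA)

lemma measurable_A_FA: "(\<lambda>y. fst (snd y)) \<in> borel_measurable FA"
  unfolding FA_def by (rule measurable_vimage_algebra1) simp

lemma FA_set:
  assumes "X \<in> sets FA"
  obtains D where "D \<in> sets borel" "X = {x \<in> space \<mu>. fst (snd x) \<in> D}"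
proof -
  obtain D where "D \<in> sets borel" "X = (\<lambda>y. fst (snd y)) -` D \<inter> space \<mu>" using assms unfolding sets_FA by blast
  then show ?thesis using that[of D] by (auto simp: vimage_def Int_def conj_commute)
qed

lemma integrable_indicator_comp:
  "h \<in> borel_measurable \<mu> \<Longrightarrow> (\<And>x. \<bar>h x\<bar> \<le> 1) \<Longrightarrow> integrable \<mu> (h :: _ \<Rightarrow> real)"
  by (rule \<mu>.integrable_const_bound[where B = 1]) auto

lemma cond_S:
  assumes K: "K = {} \<or> K = UNIV \<or> (\<exists>k. K = {k})"
  shows "AE x in \<mu>. real_cond_exp \<mu> FA (\<lambda>y. indicator K (snd (snd y))) x = kap K (fst (snd x))"
proof (rule FA.real_cond_exp_charact)
  show "integrable \<mu> (\<lambda>y. indicator K (snd (snd y)) :: real)"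
    by (rule integrable_indicator_comp) (auto simp: indicator_def)
  show "integrable \<mu> (\<lambda>x. kap K (fst (snd x)))"
    using kap_bounds by (intro integrable_indicator_comp) auto
  show "(\<lambda>x. kap K (fst (snd x))) \<in> borel_measurable FA"
    by (rule measurable_compose[OF measurable_A_FA kap_measurable])
  fix X assume "X \<in> sets FA"
  then obtain D where D[measurable]: "D \<in> sets borel" and X: "X = {x \<in> space \<mu>. fst (snd x) \<in> D}" by (rule FA_set)
  have "(\<integral>x\<in>X. indicator K (snd (snd x)) \<partial>\<mu>) = (\<integral>x. indicator {x \<in> space \<mu>. snd (snd x) \<in> K \<and> fst (snd x) \<in> D} x \<partial>\<mu> :: real)"
    unfolding set_lebesgue_integral_def X by (intro Bochner_Integration.integral_cong) (auto simp: indicator_def)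
  also have "\<dots> = measure \<mu> ({x \<in> space \<mu>. snd (snd x) \<in> K \<and> fst (snd x) \<in> D} \<inter> space \<mu>)"
    by (rule Bochner_Integration.integral_indicator)
  also have "{x \<in> space \<mu>. snd (snd x) \<in> K \<and> fst (snd x) \<in> D} \<inter> space \<mu> = {x \<in> space \<mu>. snd (snd x) \<in> K \<and> fst (snd x) \<in> D}"
    by auto
  also have "measure \<mu> {x \<in> space \<mu>. snd (snd x) \<in> K \<and> fst (snd x) \<in> D} = (\<integral>a. dA a * (indicator D a * kap K a) \<partial>lborel)"
    by (rule joint_AS[OF D K])
  also have "\<dots> = (\<integral>x. indicator D (fst (snd x)) * kap K (fst (snd x)) \<partial>\<mu>)"
    by (rule integral_A[symmetric]) measurable
  also have "\<dots> = (\<integral>x\<in>X. kap K (fst (snd x)) \<partial>\<mu>)"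
    unfolding set_lebesgue_integral_def X by (intro Bochner_Integration.integral_cong) (auto simp: indicator_def)
  finally show "(\<integral>x\<in>X. indicator K (snd (snd x)) \<partial>\<mu>) = (\<integral>x\<in>X. kap K (fst (snd x)) \<partial>\<mu>)" .
qed

lemma joint_HAS:
  assumes K: "K = {} \<or> K = UNIV \<or> (\<exists>k. K = {k})" and D[measurable]: "D \<in> sets borel"
  shows "measure \<mu> {x \<in> space \<mu>. fst x < h \<and> fst (snd x) \<in> D \<and> snd (snd x) \<in> K} =
    (\<integral>x. indicator {..<h} (fst x) * (indicator D (fst (snd x)) * kap K (fst (snd x))) \<partial>\<mu>)"
proof -
  let ?X = "\<lambda>y. indicator {..<h} (fst y) :: real" and ?Y = "\<lambda>y. indicator K (snd (snd y)) :: real"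
  let ?D = "{x \<in> space \<mu>. fst (snd x) \<in> D}"
  have "?D = (\<lambda>y. fst (snd y)) -` D \<inter> space \<mu>" by auto
  then have DF: "?D \<in> sets FA" unfolding sets_FA using D by blast
  have XY: "integrable \<mu> (\<lambda>y. ?X y * ?Y y)"
    by (rule integrable_indicator_comp) (auto simp: indicator_def)
  have Xi: "integrable \<mu> ?X" by (rule integrable_indicator_comp) (auto simp: indicator_def)
  have kX: "integrable \<mu> (\<lambda>y. kap K (fst (snd y)) * ?X y)"
    using kap_bounds by (intro integrable_indicator_comp) (auto simp: indicator_def)
  have ci: "\<forall>B C. B \<in> sets borel \<longrightarrow>
        (AE x in \<mu>.
          real_cond_exp \<mu> (vimage_algebra (space \<mu>) (\<lambda>y. fst (snd y)) borel)
             (\<lambda>y. indicator B (fst y) * indicator C (snd (snd y))) x =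
          real_cond_exp \<mu> (vimage_algebra (space \<mu>) (\<lambda>y. fst (snd y)) borel) (\<lambda>y. indicator B (fst y)) x *
          real_cond_exp \<mu> (vimage_algebra (space \<mu>) (\<lambda>y. fst (snd y)) borel) (\<lambda>y. indicator C (snd (snd y))) x)"
    using law unfolding HAS_law_def by (elim conjE) assumption
  have "{..<h} \<in> sets borel" by simp
  with ci have b: "AE x in \<mu>. real_cond_exp \<mu> FA (\<lambda>y. ?X y * ?Y y) x = real_cond_exp \<mu> FA ?X x * real_cond_exp \<mu> FA ?Y x"
    unfolding FA_def by blast
  have m: "AE x in \<mu>. real_cond_exp \<mu> FA (\<lambda>y. kap K (fst (snd y)) * ?X y) x = kap K (fst (snd x)) * real_cond_exp \<mu> FA ?X x"
    by (rule FA.real_cond_exp_mult[OF measurable_compose[OF measurable_A_FA kap_measurable] _ kX]) measurable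
  have "measure \<mu> {x \<in> space \<mu>. fst x < h \<and> fst (snd x) \<in> D \<and> snd (snd x) \<in> K} = (\<integral>x\<in>?D. ?X x * ?Y x \<partial>\<mu>)"
  proof -
    have "(\<integral>x\<in>?D. ?X x * ?Y x \<partial>\<mu>) = (\<integral>x. indicator {x \<in> space \<mu>. fst x < h \<and> fst (snd x) \<in> D \<and> snd (snd x) \<in> K} x \<partial>\<mu> :: real)"
      unfolding set_lebesgue_integral_def by (intro Bochner_Integration.integral_cong) (auto simp: indicator_def)
    also have "\<dots> = measure \<mu> ({x \<in> space \<mu>. fst x < h \<and> fst (snd x) \<in> D \<and> snd (snd x) \<in> K} \<inter> space \<mu>)"
      by (rule Bochner_Integration.integral_indicator)
    also have "{x \<in> space \<mu>. fst x < h \<and> fst (snd x) \<in> D \<and> snd (snd x) \<in> K} \<inter> space \<mu> = {x \<in> space \<mu>. fst x < h \<and> fst (snd x) \<in> D \<and> snd (snd x) \<in> K}"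
      by auto
    finally show ?thesis by simp
  qed
  also have "\<dots> = (\<integral>x\<in>?D. real_cond_exp \<mu> FA (\<lambda>y. ?X y * ?Y y) x \<partial>\<mu>)"
    by (rule FA.real_cond_exp_intA[OF XY DF])
  also have "\<dots> = (\<integral>x\<in>?D. real_cond_exp \<mu> FA (\<lambda>y. kap K (fst (snd y)) * ?X y) x \<partial>\<mu>)"
    unfolding set_lebesgue_integral_def
  proof (rule integral_cong_AE)
    show "AE x in \<mu>. indicator ?D x *\<^sub>R real_cond_exp \<mu> FA (\<lambda>y. ?X y * ?Y y) x =
      indicator ?D x *\<^sub>R real_cond_exp \<mu> FA (\<lambda>y. kap K (fst (snd y)) * ?X y) x"
      using b m cond_S[OF K] by eventually_elim simp
  qed measurable
  also have "\<dots> = (\<integral>x\<in>?D. kap K (fst (snd x)) * ?X x \<partial>\<mu>)"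
    by (rule FA.real_cond_exp_intA[OF kX DF, symmetric])
  also have "\<dots> = (\<integral>x. ?X x * (indicator D (fst (snd x)) * kap K (fst (snd x))) \<partial>\<mu>)"
    unfolding set_lebesgue_integral_def by (intro Bochner_Integration.integral_cong) (auto simp: indicator_def)
  finally show ?thesis .
qed

definition dH :: "real \<Rightarrow> real \<Rightarrow> real" where
  "dH h a = indicator {0<..<h} a * (f * Wp (h - a) / V h * g * PL MZ a)"

lemma dH_measurable [measurable]: "dH h \<in> borel_measurable borel"
  unfolding dH_def[abs_def] by measurable

lemma dH_nonneg: "dH h a \<ge> 0"
  using f g V_pos[of h] Wp_nonneg[of "h - a"] PL_bounds[of a] by (simp add: dH_def)

lemma dH_integrable: "integrable lborel (dH h)"
proof -
  have "integrable lborel (\<lambda>a. indicator {0<..h} a * dH h a)"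
  proof (rule integrable_bounded_interval[OF dH_measurable, where B = "W0 h * g"])
    fix a :: real assume a: "0 < a" "a \<le> h"
    have "f * Wp (h - a) / V h \<le> 1 * W0 h / 1"
      using f Wp_le[of "h - a" h] Wp_nonneg[of "h - a"] W0_ge_1[of h] V_ge_1[of h] a by (intro frac_le mult_mono) auto
    then have "f * Wp (h - a) / V h * g * PL MZ a \<le> W0 h * g * 1"
      using g PL_bounds[of a] W0_ge_1[of h] f Wp_nonneg[of "h - a"] V_pos[of h] by (intro mult_mono) auto
    moreover have "0 \<le> W0 h * g" using g W0_ge_1[of h] by simp
    ultimately show "\<bar>dH h a\<bar> \<le> W0 h * g"
      using dH_nonneg[of h a] by (auto simp: dH_def indicator_def)
  qed
  moreover have "(\<lambda>a. indicator {0<..h} a * dH h a) = dH h" by (auto simp: dH_def indicator_def)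
  ultimately show ?thesis by simp
qed

lemma joint_HA:
  assumes h: "h > 0" and D: "D \<in> sets borel"
  shows "measure \<mu> {x \<in> space \<mu>. fst x < h \<and> fst (snd x) \<in> D} = (\<integral>a. dH h a * indicator D a \<partial>lborel)"
proof -
  have c: "\<forall>h D. D \<in> sets borel \<longrightarrow> measure \<mu> {x \<in> space \<mu>. fst x < h \<and> fst (snd x) \<in> D} =
          (LINT a:D \<inter> {0<..<h}|lborel. f * W (h - a) / Wf f W h * g * PL MZ a)"
    using law unfolding HAS_law_def by (elim conjE) assumption
  have "measure \<mu> {x \<in> space \<mu>. fst x < h \<and> fst (snd x) \<in> D} = (LINT a:D \<inter> {0<..<h}|lborel. f * W (h - a) / Wf f W h * g * PL MZ a)"
    using c D by blast
  also have "\<dots> = (\<integral>a. dH h a * indicator D a \<partial>lborel)"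
    unfolding set_lebesgue_integral_def using h
    by (intro Bochner_Integration.integral_cong) (auto simp: dH_def indicator_def Wp_def V_eq_Wf)
  finally show ?thesis .
qed

lemma integral_HA:
  fixes \<phi> :: "real \<Rightarrow> real"
  assumes h: "h > 0" and [measurable]: "\<phi> \<in> borel_measurable borel"
  shows "(\<integral>x. indicator {..<h} (fst x) * \<phi> (fst (snd x)) \<partial>\<mu>) = (\<integral>a. dH h a * \<phi> a \<partial>lborel)"
proof -
  let ?d = "density \<mu> (\<lambda>x. ennreal (indicator {..<h} (fst x)))"
  have eq: "distr ?d borel (\<lambda>x. fst (snd x)) = density lborel (\<lambda>a. ennreal (dH h a))"
  proof (rule measure_eqI)
    fix D assume "D \<in> sets (distr ?d borel (\<lambda>x. fst (snd x)))"
    then have D[measurable]: "D \<in> sets borel" by simp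
    have "(\<lambda>x. fst (snd x)) -` D \<inter> space ?d = {x \<in> space \<mu>. fst (snd x) \<in> D}" by auto
    then have "emeasure (distr ?d borel (\<lambda>x. fst (snd x))) D = emeasure ?d {x \<in> space \<mu>. fst (snd x) \<in> D}"
      by (subst emeasure_distr) auto
    also have "\<dots> = (\<integral>\<^sup>+x. ennreal (indicator {..<h} (fst x)) * indicator {x \<in> space \<mu>. fst (snd x) \<in> D} x \<partial>\<mu>)"
      by (rule emeasure_density) measurable
    also have "\<dots> = (\<integral>\<^sup>+x. indicator {x \<in> space \<mu>. fst x < h \<and> fst (snd x) \<in> D} x \<partial>\<mu>)"
      by (intro nn_integral_cong) (auto simp: indicator_def)
    also have "\<dots> = emeasure \<mu> {x \<in> space \<mu>. fst x < h \<and> fst (snd x) \<in> D}"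
      by (rule nn_integral_indicator) measurable
    also have "\<dots> = ennreal (\<integral>a. dH h a * indicator D a \<partial>lborel)"
      using joint_HA[OF h D] by (simp add: \<mu>.emeasure_eq_measure)
    also have "\<dots> = (\<integral>\<^sup>+a. ennreal (dH h a * indicator D a) \<partial>lborel)"
      using dH_nonneg by (intro nn_integral_eq_integral[symmetric] integrable_mult_bounded[OF dH_integrable, where B = 1])
        (auto simp: indicator_def)
    also have "\<dots> = (\<integral>\<^sup>+a. ennreal (dH h a) * indicator D a \<partial>lborel)"
      by (intro nn_integral_cong) (auto simp: indicator_def)
    also have "\<dots> = emeasure (density lborel (\<lambda>a. ennreal (dH h a))) D"
      by (rule emeasure_density[symmetric]) auto
    finally show "emeasure (distr ?d borel (\<lambda>x. fst (snd x))) D = emeasure (density lborel (\<lambda>a. ennreal (dH h a))) D" .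
  qed simp
  have "(\<integral>x. indicator {..<h} (fst x) * \<phi> (fst (snd x)) \<partial>\<mu>) = (\<integral>x. \<phi> (fst (snd x)) \<partial>?d)"
    by (subst integral_density) (auto simp: indicator_def)
  also have "\<dots> = (\<integral>a. \<phi> a \<partial>distr ?d borel (\<lambda>x. fst (snd x)))"
    by (rule integral_distr[symmetric]) auto
  also have "\<dots> = (\<integral>a. dH h a *\<^sub>R \<phi> a \<partial>lborel)"
    unfolding eq by (rule integral_density) (auto simp: dH_nonneg)
  finally show ?thesis by simp
qed

lemma prob_H_less:
  assumes h: "h > 0" and A: "simple_test (h, D, K)"
  shows "measure \<mu> {x \<in> space \<mu>. fst x < h \<and> fst (snd x) \<in> D \<and> snd (snd x) \<in> K} = Mt (h, D, K) h"
proof -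
  have D[measurable]: "D \<in> sets borel" and K: "K = {} \<or> K = UNIV \<or> (\<exists>k. K = {k})"
    using A by (auto simp: simple_test_def)
  note p = sub_density_pd[OF D, of K]
  note [measurable] = sub_densityD(1)[OF p]
  have "measure \<mu> {x \<in> space \<mu>. fst x < h \<and> fst (snd x) \<in> D \<and> snd (snd x) \<in> K} =
    (\<integral>a. dH h a * (indicator D a * kap K a) \<partial>lborel)"
    unfolding joint_HAS[OF K D] by (rule integral_HA[OF h]) measurable
  also have "\<dots> = (\<integral>a. (f * g / V h) * (pd D K a * Wp (h - a)) \<partial>lborel)"
  proof (rule integral_cong_AE)
    have "AE a in lborel. a \<noteq> h" by (rule AE_lborel_singleton)
    then show "AE a in lborel. dH h a * (indicator D a * kap K a) = (f * g / V h) * (pd D K a * Wp (h - a))"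
    proof eventually_elim
      case (elim a)
      show ?case
      proof (cases "0 < a \<and> a < h")
        case True
        then have "dH h a * (indicator D a * kap K a) = f * Wp (h - a) / V h * g * (indicator D a * (PL MZ a * kap K a))"
          by (simp add: dH_def)
        then show ?thesis using True unfolding PL_kap by (simp add: pd_def mult_ac)
      next
        case False
        then show ?thesis using elim by (auto simp: dH_def pd_def Wp_neg)
      qed
    qed
  qed measurable
  also have "\<dots> = Mt (h, D, K) h" by (simp add: cm_def)
  finally show ?thesis .
qed

lemma prob_H_le:
  assumes t: "t \<ge> 0" and A: "simple_test (b, D, K)"
  shows "measure \<mu> {x \<in> space \<mu>. fst x \<le> t \<and> fst (snd x) \<in> D \<and> snd (snd x) \<in> K} = f * g * cm (pd D K) t / V t"
proof -
  have D[measurable]: "D \<in> sets borel" using A by (auto simp: simple_test_def)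
  let ?E = "\<lambda>n. {x \<in> space \<mu>. fst x < t + 1 / real (Suc n) \<and> fst (snd x) \<in> D \<and> snd (snd x) \<in> K}"
  have E: "measure \<mu> (?E n) = Mt (t + 1, D, K) (t + 1 / real (Suc n))" for n
  proof -
    have pos: "0 < t + 1 / real (Suc n)" using t by (intro add_nonneg_pos) auto
    have "1 / real (Suc n) \<le> 1" by simp
    then have "min (t + 1 / real (Suc n)) (t + 1) = t + 1 / real (Suc n)" by (simp add: min_def)
    moreover have "measure \<mu> (?E n) = Mt (t + 1 / real (Suc n), D, K) (t + 1 / real (Suc n))"
      by (rule prob_H_less[OF pos]) (use A in \<open>simp add: simple_test_def\<close>)
    ultimately show ?thesis by simp
  qed
  have l1: "(\<lambda>n. measure \<mu> (?E n)) \<longlonglongrightarrow> measure \<mu> (\<Inter>n. ?E n)"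
  proof (rule \<mu>.finite_Lim_measure_decseq)
    show "range ?E \<subseteq> sets \<mu>" by (intro image_subsetI) measurable
    show "decseq ?E"
    proof (rule decseq_SucI)
      fix n
      have "1 / real (Suc (Suc n)) \<le> 1 / real (Suc n)" by (intro divide_left_mono) auto
      then show "?E (Suc n) \<subseteq> ?E n" by (auto simp del: of_nat_Suc)
    qed
  qed
  have i: "(\<Inter>n. ?E n) = {x \<in> space \<mu>. fst x \<le> t \<and> fst (snd x) \<in> D \<and> snd (snd x) \<in> K}"
  proof (intro set_eqI iffI)
    fix x assume x: "x \<in> (\<Inter>n. ?E n)"
    have "fst x \<le> t"
    proof (rule ccontr)
      assume "\<not> fst x \<le> t"
      then obtain n where "inverse (real (Suc n)) < fst x - t" using reals_Archimedean[of "fst x - t"] by auto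
      moreover have "fst x < t + 1 / real (Suc n)" using x by blast
      ultimately show False by (simp add: inverse_eq_divide del: of_nat_Suc)
    qed
    then show "x \<in> {x \<in> space \<mu>. fst x \<le> t \<and> fst (snd x) \<in> D \<and> snd (snd x) \<in> K}" using x by blast
  next
    fix x assume x: "x \<in> {x \<in> space \<mu>. fst x \<le> t \<and> fst (snd x) \<in> D \<and> snd (snd x) \<in> K}"
    have "0 < 1 / real (Suc n)" for n by simp
    then show "x \<in> (\<Inter>n. ?E n)" using x by (auto simp del: of_nat_Suc zero_less_divide_1_iff intro: le_less_trans less_add_same_cancel1[THEN iffD2])
  qed
  have l2: "(\<lambda>n. measure \<mu> (?E n)) \<longlonglongrightarrow> Mt (t + 1, D, K) t"
    unfolding E by (rule ac_right_continuous[OF ac_Mt t]) (use A in \<open>simp add: simple_test_def\<close>)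
  have "measure \<mu> {x \<in> space \<mu>. fst x \<le> t \<and> fst (snd x) \<in> D \<and> snd (snd x) \<in> K} = Mt (t + 1, D, K) t"
    by (rule LIMSEQ_unique[OF l1[unfolded i] l2])
  then show ?thesis by simp
qed

lemma test_prob:
  assumes T: "T > 0" and A: "simple_test A"
  shows "measure \<mu> {x \<in> space \<mu>. fst x \<le> T \<and> tmem x A} = Mt A T"
proof -
  obtain b D K where A': "A = (b, D, K)" by (cases A)
  have D[measurable]: "D \<in> sets borel" using A A' by (simp add: simple_test_def)
  have e: "{x \<in> space \<mu>. fst x \<le> T \<and> tmem x A} = {x \<in> space \<mu>. fst x \<le> min T b \<and> fst (snd x) \<in> D \<and> snd (snd x) \<in> K}"
    by (auto simp: A')
  show ?thesis
  proof (cases "min T b \<ge> 0")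
    case True
    then show ?thesis unfolding e using prob_H_le[OF True A[unfolded A']] by (simp add: A')
  next
    case False
    have "measure \<mu> {x \<in> space \<mu>. fst x \<le> min T b \<and> fst (snd x) \<in> D \<and> snd (snd x) \<in> K} \<le>
      measure \<mu> {x \<in> space \<mu>. fst x \<le> 0 \<and> fst (snd x) \<in> D \<and> snd (snd x) \<in> K}"
      using False by (intro \<mu>.finite_measure_mono) auto
    also have "\<dots> = 0"
      using prob_H_le[OF order_refl A[unfolded A']] cm_nonpos[OF sub_density_pd[OF D], of 0] by simp
    finally have "measure \<mu> {x \<in> space \<mu>. fst x \<le> min T b \<and> fst (snd x) \<in> D \<and> snd (snd x) \<in> K} = 0"
      by (simp add: measure_le_0_iff)
    moreover have "Mt A T = 0" using cm_nonpos[OF sub_density_pd[OF D], of "min T b"] False by (simp add: A')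
    ultimately show ?thesis unfolding e by simp
  qed
qed

end

theorem theorem2:
  fixes g f T :: real and MZ :: "path measure" and v W :: "real \<Rightarrow> real"
    and \<mu> :: "(real \<times> real \<times> nat) measure"
  assumes "g > 0" and "0 < f" and "f \<le> 1" and "T > 0"
    and "nat_markov_process MZ"
    and "lifetime \<in> borel_measurable MZ"
    and "lifetime_density MZ v"
    and "ennreal g * expected_lifetime MZ \<ge> 1"
    and "scale_function g v W"
    and "HAS_law g f MZ W \<mu>"
  shows "\<forall>n B. B \<in> sets (\<Pi>\<^sub>M i\<in>{1..n}. borel \<Otimes>\<^sub>M borel \<Otimes>\<^sub>M count_space UNIV) \<longrightarrow>
     measure (genus_model g f MZ)
        {\<omega> \<in> space (genus_model g f MZ). Nsamp T \<omega> = Suc n \<and>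
            (\<lambda>i\<in>{1..n}. sampled_triple T \<omega> i) \<in> B}
     / measure (genus_model g f MZ) {\<omega> \<in> space (genus_model g f MZ). Nsamp T \<omega> \<ge> 1}
   = measure (\<Pi>\<^sub>M j\<in>UNIV. \<mu>)
        {\<omega> \<in> space (\<Pi>\<^sub>M j\<in>UNIV. \<mu>). (LEAST j. j \<ge> 1 \<and> fst (\<omega> j) > T) = Suc n \<and>
            (\<lambda>j\<in>{1..n}. \<omega> j) \<in> B}"
proof -
  have "genus_data g f MZ"
    using assms unfolding genus_data_def nat_markov_process_def by auto
  then interpret triple_law g f MZ v W \<mu>
    by (intro triple_law.intro genus_scale.intro genus_scale_axioms.intro triple_law_axioms.intro assms)
  interpret killed_sequence g f MZ v W \<mu> T
    by unfold_locales (use assms sets_\<mu> test_prob in auto)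
  show ?thesis using sampled_law by blast
qed

end
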